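(* Let $(R,\mathfrak m)$ be a Noetherian local ring, $I$ an integrally closed $\mathfrak m$-primary ideal of $R$, $M$ a finitely generated $R$-module, and $t\geq 1$ an integer. Then $M$ has projective dimension less than $t$ if and only if $\operatorname{Tor}_t^R(R/I,M)=0$.
   Context: An ideal is integrally closed if it equals its integral closure. *)

theory Defs
  imports "HOL-Library.Extended_Nat" "HOL-Algebra.Module" "HOL-Algebra.Ideal_Product" "HOL-Algebra.Ring_Divisibility"
begin

section \<open>Local rings and integrally closed ideals\<close>

locale local_ring = cring R + maximalideal \<mm> R for R (structure) and \<mm> +
  assumes maximalideal_unique: "maximalideal J R \<Longrightarrow> J = \<mm>"

definition ideal_radical :: "('a, 'r) ring_scheme \<Rightarrow> 'a set \<Rightarrow> 'a set" where
  "ideal_radical R I = {x \<in> carrier R. \<exists>n::nat. n \<ge> 1 \<and> x [^]\<^bsub>R\<^esub> n \<in> I}"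

definition primary_ideal :: "('a, 'r) ring_scheme \<Rightarrow> 'a set \<Rightarrow> bool" where
  "primary_ideal R I \<longleftrightarrow> ideal I R \<and> I \<noteq> carrier R \<and>
     (\<forall>x \<in> carrier R. \<forall>y \<in> carrier R. x \<otimes>\<^bsub>R\<^esub> y \<in> I \<longrightarrow> x \<in> I \<or> y \<in> ideal_radical R I)"

definition primary_to :: "('a, 'r) ring_scheme \<Rightarrow> 'a set \<Rightarrow> 'a set \<Rightarrow> bool" where
  "primary_to R \<pp> I \<longleftrightarrow> primary_ideal R I \<and> ideal_radical R I = \<pp>"

text \<open>
  An element \<open>x\<close> is integral over \<open>I\<close> if it satisfies an equation
  \<open>x^n + a\<^sub>1 x^(n-1) + \<dots> + a\<^sub>n = 0\<close> with \<open>a\<^sub>i \<in> I^i\<close>.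
  Powers of \<open>I\<close> are taken in the monoid \<^const>\<open>ideals_set\<close> of ideals of \<open>R\<close>.
\<close>

definition integral_closure_ideal :: "('a, 'r) ring_scheme \<Rightarrow> 'a set \<Rightarrow> 'a set" where
  "integral_closure_ideal R I = {x \<in> carrier R. \<exists>(n::nat) a. n \<ge> 1 \<and>
     (\<forall>i \<in> {1..n}. a i \<in> I [^]\<^bsub>ideals_set R\<^esub> i) \<and>
     x [^]\<^bsub>R\<^esub> n \<oplus>\<^bsub>R\<^esub> (\<Oplus>\<^bsub>R\<^esub>i\<in>{1..n}. a i \<otimes>\<^bsub>R\<^esub> x [^]\<^bsub>R\<^esub> (n - i)) = \<zero>\<^bsub>R\<^esub>}"

definition integrally_closed_ideal :: "('a, 'r) ring_scheme \<Rightarrow> 'a set \<Rightarrow> bool" where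
  "integrally_closed_ideal R I \<longleftrightarrow> integral_closure_ideal R I = I"


section \<open>Modules\<close>

text \<open>
  The record type \<^typ>\<open>('a, 'b) module\<close> extends the ring record, so it also has the fields
  \<^const>\<open>monoid.mult\<close> and \<^const>\<open>one\<close>. The locale \<^locale>\<open>module\<close> says nothing about these two,
  and nothing below depends on them.
\<close>

definition mod_hom ::
  "('a, 'r) ring_scheme \<Rightarrow> ('a, 'b, 'm) module_scheme \<Rightarrow> ('a, 'c, 'n) module_scheme \<Rightarrow> ('b \<Rightarrow> 'c) set"
where
  "mod_hom R M N = {h \<in> carrier M \<rightarrow> carrier N.
     (\<forall>x \<in> carrier M. \<forall>y \<in> carrier M. h (x \<oplus>\<^bsub>M\<^esub> y) = h x \<oplus>\<^bsub>N\<^esub> h y) \<and>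
     (\<forall>r \<in> carrier R. \<forall>x \<in> carrier M. h (r \<odot>\<^bsub>M\<^esub> x) = r \<odot>\<^bsub>N\<^esub> h x)}"

definition module_span ::
  "('a, 'r) ring_scheme \<Rightarrow> ('a, 'b, 'm) module_scheme \<Rightarrow> 'b set \<Rightarrow> 'b set" where
  "module_span R M S = \<Inter>{H. submodule H R M \<and> S \<subseteq> H}"

definition finitely_generated_module ::
  "('a, 'r) ring_scheme \<Rightarrow> ('a, 'b, 'm) module_scheme \<Rightarrow> bool" where
  "finitely_generated_module R M \<longleftrightarrow> module R M \<and>
     (\<exists>S \<subseteq> carrier M. finite S \<and> module_span R M S = carrier M)"

definition zero_module :: "('a, 'b, 'm) module_scheme \<Rightarrow> bool" where
  "zero_module M \<longleftrightarrow> carrier M = {\<zero>\<^bsub>M\<^esub>}"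

definition regular_module :: "('a, 'r) ring_scheme \<Rightarrow> ('a, 'a) module" where
  "regular_module R = \<lparr>carrier = carrier R, monoid.mult = monoid.mult R, one = one R,
     ring.zero = ring.zero R, add = add R, smult = monoid.mult R\<rparr>"

definition quotient_module ::
  "('a, 'r) ring_scheme \<Rightarrow> ('a, 'b, 'm) module_scheme \<Rightarrow> 'b set \<Rightarrow> ('a, 'b set) module" where
  "quotient_module R M H = \<lparr>carrier = a_rcosets\<^bsub>M\<^esub> H, monoid.mult = undefined, one = undefined,
     ring.zero = H, add = set_add M, smult = (\<lambda>r X. \<Union>x\<in>X. H +>\<^bsub>M\<^esub> (r \<odot>\<^bsub>M\<^esub> x))\<rparr>"

text \<open>The free module on a set \<open>X\<close>: finitely supported functions from \<open>X\<close> to \<open>R\<close>.\<close>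

definition free_module :: "('a, 'r) ring_scheme \<Rightarrow> 'x set \<Rightarrow> ('a, 'x \<Rightarrow> 'a) module" where
  "free_module R X = \<lparr>
     carrier = {f. (\<forall>x \<in> X. f x \<in> carrier R) \<and> (\<forall>x. x \<notin> X \<longrightarrow> f x = \<zero>\<^bsub>R\<^esub>) \<and>
                   finite {x. f x \<noteq> \<zero>\<^bsub>R\<^esub>}},
     monoid.mult = undefined, one = undefined,
     ring.zero = (\<lambda>_. \<zero>\<^bsub>R\<^esub>), add = (\<lambda>f g x. f x \<oplus>\<^bsub>R\<^esub> g x), smult = (\<lambda>r f x. r \<otimes>\<^bsub>R\<^esub> f x)\<rparr>"

definition free_basis :: "('a, 'r) ring_scheme \<Rightarrow> 'x \<Rightarrow> 'x \<Rightarrow> 'a" where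
  "free_basis R x = (\<lambda>y. if y = x then \<one>\<^bsub>R\<^esub> else \<zero>\<^bsub>R\<^esub>)"

text \<open>The linear extension of \<open>\<phi> : X \<rightarrow> M\<close> to the free module on \<open>X\<close>.\<close>

definition lin_ext :: "('a, 'r) ring_scheme \<Rightarrow> ('a, 'b, 'm) module_scheme \<Rightarrow> ('x \<Rightarrow> 'b) \<Rightarrow> ('x \<Rightarrow> 'a) \<Rightarrow> 'b" where
  "lin_ext R M \<phi> f = (\<Oplus>\<^bsub>M\<^esub>x\<in>{x. f x \<noteq> \<zero>\<^bsub>R\<^esub>}. f x \<odot>\<^bsub>M\<^esub> \<phi> x)"

text \<open>
  \<open>P\<close> is projective if every homomorphism from \<open>P\<close> lifts along every surjective homomorphism
  \<open>g : A \<rightarrow> B\<close>. A formula cannot quantify over the types of \<open>A\<close> and \<open>B\<close>. The types chosen here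
  admit \<open>B = P\<close> and the free module \<open>A\<close> on the carrier of \<open>P\<close>; so the property makes \<open>P\<close>
  a direct summand of a free module, and thus gives liftings for \<open>A\<close> and \<open>B\<close> of any types.
\<close>

definition projective_module ::
  "('a, 'r) ring_scheme \<Rightarrow> ('a, 'p) module \<Rightarrow> bool" where
  "projective_module R P \<longleftrightarrow> module R P \<and>
     (\<forall>(A :: ('a, 'p \<Rightarrow> 'a) module) (B :: ('a, 'p) module) g f.
        module R A \<and> module R B \<and> g \<in> mod_hom R A B \<and> g ` carrier A = carrier B \<and>
        f \<in> mod_hom R P B \<longrightarrow>
        (\<exists>h \<in> mod_hom R P A. \<forall>x \<in> carrier P. g (h x) = f x))"


section \<open>Tensor products\<close>

definition tensor_relations ::
  "('a, 'r) ring_scheme \<Rightarrow> ('a, 'b, 'm) module_scheme \<Rightarrow> ('a, 'c, 'n) module_scheme \<Rightarrow>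
   ('b \<times> 'c \<Rightarrow> 'a) set" where
  "tensor_relations R M N =
     (let F = free_module R (carrier M \<times> carrier N); e = free_basis R in
       {e (x \<oplus>\<^bsub>M\<^esub> x', y) \<ominus>\<^bsub>F\<^esub> (e (x, y) \<oplus>\<^bsub>F\<^esub> e (x', y)) | x x' y.
          x \<in> carrier M \<and> x' \<in> carrier M \<and> y \<in> carrier N} \<union>
       {e (x, y \<oplus>\<^bsub>N\<^esub> y') \<ominus>\<^bsub>F\<^esub> (e (x, y) \<oplus>\<^bsub>F\<^esub> e (x, y')) | x y y'.
          x \<in> carrier M \<and> y \<in> carrier N \<and> y' \<in> carrier N} \<union>
       {e (r \<odot>\<^bsub>M\<^esub> x, y) \<ominus>\<^bsub>F\<^esub> r \<odot>\<^bsub>F\<^esub> e (x, y) | r x y.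
          r \<in> carrier R \<and> x \<in> carrier M \<and> y \<in> carrier N} \<union>
       {e (x, r \<odot>\<^bsub>N\<^esub> y) \<ominus>\<^bsub>F\<^esub> r \<odot>\<^bsub>F\<^esub> e (x, y) | r x y.
          r \<in> carrier R \<and> x \<in> carrier M \<and> y \<in> carrier N})"

definition tensor_null ::
  "('a, 'r) ring_scheme \<Rightarrow> ('a, 'b, 'm) module_scheme \<Rightarrow> ('a, 'c, 'n) module_scheme \<Rightarrow>
   ('b \<times> 'c \<Rightarrow> 'a) set" where
  "tensor_null R M N =
     module_span R (free_module R (carrier M \<times> carrier N)) (tensor_relations R M N)"

definition tensor_module ::
  "('a, 'r) ring_scheme \<Rightarrow> ('a, 'b, 'm) module_scheme \<Rightarrow> ('a, 'c, 'n) module_scheme \<Rightarrow>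
   ('a, ('b \<times> 'c \<Rightarrow> 'a) set) module" where
  "tensor_module R M N =
     quotient_module R (free_module R (carrier M \<times> carrier N)) (tensor_null R M N)"

definition pure_tensor ::
  "('a, 'r) ring_scheme \<Rightarrow> ('a, 'b, 'm) module_scheme \<Rightarrow> ('a, 'c, 'n) module_scheme \<Rightarrow>
   'b \<Rightarrow> 'c \<Rightarrow> ('b \<times> 'c \<Rightarrow> 'a) set" where
  "pure_tensor R M N x y =
     tensor_null R M N +>\<^bsub>free_module R (carrier M \<times> carrier N)\<^esub> free_basis R (x, y)"

text \<open>
  The map \<open>\<phi> \<otimes> \<psi> : M \<otimes> N \<rightarrow> M' \<otimes> N'\<close>: the linear extension of
  \<open>(x, y) \<mapsto> \<phi> x \<otimes> \<psi> y\<close> to formal combinations \<open>f\<close> of pairs takes a single value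
  on each coset \<open>X\<close> of \<^const>\<open>tensor_null\<close>.
\<close>

definition tensor_map ::
  "('a, 'r) ring_scheme \<Rightarrow> ('a, 'b, 'm) module_scheme \<Rightarrow> ('a, 'c, 'n) module_scheme \<Rightarrow>
   ('b \<Rightarrow> 'b) \<Rightarrow> ('c \<Rightarrow> 'c) \<Rightarrow> ('b \<times> 'c \<Rightarrow> 'a) set \<Rightarrow> ('b \<times> 'c \<Rightarrow> 'a) set" where
  "tensor_map R M' N' \<phi> \<psi> X =
     the_elem (lin_ext R (tensor_module R M' N')
       (\<lambda>(x, y). pure_tensor R M' N' (\<phi> x) (\<psi> y)) ` X)"


section \<open>Projective resolutions, projective dimension and Tor\<close>

text \<open>
  The complex \<open>\<dots> \<rightarrow> P 2 \<rightarrow> P 1 \<rightarrow> P 0 \<rightarrow> M \<rightarrow> 0\<close> with differentials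
  \<open>d n : P (n + 1) \<rightarrow> P n\<close> and augmentation \<open>\<epsilon> : P 0 \<rightarrow> M\<close> is exact.
\<close>

definition projective_resolution ::
  "('a, 'r) ring_scheme \<Rightarrow> ('a, 'b, 'm) module_scheme \<Rightarrow>
   (nat \<Rightarrow> ('a, 'p) module) \<Rightarrow> (nat \<Rightarrow> 'p \<Rightarrow> 'p) \<Rightarrow> ('p \<Rightarrow> 'b) \<Rightarrow> bool" where
  "projective_resolution R M P d \<epsilon> \<longleftrightarrow>
     (\<forall>n. projective_module R (P n)) \<and>
     (\<forall>n. d n \<in> mod_hom R (P (Suc n)) (P n)) \<and>
     \<epsilon> \<in> mod_hom R (P 0) M \<and>
     \<epsilon> ` carrier (P 0) = carrier M \<and>
     d 0 ` carrier (P 1) = a_kernel (P 0) M \<epsilon> \<and>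
     (\<forall>n. d (Suc n) ` carrier (P (Suc (Suc n))) = a_kernel (P (Suc n)) (P n) (d n))"

text \<open>
  Projective dimension and Tor are computed from resolutions whose terms have the fixed element
  type \<^typ>\<open>('a + 'b) list \<Rightarrow> 'a\<close>, which contains the free modules on all sets of lists.
  This type is large enough for every module \<open>M\<close>: the infinite type \<^typ>\<open>('a + 'b) list\<close> has at
  least as many elements as \<open>R\<close> and \<open>M\<close>, hence indexes generators of \<open>M\<close> and of every submodule
  of a free module on a set of lists. So a free resolution exists in this type (proved below), and
  (replacing its \<open>n\<close>-th term by the \<open>n\<close>-th syzygy, or by a copy of \<open>M\<close> if \<open>n = 0\<close>) it can be
  truncated to length \<open>n\<close> if \<open>M\<close> has any projective resolution of length \<open>n\<close>.
\<close>

text \<open>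
  The zero module gets projective dimension \<open>0\<close>; a module without a finite projective
  resolution gets \<open>\<infinity>\<close>, the infimum of the empty set.
\<close>

definition projective_dimension ::
  "('a, 'r) ring_scheme \<Rightarrow> ('a, 'b, 'm) module_scheme \<Rightarrow> enat" where
  "projective_dimension R M = Inf {enat n | n.
     \<exists>(P :: nat \<Rightarrow> ('a, ('a + 'b) list \<Rightarrow> 'a) module) d \<epsilon>.
       projective_resolution R M P d \<epsilon> \<and> (\<forall>i > n. zero_module (P i))}"

definition chosen_resolution ::
  "('a, 'r) ring_scheme \<Rightarrow> ('a, 'b, 'm) module_scheme \<Rightarrow>
   (nat \<Rightarrow> ('a, ('a + 'b) list \<Rightarrow> 'a) module) \<times>
   (nat \<Rightarrow> (('a + 'b) list \<Rightarrow> 'a) \<Rightarrow> (('a + 'b) list \<Rightarrow> 'a))" where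
  "chosen_resolution R M = (SOME (P, d). \<exists>\<epsilon>. projective_resolution R M P d \<epsilon>)"

text \<open>Homology of a complex with differentials \<open>\<delta> n : C (n + 1) \<rightarrow> C n\<close> and \<open>C n = 0\<close> for \<open>n < 0\<close>.\<close>

fun cycles :: "(nat \<Rightarrow> ('a, 'c) module) \<Rightarrow> (nat \<Rightarrow> 'c \<Rightarrow> 'c) \<Rightarrow> nat \<Rightarrow> 'c set" where
  "cycles C \<delta> 0 = carrier (C 0)"
| "cycles C \<delta> (Suc n) = a_kernel (C (Suc n)) (C n) (\<delta> n)"

definition homology_module ::
  "('a, 'r) ring_scheme \<Rightarrow> (nat \<Rightarrow> ('a, 'c) module) \<Rightarrow> (nat \<Rightarrow> 'c \<Rightarrow> 'c) \<Rightarrow> nat \<Rightarrow>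
   ('a, 'c set) module" where
  "homology_module R C \<delta> n =
     quotient_module R ((C n)\<lparr>carrier := cycles C \<delta> n\<rparr>) (\<delta> n ` carrier (C (Suc n)))"

text \<open>\<open>Tor n R N M\<close> is the \<open>n\<close>-th homology of \<open>N \<otimes> P\<close> for a projective resolution \<open>P\<close> of \<open>M\<close>.\<close>

definition Tor ::
  "nat \<Rightarrow> ('a, 'r) ring_scheme \<Rightarrow> ('a, 'c, 'n) module_scheme \<Rightarrow> ('a, 'b, 'm) module_scheme \<Rightarrow>
   ('a, ('c \<times> (('a + 'b) list \<Rightarrow> 'a) \<Rightarrow> 'a) set set) module" where
  "Tor n R N M = (case chosen_resolution R M of (P, d) \<Rightarrow>
     homology_module R (\<lambda>i. tensor_module R N (P i))
       (\<lambda>i. tensor_map R N (P i) (\<lambda>x. x) (d i)) n)"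


section \<open>Existence of the chosen resolution\<close>

lemma module_free_module:
  fixes R :: "('a, 'r) ring_scheme" and X :: "'x set"
  assumes "cring R" shows "module R (free_module R X)"
proof -
  interpret R: cring R by fact
  have fin: "finite {x. f x \<oplus>\<^bsub>R\<^esub> g x \<noteq> \<zero>\<^bsub>R\<^esub>}"
    if "finite {x. f x \<noteq> \<zero>\<^bsub>R\<^esub>}" "finite {x. g x \<noteq> \<zero>\<^bsub>R\<^esub>}" for f g :: "'x \<Rightarrow> 'a"
    by (rule finite_subset[OF _ finite_UnI[OF that]]) auto
  have fin2: "finite {x. r \<otimes>\<^bsub>R\<^esub> f x \<noteq> \<zero>\<^bsub>R\<^esub>}"
    if "finite {x. f x \<noteq> \<zero>\<^bsub>R\<^esub>}" "r \<in> carrier R" for f :: "'x \<Rightarrow> 'a" and r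
    by (rule finite_subset[OF _ that(1)]) (use that in auto)
  have cl: "f x \<in> carrier R" if "f \<in> carrier (free_module R X)" for f x
    using that by (cases "x \<in> X") (auto simp: free_module_def)
  have ag: "abelian_group (free_module R X)"
  proof (rule abelian_groupI)
    fix f assume f: "f \<in> carrier (free_module R X)"
    have "{x. \<ominus>\<^bsub>R\<^esub> f x \<noteq> \<zero>\<^bsub>R\<^esub>} = {x. f x \<noteq> \<zero>\<^bsub>R\<^esub>}"
      using cl[OF f] by auto
    then show "\<exists>y\<in>carrier (free_module R X). y \<oplus>\<^bsub>free_module R X\<^esub> f = \<zero>\<^bsub>free_module R X\<^esub>"
      using f cl[OF f]
      by (intro bexI[of _ "\<lambda>x. \<ominus>\<^bsub>R\<^esub> f x"]) (auto simp: free_module_def R.l_neg)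
  next
    fix f g assume "f \<in> carrier (free_module R X)" "g \<in> carrier (free_module R X)"
    then show "f \<oplus>\<^bsub>free_module R X\<^esub> g \<in> carrier (free_module R X)"
      by (auto simp: free_module_def fin)
  next
    fix f g assume "f \<in> carrier (free_module R X)" "g \<in> carrier (free_module R X)"
    from this[THEN cl] show "f \<oplus>\<^bsub>free_module R X\<^esub> g = g \<oplus>\<^bsub>free_module R X\<^esub> f"
      by (simp add: free_module_def R.a_comm)
  next
    fix f g h assume "f \<in> carrier (free_module R X)" "g \<in> carrier (free_module R X)"
      "h \<in> carrier (free_module R X)"
    from this[THEN cl]
    show "f \<oplus>\<^bsub>free_module R X\<^esub> g \<oplus>\<^bsub>free_module R X\<^esub> h = f \<oplus>\<^bsub>free_module R X\<^esub> (g \<oplus>\<^bsub>free_module R X\<^esub> h)"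
      by (simp add: free_module_def R.a_assoc)
  next
    fix f assume "f \<in> carrier (free_module R X)"
    from this[THEN cl] show "\<zero>\<^bsub>free_module R X\<^esub> \<oplus>\<^bsub>free_module R X\<^esub> f = f"
      by (simp add: free_module_def)
  qed (simp add: free_module_def)
  show ?thesis
  proof (rule moduleI[OF assms ag])
    fix a f assume "a \<in> carrier R" "f \<in> carrier (free_module R X)"
    then show "a \<odot>\<^bsub>free_module R X\<^esub> f \<in> carrier (free_module R X)"
      by (auto simp: free_module_def fin2)
  next
    fix a b f assume "a \<in> carrier R" "b \<in> carrier R" "f \<in> carrier (free_module R X)"
    with cl[OF this(3)] show "(a \<oplus>\<^bsub>R\<^esub> b) \<odot>\<^bsub>free_module R X\<^esub> f =
        a \<odot>\<^bsub>free_module R X\<^esub> f \<oplus>\<^bsub>free_module R X\<^esub> b \<odot>\<^bsub>free_module R X\<^esub> f"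
      by (simp add: free_module_def R.l_distr)
  next
    fix a f g assume "a \<in> carrier R" "f \<in> carrier (free_module R X)" "g \<in> carrier (free_module R X)"
    with cl[OF this(2)] cl[OF this(3)]
    show "a \<odot>\<^bsub>free_module R X\<^esub> (f \<oplus>\<^bsub>free_module R X\<^esub> g) =
        a \<odot>\<^bsub>free_module R X\<^esub> f \<oplus>\<^bsub>free_module R X\<^esub> a \<odot>\<^bsub>free_module R X\<^esub> g"
      by (simp add: free_module_def R.r_distr)
  next
    fix a b f assume "a \<in> carrier R" "b \<in> carrier R" "f \<in> carrier (free_module R X)"
    with cl[OF this(3)] show "a \<otimes>\<^bsub>R\<^esub> b \<odot>\<^bsub>free_module R X\<^esub> f =
        a \<odot>\<^bsub>free_module R X\<^esub> (b \<odot>\<^bsub>free_module R X\<^esub> f)"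
      by (simp add: free_module_def R.m_assoc)
  next
    fix f assume "f \<in> carrier (free_module R X)"
    with cl[OF this] show "\<one>\<^bsub>R\<^esub> \<odot>\<^bsub>free_module R X\<^esub> f = f"
      by (simp add: free_module_def)
  qed
qed

lemma free_carrier: "f \<in> carrier (free_module R X) \<Longrightarrow> x \<in> X \<Longrightarrow> f x \<in> carrier R"
  "f \<in> carrier (free_module R X) \<Longrightarrow> f x \<noteq> \<zero>\<^bsub>R\<^esub> \<Longrightarrow> x \<in> X"
  "f \<in> carrier (free_module R X) \<Longrightarrow> finite {x. f x \<noteq> \<zero>\<^bsub>R\<^esub>}"
  by (auto simp: free_module_def)

lemma free_basis_carrier:
  assumes "cring R" "x \<in> X" shows "free_basis R x \<in> carrier (free_module R X)"
proof -
  interpret R: cring R by fact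
  have "finite {y. free_basis R x y \<noteq> \<zero>\<^bsub>R\<^esub>}"
    by (rule finite_subset[of _ "{x}"]) (auto simp: free_basis_def)
  then show ?thesis using assms by (auto simp: free_module_def free_basis_def)
qed

lemma lin_ext_eq:
  assumes "module R M" "f \<in> carrier (free_module R X)" "\<phi> \<in> X \<rightarrow> carrier M"
    "finite A" "A \<subseteq> X" "{x. f x \<noteq> \<zero>\<^bsub>R\<^esub>} \<subseteq> A"
  shows "lin_ext R M \<phi> f = (\<Oplus>\<^bsub>M\<^esub>x\<in>A. f x \<odot>\<^bsub>M\<^esub> \<phi> x)"
proof -
  interpret module R M by fact
  show ?thesis unfolding lin_ext_def
    by (rule M.add.finprod_mono_neutral_cong_left)
       (use assms free_carrier in \<open>fastforce simp: Pi_iff\<close>)+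
qed

lemma lin_ext_hom:
  assumes M: "module R M" and \<phi>: "\<phi> \<in> X \<rightarrow> carrier M"
  shows "lin_ext R M \<phi> \<in> mod_hom R (free_module R X) M"
proof -
  interpret module R M by fact
  interpret F: module R "free_module R X" by (rule module_free_module) (rule R.is_cring)
  have cl: "f x \<odot>\<^bsub>M\<^esub> \<phi> x \<in> carrier M" if "f \<in> carrier (free_module R X)" "x \<in> X" for f x
    using that \<phi> free_carrier by fastforce
  have 1: "lin_ext R M \<phi> f \<in> carrier M" if f: "f \<in> carrier (free_module R X)" for f
    unfolding lin_ext_def using cl[OF f] free_carrier(2)[OF f] by (intro M.finsum_closed) auto
  have 2: "lin_ext R M \<phi> (f \<oplus>\<^bsub>free_module R X\<^esub> g) = lin_ext R M \<phi> f \<oplus>\<^bsub>M\<^esub> lin_ext R M \<phi> g"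
    if f: "f \<in> carrier (free_module R X)" and g: "g \<in> carrier (free_module R X)" for f g
  proof -
    define A where "A = {x. f x \<noteq> \<zero>\<^bsub>R\<^esub>} \<union> {x. g x \<noteq> \<zero>\<^bsub>R\<^esub>}"
    have A: "finite A" "A \<subseteq> X" using free_carrier[OF f] free_carrier[OF g] by (auto simp: A_def)
    have s: "{x. (f \<oplus>\<^bsub>free_module R X\<^esub> g) x \<noteq> \<zero>\<^bsub>R\<^esub>} \<subseteq> A"
      by (auto simp: A_def free_module_def)
    have "lin_ext R M \<phi> (f \<oplus>\<^bsub>free_module R X\<^esub> g)
       = (\<Oplus>\<^bsub>M\<^esub>x\<in>A. (f \<oplus>\<^bsub>free_module R X\<^esub> g) x \<odot>\<^bsub>M\<^esub> \<phi> x)"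
      by (rule lin_ext_eq[OF M _ \<phi> A s]) (simp add: f g)
    also have "\<dots> = (\<Oplus>\<^bsub>M\<^esub>x\<in>A. f x \<odot>\<^bsub>M\<^esub> \<phi> x \<oplus>\<^bsub>M\<^esub> g x \<odot>\<^bsub>M\<^esub> \<phi> x)"
    proof (rule M.finsum_cong'[OF refl])
      show "(\<lambda>x. f x \<odot>\<^bsub>M\<^esub> \<phi> x \<oplus>\<^bsub>M\<^esub> g x \<odot>\<^bsub>M\<^esub> \<phi> x) \<in> A \<rightarrow> carrier M"
        using cl f g A by auto
      fix x assume "x \<in> A"
      then have "x \<in> X" using A by auto
      then show "(f \<oplus>\<^bsub>free_module R X\<^esub> g) x \<odot>\<^bsub>M\<^esub> \<phi> x = f x \<odot>\<^bsub>M\<^esub> \<phi> x \<oplus>\<^bsub>M\<^esub> g x \<odot>\<^bsub>M\<^esub> \<phi> x"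
        using free_carrier(1)[OF f] free_carrier(1)[OF g] \<phi>
        by (simp add: free_module_def Pi_iff smult_l_distr)
    qed
    also have "\<dots> = (\<Oplus>\<^bsub>M\<^esub>x\<in>A. f x \<odot>\<^bsub>M\<^esub> \<phi> x) \<oplus>\<^bsub>M\<^esub> (\<Oplus>\<^bsub>M\<^esub>x\<in>A. g x \<odot>\<^bsub>M\<^esub> \<phi> x)"
      by (rule M.finsum_addf) (use cl f g A in auto)
    also have "\<dots> = lin_ext R M \<phi> f \<oplus>\<^bsub>M\<^esub> lin_ext R M \<phi> g"
      using lin_ext_eq[OF M f \<phi> A] lin_ext_eq[OF M g \<phi> A] by (auto simp: A_def)
    finally show ?thesis .
  qed
  have 3: "lin_ext R M \<phi> (r \<odot>\<^bsub>free_module R X\<^esub> f) = r \<odot>\<^bsub>M\<^esub> lin_ext R M \<phi> f"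
    if r: "r \<in> carrier R" and f: "f \<in> carrier (free_module R X)" for r f
  proof -
    let ?A = "{x. f x \<noteq> \<zero>\<^bsub>R\<^esub>}"
    have A: "finite ?A" "?A \<subseteq> X" using free_carrier[OF f] by auto
    have s: "{x. (r \<odot>\<^bsub>free_module R X\<^esub> f) x \<noteq> \<zero>\<^bsub>R\<^esub>} \<subseteq> ?A"
      using r by (auto simp: free_module_def)
    have "lin_ext R M \<phi> (r \<odot>\<^bsub>free_module R X\<^esub> f)
       = (\<Oplus>\<^bsub>M\<^esub>x\<in>?A. (r \<odot>\<^bsub>free_module R X\<^esub> f) x \<odot>\<^bsub>M\<^esub> \<phi> x)"
      by (rule lin_ext_eq[OF M _ \<phi> A s]) (simp add: f r)
    also have "\<dots> = (\<Oplus>\<^bsub>M\<^esub>x\<in>?A. r \<odot>\<^bsub>M\<^esub> (f x \<odot>\<^bsub>M\<^esub> \<phi> x))"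
    proof (rule M.finsum_cong'[OF refl])
      show "(\<lambda>x. r \<odot>\<^bsub>M\<^esub> (f x \<odot>\<^bsub>M\<^esub> \<phi> x)) \<in> ?A \<rightarrow> carrier M"
        using cl f r A by auto
      fix x assume "x \<in> ?A"
      then have "x \<in> X" using A by auto
      then show "(r \<odot>\<^bsub>free_module R X\<^esub> f) x \<odot>\<^bsub>M\<^esub> \<phi> x = r \<odot>\<^bsub>M\<^esub> (f x \<odot>\<^bsub>M\<^esub> \<phi> x)"
        using free_carrier(1)[OF f] r \<phi> by (simp add: free_module_def Pi_iff smult_assoc1)
    qed
    also have "\<dots> = r \<odot>\<^bsub>M\<^esub> lin_ext R M \<phi> f"
      unfolding lin_ext_def by (rule finsum_smult_ldistr[symmetric]) (use A r cl f in auto)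
    finally show ?thesis .
  qed
  show ?thesis using 1 2 3 by (auto simp: mod_hom_def)
qed

lemma lin_ext_basis:
  assumes M: "module R M" and \<phi>: "\<phi> \<in> X \<rightarrow> carrier M" and x: "x \<in> X"
  shows "lin_ext R M \<phi> (free_basis R x) = \<phi> x"
proof -
  interpret module R M by fact
  have val: "free_basis R x x \<odot>\<^bsub>M\<^esub> \<phi> x = \<phi> x" "\<phi> x \<in> carrier M"
    using \<phi> x by (simp_all add: free_basis_def Pi_iff)
  have supp: "{y. free_basis R x y \<noteq> \<zero>\<^bsub>R\<^esub>} \<subseteq> {x}"
    by (auto simp: free_basis_def split: if_splits)
  have "lin_ext R M \<phi> (free_basis R x) = (\<Oplus>\<^bsub>M\<^esub>y\<in>{x}. free_basis R x y \<odot>\<^bsub>M\<^esub> \<phi> y)"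
    by (rule lin_ext_eq[OF M free_basis_carrier[OF R.is_cring x] \<phi> _ _ supp]) (simp_all add: x)
  also have "\<dots> = \<phi> x"
    using M.finsum_insert[of "{}" x "\<lambda>y. free_basis R x y \<odot>\<^bsub>M\<^esub> \<phi> y"] val by simp
  finally show ?thesis .
qed

lemma mod_hom_zero:
  assumes "module R M" "module R N" "h \<in> mod_hom R M N"
  shows "h \<zero>\<^bsub>M\<^esub> = \<zero>\<^bsub>N\<^esub>"
proof -
  interpret M: module R M by fact
  interpret N: module R N by fact
  have lin: "\<forall>r\<in>carrier R. \<forall>x\<in>carrier M. h (r \<odot>\<^bsub>M\<^esub> x) = r \<odot>\<^bsub>N\<^esub> h x"
    and closed: "h \<zero>\<^bsub>M\<^esub> \<in> carrier N"
    using assms(3) by (auto simp: mod_hom_def)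
  have "h (\<zero>\<^bsub>R\<^esub> \<odot>\<^bsub>M\<^esub> \<zero>\<^bsub>M\<^esub>) = \<zero>\<^bsub>R\<^esub> \<odot>\<^bsub>N\<^esub> h \<zero>\<^bsub>M\<^esub>"
    by (rule lin[rule_format]) simp_all
  then show ?thesis using closed by simp
qed

lemma mod_homD:
  assumes "h \<in> mod_hom R M N"
  shows "x \<in> carrier M \<Longrightarrow> h x \<in> carrier N"
    and "x \<in> carrier M \<Longrightarrow> y \<in> carrier M \<Longrightarrow> h (x \<oplus>\<^bsub>M\<^esub> y) = h x \<oplus>\<^bsub>N\<^esub> h y"
    and "r \<in> carrier R \<Longrightarrow> x \<in> carrier M \<Longrightarrow> h (r \<odot>\<^bsub>M\<^esub> x) = r \<odot>\<^bsub>N\<^esub> h x"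
  using assms by (auto simp: mod_hom_def)

lemma mod_hom_comp:
  assumes "h \<in> mod_hom R M N" "g \<in> mod_hom R N L"
  shows "(\<lambda>x. g (h x)) \<in> mod_hom R M L"
proof -
  note h = mod_homD[OF assms(1)] and g = mod_homD[OF assms(2)]
  show ?thesis unfolding mod_hom_def by (simp add: h g)
qed

lemma free_hom_eqI:
  assumes N: "module R N"
    and g: "g \<in> mod_hom R (free_module R X) N" and h: "h \<in> mod_hom R (free_module R X) N"
    and eq: "\<And>x. x \<in> X \<Longrightarrow> g (free_basis R x) = h (free_basis R x)"
    and f: "f \<in> carrier (free_module R X)"
  shows "g f = h f"
proof -
  interpret N: module R N by fact
  interpret F: module R "free_module R X" by (rule module_free_module) (rule N.R.is_cring)
  have "finite A \<Longrightarrow> f \<in> carrier (free_module R X) \<Longrightarrow> {x. f x \<noteq> \<zero>\<^bsub>R\<^esub>} \<subseteq> A \<Longrightarrow> g f = h f" for A f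
  proof (induction A arbitrary: f rule: finite_induct)
    case empty
    then have "f = \<zero>\<^bsub>free_module R X\<^esub>" by (auto simp: free_module_def)
    then show ?case using mod_hom_zero[OF F.module_axioms N g] mod_hom_zero[OF F.module_axioms N h] by simp
  next
    case (insert x A)
    show ?case
    proof (cases "x \<in> X")
      case False
      then have "{x. f x \<noteq> \<zero>\<^bsub>R\<^esub>} \<subseteq> A" using insert.prems free_carrier(2) by fastforce
      then show ?thesis using insert by blast
    next
      case x: True
      let ?u = "f(x := \<zero>\<^bsub>R\<^esub>)" and ?b = "free_basis R x"
      have sub: "{y. ?u y \<noteq> \<zero>\<^bsub>R\<^esub>} \<subseteq> {y. f y \<noteq> \<zero>\<^bsub>R\<^esub>}" by auto
      have u: "?u \<in> carrier (free_module R X)"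
        using insert.prems(1) finite_subset[OF sub] by (auto simp: free_module_def)
      have b: "?b \<in> carrier (free_module R X)" by (rule free_basis_carrier[OF N.R.is_cring x])
      have fx: "f y \<in> carrier R" for y
        using insert.prems(1) by (cases "y \<in> X") (auto simp: free_module_def)
      have dec: "f = ?u \<oplus>\<^bsub>free_module R X\<^esub> f x \<odot>\<^bsub>free_module R X\<^esub> ?b"
        using fx by (auto simp: free_module_def free_basis_def intro!: ext)
      have "g ?u = h ?u" by (rule insert.IH[OF u]) (use insert.prems in auto)
      moreover have dec_hom: "k f = k ?u \<oplus>\<^bsub>N\<^esub> f x \<odot>\<^bsub>N\<^esub> k ?b" if "k \<in> mod_hom R (free_module R X) N" for k
        using that u b fx by (subst dec) (simp add: mod_hom_def)
      ultimately show ?thesis using dec_hom[OF g] dec_hom[OF h] eq[OF x] by argo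
    qed
  qed
  from this[OF free_carrier(3)[OF f] f] show ?thesis by simp
qed

lemma projective_free_module:
  assumes "cring R" shows "projective_module R (free_module R X)"
  unfolding projective_module_def
proof (intro conjI allI impI, goal_cases)
  case 1 show ?case by (rule module_free_module[OF assms])
next
  case (2 A B g f)
  then have A: "module R A" and B: "module R B" and g: "g \<in> mod_hom R A B"
    and s: "g ` carrier A = carrier B" and f: "f \<in> mod_hom R (free_module R X) B" by auto
  define \<phi> where "\<phi> = (\<lambda>x. SOME a. a \<in> carrier A \<and> g a = f (free_basis R x))"
  have \<phi>: "\<phi> x \<in> carrier A \<and> g (\<phi> x) = f (free_basis R x)" if "x \<in> X" for x
  proof -
    have "f (free_basis R x) \<in> g ` carrier A"
      unfolding s by (rule mod_homD(1)[OF f free_basis_carrier[OF assms that]])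
    then have "\<exists>a. a \<in> carrier A \<and> g a = f (free_basis R x)" by auto
    then show ?thesis unfolding \<phi>_def by (rule someI_ex)
  qed
  then have \<phi>X: "\<phi> \<in> X \<rightarrow> carrier A" by auto
  have h: "lin_ext R A \<phi> \<in> mod_hom R (free_module R X) A" by (rule lin_ext_hom[OF A \<phi>X])
  have eq: "g (lin_ext R A \<phi> u) = f u" if "u \<in> carrier (free_module R X)" for u
  proof (rule free_hom_eqI[OF B mod_hom_comp[OF h g] f _ that])
    fix x assume "x \<in> X"
    then show "g (lin_ext R A \<phi> (free_basis R x)) = f (free_basis R x)"
      by (simp only: lin_ext_basis[OF A \<phi>X] \<phi>)
  qed
  show ?case by (rule bexI[OF _ h]) (simp add: eq)
qed

lemma lin_ext_surj:
  assumes "module R M" "\<phi> ` X = carrier M"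
  shows "lin_ext R M \<phi> ` carrier (free_module R X) = carrier M"
proof -
  interpret module R M by fact
  have \<phi>: "\<phi> \<in> X \<rightarrow> carrier M" using assms by auto
  have "lin_ext R M \<phi> \<in> carrier (free_module R X) \<rightarrow> carrier M"
    using lin_ext_hom[OF assms(1) \<phi>] by (auto simp: mod_hom_def)
  moreover have "\<phi> x \<in> lin_ext R M \<phi> ` carrier (free_module R X)" if "x \<in> X" for x
    using lin_ext_basis[OF assms(1) \<phi> that] free_basis_carrier[OF R.is_cring that] by (metis imageI)
  ultimately show ?thesis unfolding assms(2)[symmetric] by blast
qed

lemma submodule_kernel:
  assumes "module R M" "module R N" "h \<in> mod_hom R M N"
  shows "submodule (a_kernel M N h) R M"
proof -
  interpret M: module R M by fact
  interpret N: module R N by fact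
  have z: "h \<zero>\<^bsub>M\<^esub> = \<zero>\<^bsub>N\<^esub>" by (rule mod_hom_zero[OF assms])
  have inv: "\<ominus>\<^bsub>M\<^esub> x = (\<ominus>\<^bsub>R\<^esub> \<one>\<^bsub>R\<^esub>) \<odot>\<^bsub>M\<^esub> x" if "x \<in> carrier M" for x
    using that by (simp add: M.smult_l_minus)
  have sm: "h (r \<odot>\<^bsub>M\<^esub> x) = r \<odot>\<^bsub>N\<^esub> h x" if "r \<in> carrier R" "x \<in> carrier M" for r x
    using assms(3) that by (auto simp: mod_hom_def)
  have ad: "h (x \<oplus>\<^bsub>M\<^esub> y) = h x \<oplus>\<^bsub>N\<^esub> h y" if "x \<in> carrier M" "y \<in> carrier M" for x y
    using assms(3) that by (auto simp: mod_hom_def)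
  show ?thesis
    by (rule M.submoduleI) (auto simp: a_kernel_def kernel_def z inv sm ad simp del: M.smult_l_minus)
qed

text \<open>
  An injection of the finitely supported functions \<^typ>\<open>('a + 'b) list \<Rightarrow> 'a\<close> into the index type
  \<^typ>\<open>('a + 'b) list\<close>: a function is listed as its pairs \<open>(x, f x)\<close> with \<open>f x \<noteq> 0\<close>, and the
  code of a word \<open>x\<close> is made self-delimiting by putting a left summand before each letter and a
  right summand at the end.
\<close>

fun word_code :: "('a + 'b) list \<Rightarrow> ('a + 'b) list" where
  "word_code [] = [Inr undefined]"
| "word_code (s # xs) = Inl undefined # s # word_code xs"

fun list_code :: "(('a + 'b) list \<times> 'a) list \<Rightarrow> ('a + 'b) list" where
  "list_code [] = []"
| "list_code ((x, a) # ps) = word_code x @ Inl a # list_code ps"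

lemma word_code_inj: "word_code xs @ zs = word_code ys @ ws \<Longrightarrow> xs = ys \<and> zs = ws"
proof (induction xs arbitrary: ys)
  case Nil then show ?case by (cases ys) auto
next
  case (Cons s xs) then show ?case by (cases ys) auto
qed

lemma word_code_nonempty [simp]: "word_code xs \<noteq> []" by (cases xs) auto

lemma list_code_inj: "list_code ps = list_code qs \<Longrightarrow> ps = qs"
proof (induction ps arbitrary: qs rule: list_code.induct)
  case 1 then show ?case by (cases qs rule: list_code.cases) auto
next
  case (2 x a ps)
  then show ?case
    by (cases qs rule: list_code.cases) (auto dest: word_code_inj)
qed

definition finsupp_code :: "('a, 'r) ring_scheme \<Rightarrow> (('a + 'b) list \<Rightarrow> 'a) \<Rightarrow> ('a + 'b) list" where
  "finsupp_code R f = list_code (SOME l. set l = {(x, f x) | x. f x \<noteq> \<zero>\<^bsub>R\<^esub>})"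

lemma finsupp_code_inj: "inj_on (finsupp_code R) (carrier (free_module R X))"
proof (rule inj_onI)
  fix f g assume f: "f \<in> carrier (free_module R X)" and g: "g \<in> carrier (free_module R X)"
    and eq: "finsupp_code R f = finsupp_code R g"
  let ?S = "\<lambda>f. {(x, f x) | x. f x \<noteq> \<zero>\<^bsub>R\<^esub>}"
  have s: "set (SOME l. set l = ?S f) = ?S f" if f: "f \<in> carrier (free_module R X)" for f
  proof -
    have "finite (?S f)" using free_carrier(3)[OF f] by (rule finite_image_set)
    then have "\<exists>l. set l = ?S f" by (rule finite_list)
    then show ?thesis by (rule someI_ex)
  qed
  have "(SOME l. set l = ?S f) = (SOME l. set l = ?S g)"
    by (rule list_code_inj) (use eq in \<open>simp only: finsupp_code_def\<close>)
  then have "?S f = ?S g" by (metis (lifting) s[OF f] s[OF g])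
  then have mem: "p \<in> ?S f \<longleftrightarrow> p \<in> ?S g" for p by (rule arg_cong)
  show "f = g"
  proof
    fix x
    have "f x \<noteq> \<zero>\<^bsub>R\<^esub> \<longrightarrow> f x = g x" using mem[of "(x, f x)"] by auto
    moreover have "g x \<noteq> \<zero>\<^bsub>R\<^esub> \<longrightarrow> f x = g x" using mem[of "(x, g x)"] by auto
    ultimately show "f x = g x" by argo
  qed
qed

theorem projective_resolution_exists:
  fixes R :: "('a, 'r) ring_scheme" and M :: "('a, 'b, 'm) module_scheme"
  assumes M: "module R M"
  shows "\<exists>(P :: nat \<Rightarrow> ('a, ('a + 'b) list \<Rightarrow> 'a) module) d \<epsilon>. projective_resolution R M P d \<epsilon>"
proof -
  interpret M: module R M by fact
  have cr: "cring R" by (rule M.R.is_cring)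
  let ?F = "free_module R :: ('a + 'b) list set \<Rightarrow> _"
  define X0 :: "('a + 'b) list set" where "X0 = (\<lambda>m. [Inr m]) ` carrier M"
  define \<phi>0 :: "('a + 'b) list \<Rightarrow> 'b" where "\<phi>0 = (\<lambda>l. projr (hd l))"
  have \<phi>0: "\<phi>0 ` X0 = carrier M" by (force simp: X0_def \<phi>0_def)
  define \<epsilon> where "\<epsilon> = lin_ext R M \<phi>0"
  have \<epsilon>: "\<epsilon> \<in> mod_hom R (?F X0) M" "\<epsilon> ` carrier (?F X0) = carrier M"
    unfolding \<epsilon>_def using \<phi>0 by (auto intro!: lin_ext_hom[OF M] simp: lin_ext_surj[OF M])
  define Y :: "('a + 'b) list set \<times> (('a + 'b) list \<Rightarrow> 'a) set \<Rightarrow> ('a + 'b) list set"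
    where "Y = (\<lambda>(X, K). finsupp_code R ` K)"
  define \<delta> where "\<delta> = (\<lambda>(X, K). lin_ext R ((?F X)\<lparr>carrier := K\<rparr>) (inv_into K (finsupp_code R)))"
  have step: "\<delta> (X, K) \<in> mod_hom R (?F (Y (X, K))) (?F X) \<and> \<delta> (X, K) ` carrier (?F (Y (X, K))) = K"
    if K: "submodule K R (?F X)" for X K
  proof -
    have F: "module R (?F X)" by (rule module_free_module[OF cr])
    have FK: "module R ((?F X)\<lparr>carrier := K\<rparr>)" by (rule submodule.submodule_is_module[OF K F])
    have KX: "K \<subseteq> carrier (?F X)" by (rule module.submoduleE(1)[OF F K])
    have im: "inv_into K (finsupp_code R) ` Y (X, K) = carrier ((?F X)\<lparr>carrier := K\<rparr>)"
      using inj_on_subset[OF finsupp_code_inj KX] by (simp add: Y_def inv_into_image_cancel)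
    have "\<delta> (X, K) \<in> mod_hom R (?F (Y (X, K))) ((?F X)\<lparr>carrier := K\<rparr>)"
      unfolding \<delta>_def using im by (auto intro!: lin_ext_hom[OF FK])
    moreover have "\<delta> (X, K) ` carrier (?F (Y (X, K))) = K"
      unfolding \<delta>_def using lin_ext_surj[OF FK im] by simp
    ultimately show ?thesis using KX by (auto simp: mod_hom_def)
  qed
  define S where "S = rec_nat (X0, a_kernel (?F X0) M \<epsilon>)
     (\<lambda>_ s. (Y s, a_kernel (?F (Y s)) (?F (fst s)) (\<delta> s)))"
  have S0: "S 0 = (X0, a_kernel (?F X0) M \<epsilon>)" by (simp add: S_def)
  have SS: "S (Suc n) = (Y (S n), a_kernel (?F (Y (S n))) (?F (fst (S n))) (\<delta> (S n)))" for n
    by (simp add: S_def)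
  have sub: "submodule (snd (S n)) R (?F (fst (S n)))" for n
  proof (induction n)
    case 0 show ?case
      using submodule_kernel[OF module_free_module[OF cr] M \<epsilon>(1)] by (simp add: S0)
  next
    case (Suc n)
    have "\<delta> (S n) \<in> mod_hom R (?F (Y (S n))) (?F (fst (S n)))"
      using step[OF Suc] by simp
    from submodule_kernel[OF module_free_module[OF cr] module_free_module[OF cr] this]
    show ?case by (simp add: SS)
  qed
  have fst_S: "fst (S (Suc n)) = Y (S n)" for n by (simp add: SS)
  have hom: "\<delta> (S n) \<in> mod_hom R (?F (fst (S (Suc n)))) (?F (fst (S n)))" for n
    unfolding fst_S using step[OF sub[of n]] by simp
  have im: "\<delta> (S n) ` carrier (?F (fst (S (Suc n)))) = snd (S n)" for n
    unfolding fst_S using step[OF sub[of n]] by simp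
  have ker: "snd (S 0) = a_kernel (?F (fst (S 0))) M \<epsilon>"
    "snd (S (Suc n)) = a_kernel (?F (fst (S (Suc n)))) (?F (fst (S n))) (\<delta> (S n))" for n
    by (simp_all add: S0 SS)
  have "projective_resolution R M (\<lambda>n. ?F (fst (S n))) (\<lambda>n. \<delta> (S n)) \<epsilon>"
    unfolding projective_resolution_def
  proof (intro conjI allI)
    show "\<epsilon> \<in> mod_hom R (?F (fst (S 0))) M" "\<epsilon> ` carrier (?F (fst (S 0))) = carrier M"
      using \<epsilon> by (simp_all add: S0)
    show "\<delta> (S 0) ` carrier (?F (fst (S 1))) = a_kernel (?F (fst (S 0))) M \<epsilon>"
      using im[of 0] ker(1) by simp
    show "\<delta> (S (Suc n)) ` carrier (?F (fst (S (Suc (Suc n))))) =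
      a_kernel (?F (fst (S (Suc n)))) (?F (fst (S n))) (\<delta> (S n))" for n
      unfolding im by (rule ker(2))
  qed (rule projective_free_module[OF cr] hom)+
  then show ?thesis by blast
qed

corollary chosen_resolution:
  fixes M :: "('a, 'b, 'm) module_scheme"
  assumes "module R M" "chosen_resolution R M = (P, d)"
  shows "\<exists>\<epsilon>. projective_resolution R M P d \<epsilon>"
proof -
  have "case chosen_resolution R M of (P, d) \<Rightarrow> \<exists>\<epsilon>. projective_resolution R M P d \<epsilon>"
    unfolding chosen_resolution_def
    by (rule someI_ex) (use projective_resolution_exists[OF assms(1)] in auto)
  then show ?thesis using assms(2) by simp
qed

end

theory Submission
  imports Defs
begin

text \<open>
  Let \<open>P\<close> be a projective resolution of \<open>M\<close>, and let \<open>K\<close> be the kernel of the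
  differential out of \<open>P (t - 1)\<close> (of the augmentation if \<open>t = 1\<close>). Since
  \<open>R/I \<otimes> P\<close> is \<open>P/IP\<close>, exactness of \<open>P\<close> shows that
  \<open>Tor\<^sub>t(R/I, M) = 0\<close> holds if and only if \<open>K \<inter> I P (t - 1) = I K\<close>
  (\<open>Tor_zero_iff_pure\<close>). Call \<open>K\<close> pure in this case. By comparing resolutions, purity holds
  for all projective resolutions of \<open>M\<close> if it holds for one of them (\<open>pure_for_transfer\<close>).

  If \<open>M\<close> has projective dimension less than \<open>t\<close>, there is a resolution with \<open>P t = 0\<close>,
  hence \<open>K = 0\<close>, which is pure.

  For the converse take \<open>P\<close> to be a minimal free resolution, so that \<open>P (t - 1)\<close> is free of
  finite rank and \<open>K \<subseteq> \<mm> P (t - 1)\<close>. It suffices that a pure \<open>K\<close> is zero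
  (\<open>pure_submodule_zero\<close>), because then the resolution stops before degree \<open>t\<close>. First, all
  coordinates of \<open>K\<close> lie in \<open>I\<close>. Otherwise the ideal \<open>c\<close> of coordinates of \<open>K\<close>
  has nonzero image in \<open>R/I\<close>, hence meets the socle: there is \<open>s \<in> c\<close> with
  \<open>s \<mm> \<subseteq> I\<close> and \<open>s \<notin> I\<close>. Then
  \<open>s K \<subseteq> K \<inter> I P (t - 1) = I K\<close>, and the determinant trick gives an element
  \<open>z = s^m + a\<^sub>1 s^(m-1) + \<dots> + a\<^sub>m\<close> with \<open>a\<^sub>i \<in> I^i\<close> that kills
  \<open>K\<close>. So \<open>z\<close> kills \<open>c\<close>, and \<open>z s = 0\<close> is an equation of integral dependence
  of \<open>s\<close> over \<open>I\<close>. As \<open>I\<close> is integrally closed, \<open>s \<in> I\<close>, a contradiction. Thus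
  \<open>K \<subseteq> I P (t - 1)\<close>, so \<open>K = I K\<close>, and \<open>K = 0\<close> by Nakayama's lemma, which is
  the determinant trick for \<open>s = 1\<close>.

  The determinant trick itself is proved by Gaussian elimination without division
  (\<open>eliminated_annihilator\<close>), which yields an equation of larger degree than the
  determinant would, but of the same shape.
\<close>

section \<open>Integral equations with coefficients in powers of an ideal\<close>

lemma (in cring) ideal_pow_ideal:
  assumes "ideal I R"
  shows "ideal (I [^]\<^bsub>ideals_set R\<^esub> (n::nat)) R"
proof -
  interpret S: comm_monoid "ideals_set R" by (rule ideals_set_is_comm_monoid)
  have "I [^]\<^bsub>ideals_set R\<^esub> n \<in> carrier (ideals_set R)"
    by (rule S.nat_pow_closed) (use assms in \<open>simp add: ideals_set_def\<close>)
  then show ?thesis by (simp add: ideals_set_def)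
qed

lemma (in cring) ideal_pow_mult_mem:
  assumes "ideal I R" "a \<in> I [^]\<^bsub>ideals_set R\<^esub> (i::nat)" "b \<in> I [^]\<^bsub>ideals_set R\<^esub> (j::nat)"
  shows "a \<otimes> b \<in> I [^]\<^bsub>ideals_set R\<^esub> (i + j)"
proof -
  interpret S: comm_monoid "ideals_set R" by (rule ideals_set_is_comm_monoid)
  have "I [^]\<^bsub>ideals_set R\<^esub> (i + j) = I [^]\<^bsub>ideals_set R\<^esub> i \<otimes>\<^bsub>ideals_set R\<^esub> I [^]\<^bsub>ideals_set R\<^esub> j"
    by (rule S.nat_pow_mult[symmetric]) (use assms in \<open>simp add: ideals_set_def\<close>)
  also have "\<dots> = ideal_prod R (I [^]\<^bsub>ideals_set R\<^esub> i) (I [^]\<^bsub>ideals_set R\<^esub> j)"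
    by (simp add: ideals_set_def)
  finally show ?thesis using assms ideal_prod.prod[of a _ b _ R] by simp
qed

lemma (in cring) ideal_pow_one:
  assumes "ideal I R"
  shows "I [^]\<^bsub>ideals_set R\<^esub> (1::nat) = I"
proof -
  interpret S: comm_monoid "ideals_set R" by (rule ideals_set_is_comm_monoid)
  have "I \<in> carrier (ideals_set R)" using assms by (simp add: ideals_set_def)
  then show ?thesis by (rule S.nat_pow_eone)
qed

lemma (in cring) ideal_pow_Suc_subset:
  assumes "ideal I R"
  shows "I [^]\<^bsub>ideals_set R\<^esub> (Suc n) \<subseteq> I"
proof -
  have "I [^]\<^bsub>ideals_set R\<^esub> (Suc n) = ideal_prod R (I [^]\<^bsub>ideals_set R\<^esub> n) I"
    by (simp add: nat_pow_def ideals_set_def)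
  then show ?thesis using ideal_prod_inter[OF ideal_pow_ideal[OF assms] assms] by auto
qed

text \<open>
  The values at \<open>s\<close> of the polynomials
  \<open>a\<^sub>1 X^(n-1) + \<dots> + a\<^sub>n\<close> with \<open>a\<^sub>i \<in> I^i\<close>, by Horner's rule. These sets are graded by \<open>n\<close>:
  a product of a value of degree \<open>k\<close> and one of degree \<open>n\<close> is a value of degree \<open>k + n\<close>.
  Together with \<open>monic_values\<close> below, where the leading term \<open>s^n\<close> is added, they stand
  for the off-diagonal and the diagonal entries of a matrix in the elimination that replaces the
  determinant of \<open>s - A\<close>; and \<open>s\<close> is integral over \<open>I\<close> when zero is one of its
  monic values.
\<close>

fun lower_values :: "('a, 'r) ring_scheme \<Rightarrow> 'a set \<Rightarrow> 'a \<Rightarrow> nat \<Rightarrow> 'a set" where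
  "lower_values R I s 0 = {\<zero>\<^bsub>R\<^esub>}"
| "lower_values R I s (Suc n) =
     {s \<otimes>\<^bsub>R\<^esub> e \<oplus>\<^bsub>R\<^esub> a | e a. e \<in> lower_values R I s n \<and> a \<in> I [^]\<^bsub>ideals_set R\<^esub> Suc n}"

declare lower_values.simps(2) [simp del]

definition monic_values :: "('a, 'r) ring_scheme \<Rightarrow> 'a set \<Rightarrow> 'a \<Rightarrow> nat \<Rightarrow> 'a set" where
  "monic_values R I s n = {s [^]\<^bsub>R\<^esub> n \<oplus>\<^bsub>R\<^esub> e | e. e \<in> lower_values R I s n}"

locale ideal_element = cring R + ideal I R for I and R (structure) +
  fixes s assumes s: "s \<in> carrier R"
begin

abbreviation "E \<equiv> lower_values R I s"
abbreviation "D \<equiv> monic_values R I s"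
abbreviation "J (n::nat) \<equiv> I [^]\<^bsub>ideals_set R\<^esub> n"

lemma J_ideal: "ideal (J n) R" by (rule ideal_pow_ideal) (rule is_ideal)

lemma J_mult: "a \<in> J i \<Longrightarrow> b \<in> J j \<Longrightarrow> a \<otimes> b \<in> J (i + j)"
  by (rule ideal_pow_mult_mem[OF is_ideal])

lemma J_carr: "a \<in> J n \<Longrightarrow> a \<in> carrier R"
  using ideal.Icarr[OF J_ideal] .

lemma J_add: "a \<in> J n \<Longrightarrow> b \<in> J n \<Longrightarrow> a \<oplus> b \<in> J n"
  by (rule additive_subgroup.a_closed[OF ideal.axioms(1)[OF J_ideal]])

lemma J_neg: "a \<in> J n \<Longrightarrow> \<ominus> a \<in> J n"
  by (rule additive_subgroup.a_inv_closed[OF ideal.axioms(1)[OF J_ideal]])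

lemma J_zero: "\<zero> \<in> J n"
  by (rule additive_subgroup.zero_closed[OF ideal.axioms(1)[OF J_ideal]])

lemma E_carr: "e \<in> E n \<Longrightarrow> e \<in> carrier R"
proof (induction n arbitrary: e)
  case (Suc n)
  then show ?case using s J_carr unfolding lower_values.simps by blast
qed simp

lemma E_zero: "\<zero> \<in> E n"
proof (induction n)
  case (Suc n)
  have "\<zero> = s \<otimes> \<zero> \<oplus> \<zero>" using s by simp
  then show ?case using Suc J_zero[of "Suc n"] unfolding lower_values.simps by blast
qed simp

lemma E_SucI: "e \<in> E n \<Longrightarrow> a \<in> J (Suc n) \<Longrightarrow> s \<otimes> e \<oplus> a \<in> E (Suc n)"
  unfolding lower_values.simps by blast

lemma E_SucE:
  assumes "x \<in> E (Suc n)"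
  obtains e a where "e \<in> E n" "a \<in> J (Suc n)" "x = s \<otimes> e \<oplus> a" "e \<in> carrier R" "a \<in> carrier R"
  using assms E_carr J_carr unfolding lower_values.simps by blast

lemma E_add: "e \<in> E n \<Longrightarrow> f \<in> E n \<Longrightarrow> e \<oplus> f \<in> E n"
proof (induction n arbitrary: e f)
  case (Suc n)
  from Suc.prems obtain e' a f' b where *: "e' \<in> E n" "a \<in> J (Suc n)" "e = s \<otimes> e' \<oplus> a"
    "f' \<in> E n" "b \<in> J (Suc n)" "f = s \<otimes> f' \<oplus> b"
    and c: "e' \<in> carrier R" "a \<in> carrier R" "f' \<in> carrier R" "b \<in> carrier R"
    by (elim E_SucE)
  have "e \<oplus> f = s \<otimes> (e' \<oplus> f') \<oplus> (a \<oplus> b)" unfolding * using c s by algebra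
  then show ?case using E_SucI[OF Suc.IH J_add] * by simp
qed simp

lemma E_neg: "e \<in> E n \<Longrightarrow> \<ominus> e \<in> E n"
proof (induction n arbitrary: e)
  case (Suc n)
  from Suc.prems obtain e' a where *: "e' \<in> E n" "a \<in> J (Suc n)" "e = s \<otimes> e' \<oplus> a"
    and c: "e' \<in> carrier R" "a \<in> carrier R" by (elim E_SucE)
  have "\<ominus> e = s \<otimes> (\<ominus> e') \<oplus> (\<ominus> a)" unfolding * using c s by algebra
  then show ?case using E_SucI[OF Suc.IH J_neg] * by simp
qed simp

lemma J_E: assumes "0 < j" "a \<in> J j" shows "a \<in> E j"
proof -
  obtain n where n: "j = Suc n" using assms by (cases j) auto
  have "a = s \<otimes> \<zero> \<oplus> a" using s J_carr[OF assms(2)] by simp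
  then show ?thesis using E_SucI[OF E_zero, of a n] assms n by simp
qed

lemma I_E: "a \<in> I \<Longrightarrow> a \<in> E 1"
  by (rule J_E) (simp_all only: zero_less_one ideal_pow_one[OF is_ideal])

lemma s_E: "e \<in> E n \<Longrightarrow> s \<otimes> e \<in> E (Suc n)"
  using E_SucI[OF _ J_zero] s E_carr by (metis m_closed r_zero)

lemma s_pow_E: "e \<in> E n \<Longrightarrow> s [^] (k::nat) \<otimes> e \<in> E (k + n)"
proof (induction k)
  case (Suc k)
  have "s [^] Suc k \<otimes> e = s \<otimes> (s [^] k \<otimes> e)"
    using s E_carr[OF Suc.prems] by (simp add: m_assoc m_comm m_lcomm)
  then show ?case using s_E Suc by simp
qed (simp add: E_carr)

lemma J_mult_E: "a \<in> J j \<Longrightarrow> e \<in> E n \<Longrightarrow> a \<otimes> e \<in> E (j + n)"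
proof (induction n arbitrary: e)
  case 0
  then show ?case using E_zero J_carr by simp
next
  case (Suc n)
  from Suc.prems(2) obtain e' b where *: "e' \<in> E n" "b \<in> J (Suc n)" "e = s \<otimes> e' \<oplus> b"
    and c: "e' \<in> carrier R" "b \<in> carrier R" by (elim E_SucE)
  have "a \<otimes> e = s \<otimes> (a \<otimes> e') \<oplus> a \<otimes> b" unfolding * using c s J_carr[OF Suc.prems(1)] by algebra
  moreover have "a \<otimes> b \<in> J (Suc (j + n))" using J_mult[OF Suc.prems(1) *(2)] by simp
  ultimately show ?case using E_SucI Suc.IH[OF Suc.prems(1) *(1)] by (metis add_Suc_right)
qed

lemma E_mult: "e \<in> E k \<Longrightarrow> f \<in> E n \<Longrightarrow> e \<otimes> f \<in> E (k + n)"
proof (induction k arbitrary: e)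
  case 0
  then show ?case using E_zero E_carr by simp
next
  case (Suc k)
  from Suc.prems(1) obtain e' b where *: "e' \<in> E k" "b \<in> J (Suc k)" "e = s \<otimes> e' \<oplus> b"
    and c: "e' \<in> carrier R" "b \<in> carrier R" by (elim E_SucE)
  have "e \<otimes> f = s \<otimes> (e' \<otimes> f) \<oplus> b \<otimes> f" unfolding * using c s E_carr[OF Suc.prems(2)] by algebra
  moreover have "s \<otimes> (e' \<otimes> f) \<in> E (Suc k + n)" using s_E Suc.IH[OF *(1) Suc.prems(2)] by simp
  ultimately show ?case using E_add J_mult_E[OF *(2) Suc.prems(2)] by simp
qed

lemma D_carr: "z \<in> D n \<Longrightarrow> z \<in> carrier R"
  using s E_carr by (auto simp: monic_values_def)

lemma D_mult_E:
  assumes "z \<in> D k" "e \<in> E n" shows "z \<otimes> e \<in> E (k + n)"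
proof -
  from assms obtain f where f: "f \<in> E k" "z = s [^] k \<oplus> f" by (auto simp: monic_values_def)
  have "z \<otimes> e = s [^] k \<otimes> e \<oplus> f \<otimes> e"
    unfolding f using s E_carr f assms by (simp add: l_distr)
  then show ?thesis using E_add s_pow_E E_mult f assms by simp
qed

lemma D_add_E:
  assumes "z \<in> D n" "e \<in> E n" shows "z \<oplus> e \<in> D n"
proof -
  from assms obtain f where f: "f \<in> E n" "z = s [^] n \<oplus> f" by (auto simp: monic_values_def)
  have "z \<oplus> e = s [^] n \<oplus> (f \<oplus> e)"
    unfolding f using s E_carr f assms by (simp add: a_assoc)
  then show ?thesis using E_add[OF f(1) assms(2)] unfolding monic_values_def by blast
qed

text \<open>
  With \<open>z = s^k + g\<close> and \<open>w = s^n + f\<close>, all terms of \<open>z w\<close> except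
  \<open>s^(k+n)\<close> contain a factor of lower type, so the product is monic again.
\<close>

lemma D_mult:
  assumes "z \<in> D k" "w \<in> D n" shows "z \<otimes> w \<in> D (k + n)"
proof -
  from assms obtain f where f: "f \<in> E n" "w = s [^] n \<oplus> f" by (auto simp: monic_values_def)
  from assms obtain g where g: "g \<in> E k" "z = s [^] k \<oplus> g" by (auto simp: monic_values_def)
  note c = s E_carr[OF f(1)] E_carr[OF g(1)] D_carr[OF assms(1)]
  have "z \<otimes> w = s [^] (k + n) \<oplus> (s [^] n \<otimes> g \<oplus> z \<otimes> f)"
  proof -
    have "z \<otimes> w = z \<otimes> s [^] n \<oplus> z \<otimes> f" unfolding f using c by (simp add: r_distr)
    also have "z \<otimes> s [^] n = s [^] k \<otimes> s [^] n \<oplus> s [^] n \<otimes> g"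
      unfolding g using c by (simp add: l_distr r_distr m_comm)
    also have "s [^] k \<otimes> s [^] n = s [^] (k + n)" using s by (simp add: nat_pow_mult)
    finally show ?thesis using c by (simp add: a_assoc)
  qed
  moreover have "s [^] n \<otimes> g \<oplus> z \<otimes> f \<in> E (k + n)"
    using E_add[of "s [^] n \<otimes> g" "k + n" "z \<otimes> f"] s_pow_E[OF g(1), of n] D_mult_E[OF assms(1) f(1)]
    by (simp add: Groups.add.commute)
  ultimately show ?thesis by (auto simp: monic_values_def)
qed

lemma s_D: "s \<in> D 1"
  using s E_zero[of 1] by (force simp: monic_values_def)

lemma E_subset_I: "E n \<subseteq> I"
proof (induction n)
  case 0 then show ?case using additive_subgroup.zero_closed[OF is_additive_subgroup] by simp
next
  case (Suc n)
  show ?case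
  proof
    fix x assume "x \<in> E (Suc n)"
    then obtain e a where *: "e \<in> E n" "a \<in> J (Suc n)" "x = s \<otimes> e \<oplus> a" by (elim E_SucE)
    then show "x \<in> I" using Suc ideal_pow_Suc_subset[OF is_ideal, of n] s I_l_closed by blast
  qed
qed

lemma E_expand:
  "e \<in> E n \<Longrightarrow> \<exists>a. (\<forall>i\<in>{1..n}. a i \<in> J i) \<and> e = (\<Oplus>i\<in>{1..n}. a i \<otimes> s [^] (n - i))"
proof (induction n arbitrary: e)
  case (Suc n)
  from Suc.prems obtain e' b where *: "e' \<in> E n" "b \<in> J (Suc n)" "e = s \<otimes> e' \<oplus> b"
    and c: "e' \<in> carrier R" "b \<in> carrier R" by (elim E_SucE)
  from Suc.IH[OF *(1)] obtain a where a: "\<forall>i\<in>{1..n}. a i \<in> J i"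
    and e': "e' = (\<Oplus>i\<in>{1..n}. a i \<otimes> s [^] (n - i))" by blast
  let ?a = "a(Suc n := b)"
  have ac: "a i \<in> carrier R" if "i \<in> {1..n}" for i using a that J_carr by blast
  have "s \<otimes> e' = (\<Oplus>i\<in>{1..n}. s \<otimes> (a i \<otimes> s [^] (n - i)))"
    unfolding e' by (rule finsum_rdistr) (use s ac in auto)
  also have "\<dots> = (\<Oplus>i\<in>{1..n}. ?a i \<otimes> s [^] (Suc n - i))"
  proof (rule finsum_cong'[OF refl])
    show "(\<lambda>i. ?a i \<otimes> s [^] (Suc n - i)) \<in> {1..n} \<rightarrow> carrier R" using s ac by auto
    fix i assume i: "i \<in> {1..n}"
    then have "s [^] (Suc n - i) = s [^] (n - i) \<otimes> s" by (simp add: Suc_diff_le)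
    then show "s \<otimes> (a i \<otimes> s [^] (n - i)) = ?a i \<otimes> s [^] (Suc n - i)"
      using i s ac by (simp add: m_ac)
  qed
  finally have se: "s \<otimes> e' = (\<Oplus>i\<in>{1..n}. ?a i \<otimes> s [^] (Suc n - i))" .
  have "(\<Oplus>i\<in>{1..Suc n}. ?a i \<otimes> s [^] (Suc n - i)) =
     ?a (Suc n) \<otimes> s [^] (Suc n - Suc n) \<oplus> (\<Oplus>i\<in>{1..n}. ?a i \<otimes> s [^] (Suc n - i))"
    using finsum_insert[of "{1..n}" "Suc n" "\<lambda>i. ?a i \<otimes> s [^] (Suc n - i)"] s ac c
    by (simp add: atLeastAtMostSuc_conv Pi_iff)
  also have "\<dots> = b \<oplus> s \<otimes> e'" using c unfolding se by simp
  also have "\<dots> = e" using *(3) c s by (simp add: a_comm)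
  finally show ?case using a *(2) by (intro exI[of _ ?a]) auto
qed simp

text \<open>
  A vanishing monic value is an equation of integral dependence, once its recursive
  description is expanded into coefficients.
\<close>

lemma integral_if_monic_zero:
  assumes "0 < n" "\<zero> \<in> D n"
  shows "s \<in> integral_closure_ideal R I"
proof -
  obtain e where e: "e \<in> E n" "\<zero> = s [^] n \<oplus> e" using assms by (auto simp: monic_values_def)
  from E_expand[OF e(1)] obtain a where "\<forall>i\<in>{1..n}. a i \<in> J i"
    and "e = (\<Oplus>i\<in>{1..n}. a i \<otimes> s [^] (n - i))" by blast
  with e s assms(1) show ?thesis unfolding integral_closure_ideal_def
    by (auto intro!: exI[of _ n] exI[of _ a])
qed

end

section \<open>Units and socle elements in Noetherian local rings\<close>

locale noetherian_local_ring = local_ring R \<mm> + noetherian_ring R for R (structure) and \<mm>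
begin

text \<open>
  If the ideal generated by \<open>a\<close> were proper, Zorn's lemma would put it into a maximal ideal,
  which is \<open>\<mm>\<close>. The union of a chain of proper ideals is proper since, by the Noetherian
  property, it is a member of the chain.
\<close>

lemma unit_if_notin_maximal:
  assumes a: "a \<in> carrier R" "a \<notin> \<mm>"
  shows "a \<in> Units R"
proof -
  let ?A = "{J. ideal J R \<and> a \<in> J \<and> \<one> \<notin> J}"
  have pr: "ideal (PIdl a) R" by (rule cgenideal_ideal[OF a(1)])
  have "\<one> \<in> PIdl a"
  proof (rule ccontr)
    assume no: "\<one> \<notin> PIdl a"
    have "\<exists>M\<in>?A. \<forall>X\<in>?A. M \<subseteq> X \<longrightarrow> X = M"
    proof (rule subset_Zorn_nonempty)
      show "?A \<noteq> {}" using pr no cgenideal_self[OF a(1)] by blast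
      fix C assume C: "C \<noteq> {}" "subset.chain ?A C"
      then have "subset.chain {J. ideal J R} C" by (auto simp: pred_on.chain_def)
      from ideal_chain_is_trivial[OF C(1) this] show "\<Union> C \<in> ?A"
        using C(2) by (auto simp: pred_on.chain_def)
    qed
    then obtain N where N: "ideal N R" "a \<in> N" "\<one> \<notin> N"
      and max: "\<And>X. ideal X R \<Longrightarrow> a \<in> X \<Longrightarrow> \<one> \<notin> X \<Longrightarrow> N \<subseteq> X \<Longrightarrow> X = N" by auto
    have "maximalideal N R"
    proof (rule maximalidealI[OF N(1)])
      show "carrier R \<noteq> N" using N(3) by auto
      fix J assume J: "ideal J R" "N \<subseteq> J" "J \<subseteq> carrier R"
      show "J = N \<or> J = carrier R"
        using max[OF J(1) _ _ J(2)] ideal.one_imp_carrier[OF J(1)] J(2) N(2) by blast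
    qed
    then show False using maximalideal_unique N(2) a(2) by blast
  qed
  then obtain x where x: "x \<in> carrier R" "\<one> = x \<otimes> a" by (auto simp: cgenideal_def)
  have "x \<otimes> a = \<one>" "a \<otimes> x = \<one>" using x a(1) by (auto simp: m_comm)
  then show ?thesis using x(1) a(1) unfolding Units_def by blast
qed

lemma one_notin_maximal: "\<one> \<notin> \<mm>"
  using I_notcarr one_imp_carrier by blast

text \<open>
  Every nonzero submodule of \<open>R/I\<close> meets the socle \<open>(I : \<mm>)/I\<close>. The multiplier is a
  product of powers of finitely many generators of \<open>\<mm>\<close>: since each generator \<open>g\<close> has a
  power in \<open>I\<close>, one can multiply by the largest power of \<open>g\<close> that stays outside \<open>I\<close>, and
  after this \<open>g\<close> carries the element into \<open>I\<close>.
\<close>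

lemma primary_socle_multiple:
  assumes I: "primary_to R \<mm> I" and c: "c \<in> carrier R" "c \<notin> I"
  obtains r where "r \<in> carrier R" "r \<otimes> c \<notin> I" "\<And>y. y \<in> \<mm> \<Longrightarrow> y \<otimes> (r \<otimes> c) \<in> I"
proof -
  interpret I: ideal I R using I by (auto simp: primary_to_def primary_ideal_def)
  obtain A where A: "A \<subseteq> carrier R" "finite A" "\<mm> = Idl A" using finetely_gen[OF is_ideal] by auto
  have Am: "A \<subseteq> \<mm>" using genideal_self[OF A(1)] A(3) by simp
  have "finite B \<Longrightarrow> B \<subseteq> A \<Longrightarrow> \<exists>r\<in>carrier R. r \<otimes> c \<notin> I \<and> (\<forall>y\<in>B. y \<otimes> (r \<otimes> c) \<in> I)" for B
  proof (induction B rule: finite_induct)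
    case empty
    then show ?case using c by (auto intro!: bexI[of _ \<one>])
  next
    case (insert g B)
    then obtain r where r: "r \<in> carrier R" "r \<otimes> c \<notin> I" "\<forall>y\<in>B. y \<otimes> (r \<otimes> c) \<in> I" by auto
    have g: "g \<in> carrier R" "g \<in> \<mm>" using insert.prems A(1) Am by auto
    let ?P = "\<lambda>j::nat. g [^] j \<otimes> (r \<otimes> c) \<in> I"
    have "\<exists>n::nat. g [^] n \<in> I"
      using g I by (auto simp: primary_to_def ideal_radical_def)
    then obtain n :: nat where "g [^] n \<in> I" by blast
    then have "?P n" by (rule I.I_r_closed) (use r(1) c(1) in simp)
    then have ex: "\<exists>n. ?P n" by (rule exI)
    define j where "j = (LEAST j. ?P j)"
    have j: "?P j" unfolding j_def using ex by (rule LeastI_ex)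
    have "j \<noteq> 0" using j r c by (intro notI) simp
    then obtain k where k: "j = Suc k" by (cases j) auto
    \<comment> \<open>\<open>j\<close> is the least exponent that leads into \<open>I\<close>, so \<open>g^(j-1)\<close> still stays outside\<close>
    have nk: "\<not> ?P k" using not_less_Least[of k ?P] k unfolding j_def by simp
    let ?r = "g [^] k \<otimes> r"
    have eq: "?r \<otimes> c = g [^] k \<otimes> (r \<otimes> c)" using g r c by (simp add: m_assoc)
    have "g \<otimes> (?r \<otimes> c) = g [^] j \<otimes> (r \<otimes> c)" unfolding k using g r c by (simp add: m_ac)
    then have 1: "g \<otimes> (?r \<otimes> c) \<in> I" using j by simp
    have 2: "y \<otimes> (?r \<otimes> c) \<in> I" if y: "y \<in> B" for y
    proof -
      have "y \<in> carrier R" using insert.prems A(1) y by auto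
      then have "y \<otimes> (?r \<otimes> c) = g [^] k \<otimes> (y \<otimes> (r \<otimes> c))" using g r c by (simp add: m_ac)
      then show ?thesis using I.I_l_closed r(3) y g by simp
    qed
    show ?case by (rule bexI[of _ ?r]) (use 1 2 nk eq g r in auto)
  qed
  from this[OF A(2)] obtain r where r: "r \<in> carrier R" "r \<otimes> c \<notin> I" "\<forall>y\<in>A. y \<otimes> (r \<otimes> c) \<in> I" by auto
  have rc: "r \<otimes> c \<in> carrier R" using r c by simp
  have Q: "ideal {y \<in> carrier R. y \<otimes> (r \<otimes> c) \<in> I} R" (is "ideal ?Q R")
  proof (rule idealI)
    show "ring R" by (rule ring_axioms)
    show "subgroup ?Q (add_monoid R)"
      by (rule add.subgroupI) (use rc in \<open>auto simp: l_distr l_minus simp flip: a_inv_def intro!: exI[of _ \<zero>]\<close>)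
    fix a x assume a: "a \<in> ?Q" and x: "x \<in> carrier R"
    then have ac: "a \<in> carrier R" by simp
    have "(x \<otimes> a) \<otimes> (r \<otimes> c) = x \<otimes> (a \<otimes> (r \<otimes> c))" using x ac rc by (simp add: m_assoc)
    moreover have "a \<otimes> x = x \<otimes> a" using x ac by (simp add: m_comm)
    ultimately show "x \<otimes> a \<in> ?Q" "a \<otimes> x \<in> ?Q" using a x I.I_l_closed by auto
  qed
  have "\<mm> \<subseteq> ?Q" unfolding A(3) by (rule genideal_minimal[OF Q]) (use r A in auto)
  then show thesis using that r by blast
qed

end

section \<open>Products of an ideal and a submodule\<close>

inductive_set ideal_smult :: "('a, 'b, 'm) module_scheme \<Rightarrow> 'a set \<Rightarrow> 'b set \<Rightarrow> 'b set"
  for M and I and K where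
  zero: "\<zero>\<^bsub>M\<^esub> \<in> ideal_smult M I K"
| smult: "a \<in> I \<Longrightarrow> x \<in> K \<Longrightarrow> a \<odot>\<^bsub>M\<^esub> x \<in> ideal_smult M I K"
| add: "u \<in> ideal_smult M I K \<Longrightarrow> v \<in> ideal_smult M I K \<Longrightarrow> u \<oplus>\<^bsub>M\<^esub> v \<in> ideal_smult M I K"

text \<open>
  The submodule \<open>K\<close> of \<open>M\<close> satisfies \<open>K \<inter> I M = I K\<close>, that is,
  \<open>K/IK \<rightarrow> M/IM\<close> is injective. For \<open>K\<close> the kernel of a surjection from a projective module
  \<open>M\<close> to \<open>N\<close>, this says \<open>Tor\<^sub>1(R/I, N) = 0\<close>.
\<close>

definition pure_for :: "('a, 'b, 'm) module_scheme \<Rightarrow> 'a set \<Rightarrow> 'b set \<Rightarrow> bool" where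
  "pure_for M I K \<longleftrightarrow> K \<inter> ideal_smult M I (carrier M) \<subseteq> ideal_smult M I K"

definition combinations :: "('a, 'b, 'm) module_scheme \<Rightarrow> 'a set \<Rightarrow> 'b set \<Rightarrow> 'b set" where
  "combinations M I S = {\<Oplus>\<^bsub>M\<^esub>y\<in>S. a y \<odot>\<^bsub>M\<^esub> y | a. a \<in> S \<rightarrow> I}"

lemma module_span_least: "submodule H R M \<Longrightarrow> S \<subseteq> H \<Longrightarrow> module_span R M S \<subseteq> H"
  by (auto simp: module_span_def)

lemma module_span_self: "S \<subseteq> module_span R M S"
  by (auto simp: module_span_def)

context module
begin

lemma submodule_zero: "submodule H R M \<Longrightarrow> \<zero>\<^bsub>M\<^esub> \<in> H"
  using subgroup.one_closed[OF submodule.axioms(1)] by fastforce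

lemma submodule_add: "submodule H R M \<Longrightarrow> x \<in> H \<Longrightarrow> y \<in> H \<Longrightarrow> x \<oplus>\<^bsub>M\<^esub> y \<in> H"
  by (rule submoduleE(5))

lemma submodule_smult: "submodule H R M \<Longrightarrow> a \<in> carrier R \<Longrightarrow> x \<in> H \<Longrightarrow> a \<odot>\<^bsub>M\<^esub> x \<in> H"
  by (rule submoduleE(4))

lemma submodule_carr: "submodule H R M \<Longrightarrow> x \<in> H \<Longrightarrow> x \<in> carrier M"
  using submoduleE(1) by blast

lemma submodule_minus: "submodule H R M \<Longrightarrow> x \<in> H \<Longrightarrow> y \<in> H \<Longrightarrow> x \<ominus>\<^bsub>M\<^esub> y \<in> H"
  unfolding a_minus_def using submodule_add submoduleE(3) by blast

lemma submoduleI':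
  assumes "H \<subseteq> carrier M" "\<zero>\<^bsub>M\<^esub> \<in> H" "\<And>a b. a \<in> H \<Longrightarrow> b \<in> H \<Longrightarrow> a \<oplus>\<^bsub>M\<^esub> b \<in> H"
    "\<And>a x. a \<in> carrier R \<Longrightarrow> x \<in> H \<Longrightarrow> a \<odot>\<^bsub>M\<^esub> x \<in> H"
  shows "submodule H R M"
proof (rule submoduleI)
  fix a assume "a \<in> H"
  moreover from this have "(\<ominus> \<one>) \<odot>\<^bsub>M\<^esub> a = \<ominus>\<^bsub>M\<^esub> a" using assms(1) by (subst smult_l_minus) auto
  ultimately show "\<ominus>\<^bsub>M\<^esub> a \<in> H" using assms(4)[of "\<ominus> \<one>" a] by simp
qed (use assms in auto)

lemma module_span_submodule:
  assumes "S \<subseteq> carrier M" shows "submodule (module_span R M S) R M"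
  by (rule submoduleI')
     (use assms carrier_is_submodule submodule_zero in
       \<open>auto simp: module_span_def intro: submodule_add submodule_smult\<close>)

lemma submodule_finsum:
  assumes "submodule H R M" "finite A" "f \<in> A \<rightarrow> H"
  shows "(\<Oplus>\<^bsub>M\<^esub>i\<in>A. f i) \<in> H"
  using assms(2,3)
proof (induction A rule: finite_induct)
  case empty
  then show ?case using submodule_zero[OF assms(1)] by simp
next
  case (insert x A)
  have "(\<Oplus>\<^bsub>M\<^esub>i\<in>insert x A. f i) = f x \<oplus>\<^bsub>M\<^esub> (\<Oplus>\<^bsub>M\<^esub>i\<in>A. f i)"
    by (rule M.finsum_insert) (use insert submodule_carr[OF assms(1)] in auto)
  then show ?case using insert submodule_add[OF assms(1)] by auto
qed

lemma combinations_submodule: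
  assumes I: "ideal I R" and S: "finite S" "S \<subseteq> carrier M"
  shows "submodule (combinations M I S) R M"
proof (rule submoduleI')
  interpret I: ideal I R by fact
  have cl: "a y \<odot>\<^bsub>M\<^esub> y \<in> carrier M" if "a \<in> S \<rightarrow> I" "y \<in> S" for a y
    using that S I.Icarr by blast
  show "combinations M I S \<subseteq> carrier M"
    unfolding combinations_def using cl by (auto intro!: M.finsum_closed)
  have "(\<Oplus>\<^bsub>M\<^esub>y\<in>S. \<zero> \<odot>\<^bsub>M\<^esub> y) = \<zero>\<^bsub>M\<^esub>"
    using S by (intro M.add.finprod_one_eqI) auto
  moreover have "(\<lambda>_. \<zero>) \<in> S \<rightarrow> I" by simp
  ultimately show "\<zero>\<^bsub>M\<^esub> \<in> combinations M I S"
    unfolding combinations_def by (intro CollectI exI[of _ "\<lambda>_. \<zero>"]) simp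
next
  interpret I: ideal I R by fact
  have cl: "a y \<odot>\<^bsub>M\<^esub> y \<in> carrier M" if "a \<in> S \<rightarrow> I" "y \<in> S" for a y
    using that S I.Icarr by blast
  fix u v assume "u \<in> combinations M I S" "v \<in> combinations M I S"
  then obtain a b where a: "a \<in> S \<rightarrow> I" "u = (\<Oplus>\<^bsub>M\<^esub>y\<in>S. a y \<odot>\<^bsub>M\<^esub> y)"
    and b: "b \<in> S \<rightarrow> I" "v = (\<Oplus>\<^bsub>M\<^esub>y\<in>S. b y \<odot>\<^bsub>M\<^esub> y)" by (auto simp: combinations_def)
  have "u \<oplus>\<^bsub>M\<^esub> v = (\<Oplus>\<^bsub>M\<^esub>y\<in>S. a y \<odot>\<^bsub>M\<^esub> y \<oplus>\<^bsub>M\<^esub> b y \<odot>\<^bsub>M\<^esub> y)"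
    unfolding a b by (rule M.finsum_addf[symmetric]) (use cl a b in auto)
  also have "\<dots> = (\<Oplus>\<^bsub>M\<^esub>y\<in>S. (a y \<oplus> b y) \<odot>\<^bsub>M\<^esub> y)"
  proof (rule M.finsum_cong'[OF refl])
    fix y assume y: "y \<in> S"
    then have "a y \<in> carrier R" "b y \<in> carrier R" "y \<in> carrier M"
      using I.Icarr[OF funcset_mem[OF a(1) y]] I.Icarr[OF funcset_mem[OF b(1) y]] S y by auto
    then show "a y \<odot>\<^bsub>M\<^esub> y \<oplus>\<^bsub>M\<^esub> b y \<odot>\<^bsub>M\<^esub> y = (a y \<oplus> b y) \<odot>\<^bsub>M\<^esub> y" by (simp add: smult_l_distr)
  next
    have "(\<lambda>y. a y \<oplus> b y) \<in> S \<rightarrow> I" using a(1) b(1) by auto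
    then show "(\<lambda>y. (a y \<oplus> b y) \<odot>\<^bsub>M\<^esub> y) \<in> S \<rightarrow> carrier M" using cl by blast
  qed
  finally show "u \<oplus>\<^bsub>M\<^esub> v \<in> combinations M I S"
    unfolding combinations_def using a b by (auto intro!: exI[of _ "\<lambda>y. a y \<oplus> b y"])
next
  interpret I: ideal I R by fact
  have cl: "a y \<odot>\<^bsub>M\<^esub> y \<in> carrier M" if "a \<in> S \<rightarrow> I" "y \<in> S" for a y
    using that S I.Icarr by blast
  fix r u assume r: "r \<in> carrier R" and "u \<in> combinations M I S"
  then obtain a where a: "a \<in> S \<rightarrow> I" "u = (\<Oplus>\<^bsub>M\<^esub>y\<in>S. a y \<odot>\<^bsub>M\<^esub> y)" by (auto simp: combinations_def)
  have "r \<odot>\<^bsub>M\<^esub> u = (\<Oplus>\<^bsub>M\<^esub>y\<in>S. r \<odot>\<^bsub>M\<^esub> (a y \<odot>\<^bsub>M\<^esub> y))"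
    unfolding a by (rule finsum_smult_ldistr) (use S r cl a in auto)
  also have "\<dots> = (\<Oplus>\<^bsub>M\<^esub>y\<in>S. (r \<otimes> a y) \<odot>\<^bsub>M\<^esub> y)"
  proof (rule M.finsum_cong'[OF refl])
    fix y assume y: "y \<in> S"
    then have "a y \<in> carrier R" "y \<in> carrier M" using I.Icarr[OF funcset_mem[OF a(1) y]] S y by auto
    then show "r \<odot>\<^bsub>M\<^esub> (a y \<odot>\<^bsub>M\<^esub> y) = (r \<otimes> a y) \<odot>\<^bsub>M\<^esub> y" using r by (simp add: smult_assoc1)
  next
    have "(\<lambda>y. r \<otimes> a y) \<in> S \<rightarrow> I" using a(1) r I.I_l_closed by auto
    then show "(\<lambda>y. (r \<otimes> a y) \<odot>\<^bsub>M\<^esub> y) \<in> S \<rightarrow> carrier M" using cl by blast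
  qed
  finally show "r \<odot>\<^bsub>M\<^esub> u \<in> combinations M I S"
    unfolding combinations_def using a r I.I_l_closed by (auto intro!: exI[of _ "\<lambda>y. r \<otimes> a y"])
qed

lemma delta_combination:
  assumes "finite S" "S \<subseteq> carrier M" "x \<in> S" "r \<in> carrier R"
  shows "(\<Oplus>\<^bsub>M\<^esub>y\<in>S. (if x = y then r else \<zero>) \<odot>\<^bsub>M\<^esub> y) = r \<odot>\<^bsub>M\<^esub> x"
proof -
  have "(\<Oplus>\<^bsub>M\<^esub>y\<in>S. (if x = y then r else \<zero>) \<odot>\<^bsub>M\<^esub> y) = (\<Oplus>\<^bsub>M\<^esub>y\<in>S. if x = y then r \<odot>\<^bsub>M\<^esub> y else \<zero>\<^bsub>M\<^esub>)"
    by (rule M.finsum_cong'[OF refl]) (use assms in auto)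
  also have "\<dots> = r \<odot>\<^bsub>M\<^esub> x"
    by (rule M.add.finprod_singleton) (use assms in auto)
  finally show ?thesis .
qed

lemma module_span_combinations:
  assumes "finite S" "S \<subseteq> carrier M"
  shows "module_span R M S \<subseteq> combinations M (carrier R) S"
proof (rule module_span_least[OF combinations_submodule[OF oneideal assms]])
  show "S \<subseteq> combinations M (carrier R) S"
  proof
    fix x assume "x \<in> S"
    from delta_combination[OF assms this R.one_closed] show "x \<in> combinations M (carrier R) S"
      unfolding combinations_def using \<open>x \<in> S\<close> assms(2)
      by (auto intro!: exI[of _ "\<lambda>y. if x = y then \<one> else \<zero>"])
  qed
qed

text \<open>
  If \<open>S\<close> generates \<open>K\<close>, an element of \<open>I K\<close> is a combination of \<open>S\<close> itself with
  coefficients in \<open>I\<close>. This gives the matrix for the determinant trick.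
\<close>

lemma ideal_smult_span:
  assumes I: "ideal I R" and S: "finite S" "S \<subseteq> carrier M"
  shows "ideal_smult M I (module_span R M S) \<subseteq> combinations M I S"
proof
  interpret I: ideal I R by fact
  note sub = combinations_submodule[OF I S]
  fix u assume "u \<in> ideal_smult M I (module_span R M S)"
  then show "u \<in> combinations M I S"
  proof induction
    case zero show ?case by (rule submodule_zero[OF sub])
  next
    case (smult a x)
    then obtain r where r: "r \<in> S \<rightarrow> carrier R" "x = (\<Oplus>\<^bsub>M\<^esub>y\<in>S. r y \<odot>\<^bsub>M\<^esub> y)"
      using module_span_combinations[OF S] by (auto simp: combinations_def)
    have a: "a \<in> carrier R" using smult I.Icarr by blast
    have "a \<odot>\<^bsub>M\<^esub> x = (\<Oplus>\<^bsub>M\<^esub>y\<in>S. a \<odot>\<^bsub>M\<^esub> (r y \<odot>\<^bsub>M\<^esub> y))"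
      unfolding r by (rule finsum_smult_ldistr) (use S r a in auto)
    also have "\<dots> = (\<Oplus>\<^bsub>M\<^esub>y\<in>S. (a \<otimes> r y) \<odot>\<^bsub>M\<^esub> y)"
    proof (rule M.finsum_cong'[OF refl])
      fix y assume y: "y \<in> S"
      then have "r y \<in> carrier R" "y \<in> carrier M" using r S by auto
      then show "a \<odot>\<^bsub>M\<^esub> (r y \<odot>\<^bsub>M\<^esub> y) = (a \<otimes> r y) \<odot>\<^bsub>M\<^esub> y" using a by (simp add: smult_assoc1)
    qed (use r a S in auto)
    finally show ?case unfolding combinations_def using r smult(1) I.I_r_closed
      by (auto intro!: exI[of _ "\<lambda>y. a \<otimes> r y"])
  next
    case (add u v) then show ?case using submodule_add[OF sub] by blast
  qed
qed

lemma annihilated_submodule: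
  assumes "z \<in> carrier R" shows "submodule {x \<in> carrier M. z \<odot>\<^bsub>M\<^esub> x = \<zero>\<^bsub>M\<^esub>} R M"
proof (rule submoduleI')
  fix a x assume a: "a \<in> carrier R" and "x \<in> {x \<in> carrier M. z \<odot>\<^bsub>M\<^esub> x = \<zero>\<^bsub>M\<^esub>}"
  then have x: "x \<in> carrier M" "z \<odot>\<^bsub>M\<^esub> x = \<zero>\<^bsub>M\<^esub>" by auto
  have "z \<odot>\<^bsub>M\<^esub> (a \<odot>\<^bsub>M\<^esub> x) = a \<odot>\<^bsub>M\<^esub> (z \<odot>\<^bsub>M\<^esub> x)"
    using a x(1) assms by (simp add: smult_assoc1[symmetric] R.m_comm)
  then show "a \<odot>\<^bsub>M\<^esub> x \<in> {x \<in> carrier M. z \<odot>\<^bsub>M\<^esub> x = \<zero>\<^bsub>M\<^esub>}" using a x by simp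
qed (use assms in \<open>auto simp: smult_r_distr\<close>)

end

section \<open>The determinant trick\<close>

context ideal_element
begin

text \<open>
  Gaussian elimination without division, in the role of Cramer's rule. Let \<open>B x = 0\<close>, with
  monic diagonal entries and lower off-diagonal entries, all of degree \<open>k\<close>. To remove the generator
  \<open>w\<close>, multiply each other row by the pivot \<open>B w w\<close> and subtract a multiple of row \<open>w\<close>. The
  new entries \<open>B w w B x y - B x w B w y\<close> have degree \<open>2 k\<close> and the same monic and lower
  pattern. If \<open>z\<close> kills the remaining generators, then \<open>z (B w w)\<close> also kills \<open>w\<close>, because
  row \<open>w\<close> expresses \<open>(B w w) w\<close> by the other generators; and \<open>z (B w w)\<close> is monic.
\<close>

lemma eliminated_annihilator:
  assumes M: "module R M" and "finite S" "S \<subseteq> carrier M" "0 < k"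
    and "\<And>x. x \<in> S \<Longrightarrow> B x x \<in> D k" and "\<And>x y. x \<in> S \<Longrightarrow> y \<in> S \<Longrightarrow> x \<noteq> y \<Longrightarrow> B x y \<in> E k"
    and "\<And>x. x \<in> S \<Longrightarrow> (\<Oplus>\<^bsub>M\<^esub>y\<in>S. B x y \<odot>\<^bsub>M\<^esub> y) = \<zero>\<^bsub>M\<^esub>"
  shows "\<exists>m>0. \<exists>z\<in>D m. \<forall>x\<in>S. z \<odot>\<^bsub>M\<^esub> x = \<zero>\<^bsub>M\<^esub>"
  using assms(2-)
proof (induction S arbitrary: B k rule: finite_induct)
  case empty
  then show ?case using s_D by (intro exI[of _ 1]) auto
next
  case (insert w S)
  interpret M: module R M by fact
  note diag = insert.prems(3) and off = insert.prems(4) and rel = insert.prems(5)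
  have S: "S \<subseteq> carrier M" and w: "w \<in> carrier M" using insert.prems by auto
  have Bc: "B x y \<in> carrier R" if "x \<in> insert w S" "y \<in> insert w S" for x y
    using that diag off D_carr E_carr by (cases "x = y") blast+
  define C where "C x y = B w w \<otimes> B x y \<oplus> \<ominus> (B x w \<otimes> B w y)" for x y
  let ?sum = "\<lambda>x. \<Oplus>\<^bsub>M\<^esub>y\<in>S. B x y \<odot>\<^bsub>M\<^esub> y"
  have sc: "?sum x \<in> carrier M" if "x \<in> insert w S" for x
    using Bc that S by (auto intro!: M.M.finsum_closed)
  have split: "B x w \<odot>\<^bsub>M\<^esub> w \<oplus>\<^bsub>M\<^esub> ?sum x = \<zero>\<^bsub>M\<^esub>" if "x \<in> insert w S" for x
  proof -
    have "(\<Oplus>\<^bsub>M\<^esub>y\<in>insert w S. B x y \<odot>\<^bsub>M\<^esub> y) = B x w \<odot>\<^bsub>M\<^esub> w \<oplus>\<^bsub>M\<^esub> ?sum x"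
      by (rule M.M.finsum_insert) (use insert.hyps Bc that S w in auto)
    then show ?thesis using rel[OF that] by simp
  qed
  have neg: "?sum x = \<ominus>\<^bsub>M\<^esub> (B x w \<odot>\<^bsub>M\<^esub> w)" if "x \<in> insert w S" for x
    using M.M.minus_equality[of "?sum x" "B x w \<odot>\<^bsub>M\<^esub> w"] split[OF that] sc[OF that] Bc[OF that] w
    by (simp add: M.M.a_comm)
  have "\<exists>m>0. \<exists>z\<in>D m. \<forall>x\<in>S. z \<odot>\<^bsub>M\<^esub> x = \<zero>\<^bsub>M\<^esub>"
  proof (rule insert.IH[of "k + k" C])
    show "S \<subseteq> carrier M" "0 < k + k" using S insert.prems by auto
  next
    fix x assume x: "x \<in> S"
    then have "x \<noteq> w" using insert.hyps by auto
    then have "B x w \<otimes> B w x \<in> E (k + k)" using E_mult[of "B x w" k "B w x" k] off x by auto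
    then show "C x x \<in> D (k + k)"
      unfolding C_def using D_add_E D_mult diag x E_neg by simp
  next
    fix x y assume x: "x \<in> S" "y \<in> S" "x \<noteq> y"
    then have "x \<noteq> w" "y \<noteq> w" using insert.hyps by auto
    then have "B x w \<otimes> B w y \<in> E (k + k)" using E_mult[of "B x w" k "B w y" k] off x by auto
    moreover have "B w w \<otimes> B x y \<in> E (k + k)" using D_mult_E[of "B w w" k "B x y" k] diag off x by auto
    ultimately show "C x y \<in> E (k + k)" unfolding C_def using E_add E_neg by simp
  next
    fix x assume x: "x \<in> S"
    have c: "B w w \<in> carrier R" "B x w \<in> carrier R" using Bc x by auto
    have "(\<Oplus>\<^bsub>M\<^esub>y\<in>S. C x y \<odot>\<^bsub>M\<^esub> y) =
        (\<Oplus>\<^bsub>M\<^esub>y\<in>S. B w w \<odot>\<^bsub>M\<^esub> (B x y \<odot>\<^bsub>M\<^esub> y) \<oplus>\<^bsub>M\<^esub> (\<ominus> B x w) \<odot>\<^bsub>M\<^esub> (B w y \<odot>\<^bsub>M\<^esub> y))"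
    proof (rule M.M.finsum_cong'[OF refl])
      fix y assume y: "y \<in> S"
      then have "B x y \<in> carrier R" "B w y \<in> carrier R" "y \<in> carrier M" using Bc x S by auto
      then show "C x y \<odot>\<^bsub>M\<^esub> y = B w w \<odot>\<^bsub>M\<^esub> (B x y \<odot>\<^bsub>M\<^esub> y) \<oplus>\<^bsub>M\<^esub> (\<ominus> B x w) \<odot>\<^bsub>M\<^esub> (B w y \<odot>\<^bsub>M\<^esub> y)"
        using c by (simp add: C_def M.smult_l_distr M.smult_assoc1 l_minus[symmetric] del: M.smult_l_minus)
    qed (use Bc x c S in auto)
    also have "\<dots> = (\<Oplus>\<^bsub>M\<^esub>y\<in>S. B w w \<odot>\<^bsub>M\<^esub> (B x y \<odot>\<^bsub>M\<^esub> y)) \<oplus>\<^bsub>M\<^esub> (\<Oplus>\<^bsub>M\<^esub>y\<in>S. (\<ominus> B x w) \<odot>\<^bsub>M\<^esub> (B w y \<odot>\<^bsub>M\<^esub> y))"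
      by (rule M.M.finsum_addf) (use Bc x c S in auto)
    also have "(\<Oplus>\<^bsub>M\<^esub>y\<in>S. B w w \<odot>\<^bsub>M\<^esub> (B x y \<odot>\<^bsub>M\<^esub> y)) = B w w \<odot>\<^bsub>M\<^esub> ?sum x"
      by (rule M.finsum_smult_ldistr[symmetric]) (use insert.hyps Bc x c S in auto)
    also have "(\<Oplus>\<^bsub>M\<^esub>y\<in>S. (\<ominus> B x w) \<odot>\<^bsub>M\<^esub> (B w y \<odot>\<^bsub>M\<^esub> y)) = (\<ominus> B x w) \<odot>\<^bsub>M\<^esub> ?sum w"
      by (rule M.finsum_smult_ldistr[symmetric]) (use insert.hyps Bc x c S in auto)
    also have "B w w \<odot>\<^bsub>M\<^esub> ?sum x \<oplus>\<^bsub>M\<^esub> (\<ominus> B x w) \<odot>\<^bsub>M\<^esub> ?sum w =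
       \<ominus>\<^bsub>M\<^esub> ((B w w \<otimes> B x w) \<odot>\<^bsub>M\<^esub> w) \<oplus>\<^bsub>M\<^esub> (B x w \<otimes> B w w) \<odot>\<^bsub>M\<^esub> w"
      using x c w by (simp add: neg M.smult_r_minus M.smult_l_minus M.smult_assoc1)
    also have "\<dots> = \<zero>\<^bsub>M\<^esub>" using c w by (simp add: m_comm M.M.l_neg)
    finally show "(\<Oplus>\<^bsub>M\<^esub>y\<in>S. C x y \<odot>\<^bsub>M\<^esub> y) = \<zero>\<^bsub>M\<^esub>" .
  qed
  then obtain m z where m: "0 < m" and z: "z \<in> D m" "\<And>x. x \<in> S \<Longrightarrow> z \<odot>\<^bsub>M\<^esub> x = \<zero>\<^bsub>M\<^esub>" by blast
  have zc: "z \<in> carrier R" by (rule D_carr[OF z(1)])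
  have c: "B w w \<in> carrier R" using Bc by simp
  have kill: "z \<odot>\<^bsub>M\<^esub> ?sum w = \<zero>\<^bsub>M\<^esub>"
  proof -
    let ?Z = "{x \<in> carrier M. z \<odot>\<^bsub>M\<^esub> x = \<zero>\<^bsub>M\<^esub>}"
    have sub: "submodule ?Z R M" by (rule M.annihilated_submodule[OF zc])
    have "?sum w \<in> ?Z"
    proof (rule M.submodule_finsum[OF sub insert.hyps(1)], rule Pi_I)
      fix y assume y: "y \<in> S"
      have "y \<in> ?Z" using z(2)[OF y] y S by auto
      then show "B w y \<odot>\<^bsub>M\<^esub> y \<in> ?Z" by (rule M.submodule_smult[OF sub, rotated]) (use Bc y in simp)
    qed
    then show ?thesis by simp
  qed
  have "(z \<otimes> B w w) \<odot>\<^bsub>M\<^esub> x = \<zero>\<^bsub>M\<^esub>" if x: "x \<in> insert w S" for x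
  proof (cases "x = w")
    case True
    have "z \<odot>\<^bsub>M\<^esub> (B w w \<odot>\<^bsub>M\<^esub> w) = \<ominus>\<^bsub>M\<^esub> (z \<odot>\<^bsub>M\<^esub> ?sum w)"
      using neg[of w] zc c w by (simp add: M.smult_r_minus)
    then show ?thesis unfolding True kill using zc c w by (simp add: M.smult_assoc1)
  next
    case False
    then have "x \<in> S" "x \<in> carrier M" using x S by auto
    have "(z \<otimes> B w w) \<odot>\<^bsub>M\<^esub> x = B w w \<odot>\<^bsub>M\<^esub> (z \<odot>\<^bsub>M\<^esub> x)"
      using zc c \<open>x \<in> carrier M\<close> by (simp add: M.smult_assoc1[symmetric] m_comm)
    then show ?thesis using z(2)[OF \<open>x \<in> S\<close>] c by simp
  qed
  moreover have "z \<otimes> B w w \<in> D (m + k)" using D_mult z diag by simp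
  ultimately show ?case using m by (intro exI[of _ "m + k"]) auto
qed

text \<open>
  The matrix is \<open>s - A\<close>, where \<open>A\<close> has entries in \<open>I\<close> and expresses multiplication by
  \<open>s\<close> on the generators.
\<close>

lemma determinant_trick:
  assumes M: "module R M" and S: "finite S" "S \<subseteq> carrier M"
    and sS: "\<And>x. x \<in> S \<Longrightarrow> s \<odot>\<^bsub>M\<^esub> x \<in> combinations M I S"
  shows "\<exists>m>0. \<exists>z\<in>D m. \<forall>x\<in>S. z \<odot>\<^bsub>M\<^esub> x = \<zero>\<^bsub>M\<^esub>"
proof -
  interpret M: module R M by fact
  have "\<exists>a. a \<in> S \<rightarrow> I \<and> s \<odot>\<^bsub>M\<^esub> x = (\<Oplus>\<^bsub>M\<^esub>y\<in>S. a y \<odot>\<^bsub>M\<^esub> y)" if "x \<in> S" for x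
    using sS[OF that] by (auto simp: combinations_def)
  then obtain a where a: "\<And>x. x \<in> S \<Longrightarrow> a x \<in> S \<rightarrow> I"
    and eq: "\<And>x. x \<in> S \<Longrightarrow> s \<odot>\<^bsub>M\<^esub> x = (\<Oplus>\<^bsub>M\<^esub>y\<in>S. a x y \<odot>\<^bsub>M\<^esub> y)" by metis
  have aI: "a x y \<in> I" "a x y \<in> carrier R" if "x \<in> S" "y \<in> S" for x y
    using funcset_mem[OF a[OF that(1)] that(2)] Icarr by auto
  define B where "B x y = (if x = y then s else \<zero>) \<oplus> \<ominus> a x y" for x y
  show ?thesis
  proof (rule eliminated_annihilator[OF M S, of 1 B])
    fix x assume x: "x \<in> S"
    show "B x x \<in> D 1" unfolding B_def using D_add_E[OF s_D] E_neg[OF I_E] aI x by simp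
    have "(\<Oplus>\<^bsub>M\<^esub>y\<in>S. B x y \<odot>\<^bsub>M\<^esub> y) =
      (\<Oplus>\<^bsub>M\<^esub>y\<in>S. (if x = y then s else \<zero>) \<odot>\<^bsub>M\<^esub> y \<oplus>\<^bsub>M\<^esub> (\<ominus> \<one>) \<odot>\<^bsub>M\<^esub> (a x y \<odot>\<^bsub>M\<^esub> y))"
    proof (rule M.M.finsum_cong'[OF refl])
      fix y assume y: "y \<in> S"
      then show "B x y \<odot>\<^bsub>M\<^esub> y = (if x = y then s else \<zero>) \<odot>\<^bsub>M\<^esub> y \<oplus>\<^bsub>M\<^esub> (\<ominus> \<one>) \<odot>\<^bsub>M\<^esub> (a x y \<odot>\<^bsub>M\<^esub> y)"
        using aI[OF x y] s S by (auto simp: B_def M.smult_l_distr M.smult_l_minus)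
    qed (use aI x S s in auto)
    also have "\<dots> = (\<Oplus>\<^bsub>M\<^esub>y\<in>S. (if x = y then s else \<zero>) \<odot>\<^bsub>M\<^esub> y) \<oplus>\<^bsub>M\<^esub> (\<Oplus>\<^bsub>M\<^esub>y\<in>S. (\<ominus> \<one>) \<odot>\<^bsub>M\<^esub> (a x y \<odot>\<^bsub>M\<^esub> y))"
      by (rule M.M.finsum_addf) (use aI x S s in auto)
    also have "(\<Oplus>\<^bsub>M\<^esub>y\<in>S. (if x = y then s else \<zero>) \<odot>\<^bsub>M\<^esub> y) = s \<odot>\<^bsub>M\<^esub> x"
      by (rule M.delta_combination[OF S x s])
    also have "(\<Oplus>\<^bsub>M\<^esub>y\<in>S. (\<ominus> \<one>) \<odot>\<^bsub>M\<^esub> (a x y \<odot>\<^bsub>M\<^esub> y)) = (\<ominus> \<one>) \<odot>\<^bsub>M\<^esub> (s \<odot>\<^bsub>M\<^esub> x)"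
      unfolding eq[OF x] by (rule M.finsum_smult_ldistr[symmetric]) (use aI x S in auto)
    finally show "(\<Oplus>\<^bsub>M\<^esub>y\<in>S. B x y \<odot>\<^bsub>M\<^esub> y) = \<zero>\<^bsub>M\<^esub>"
      using x S s by (simp add: M.smult_l_minus M.M.r_neg subset_iff)
  next
    fix x y assume "x \<in> S" "y \<in> S" "x \<noteq> y"
    then show "B x y \<in> E 1" unfolding B_def using E_neg[OF I_E] aI by simp
  qed simp
qed

end

section \<open>Finite free modules\<close>

lemma free_module_simps [simp]:
  "\<zero>\<^bsub>free_module R X\<^esub> = (\<lambda>_. \<zero>\<^bsub>R\<^esub>)"
  "f \<oplus>\<^bsub>free_module R X\<^esub> g = (\<lambda>x. f x \<oplus>\<^bsub>R\<^esub> g x)"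
  "r \<odot>\<^bsub>free_module R X\<^esub> f = (\<lambda>x. r \<otimes>\<^bsub>R\<^esub> f x)"
  by (simp_all add: free_module_def)

lemma (in ring) free_coord: "f \<in> carrier (free_module R X) \<Longrightarrow> f x \<in> carrier R"
  by (cases "x \<in> X") (auto simp: free_module_def)

lemma (in cring) free_minus:
  assumes "f \<in> carrier (free_module R X)" "g \<in> carrier (free_module R X)"
  shows "f \<ominus>\<^bsub>free_module R X\<^esub> g = (\<lambda>x. f x \<ominus> g x)"
proof -
  interpret F: module R "free_module R X" by (rule module_free_module[OF is_cring])
  have "\<ominus>\<^bsub>free_module R X\<^esub> g = (\<ominus> \<one>) \<odot>\<^bsub>free_module R X\<^esub> g"
    using F.smult_l_minus[OF one_closed assms(2)] F.smult_one[OF assms(2)] by (simp only:)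
  then show ?thesis using free_coord[OF assms(1)] free_coord[OF assms(2)] by (simp add: a_minus_def l_minus)
qed

lemma (in cring) submodule_free_subset:
  assumes "X \<subseteq> Y" "submodule H R (free_module R Y)"
  shows "submodule (H \<inter> carrier (free_module R X)) R (free_module R X)"
proof -
  interpret F: module R "free_module R X" by (rule module_free_module[OF is_cring])
  interpret G: module R "free_module R Y" by (rule module_free_module[OF is_cring])
  note h = G.submodule_zero[OF assms(2)] G.submodule_add[OF assms(2)] G.submodule_smult[OF assms(2)]
  show ?thesis
    by (rule F.submoduleI')
       (use h F.M.zero_closed F.M.add.m_closed F.smult_closed in auto)
qed

text \<open>
  Induction on the rank, separating one coordinate \<open>x\<close>. The \<open>x\<close>-coordinates of \<open>K\<close> form an
  ideal, which is generated by the coordinates of a finite \<open>T \<subseteq> K\<close>; the elements of \<open>K\<close> with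
  vanishing \<open>x\<close>-coordinate have rank one less, hence finitely many generators \<open>U\<close>. Subtracting
  from an element of \<open>K\<close> a combination of \<open>T\<close> with the same \<open>x\<close>-coordinate leaves a combination of
  \<open>U\<close>.
\<close>

lemma free_submodule_fg:
  fixes X :: "'x set"
  assumes "cring R" "noetherian_ring R" and "finite X" "submodule K R (free_module R X)"
  shows "\<exists>S\<subseteq>K. finite S \<and> K \<subseteq> module_span R (free_module R X) S"
  using assms(3,4)
proof (induction X arbitrary: K rule: finite_induct)
  case empty
  interpret R: cring R by fact
  interpret F: module R "free_module R ({}::'x set)" by (rule module_free_module[OF assms(1)])
  have "K \<subseteq> {\<lambda>_. \<zero>\<^bsub>R\<^esub>}" using F.submodule_carr[OF empty] by (auto simp: free_module_def)
  moreover have "(\<lambda>_. \<zero>\<^bsub>R\<^esub>) \<in> module_span R (free_module R ({}::'x set)) {}"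
    using F.submodule_zero[OF F.module_span_submodule[of "{}"]] by simp
  ultimately show ?case by (intro exI[of _ "{}"]) auto
next
  case (insert x X)
  interpret R: cring R by fact
  interpret N: noetherian_ring R by fact
  let ?F = "free_module R (insert x X)"
  interpret F: module R ?F by (rule module_free_module[OF assms(1)])
  interpret G: module R "free_module R X" by (rule module_free_module[OF assms(1)])
  note K = insert.prems
  have coord_ideal: "ideal ((\<lambda>f. f x) ` H) R" if H: "submodule H R ?F" for H
  proof (rule idealI)
    have hc: "f x \<in> carrier R" if "f \<in> H" for f
      using R.free_coord[OF F.submodule_carr[OF H that]] .
    show "ring R" by (rule R.ring_axioms)
    show "subgroup ((\<lambda>f. f x) ` H) (add_monoid R)"
    proof (rule R.add.subgroupI)
      show "(\<lambda>f. f x) ` H \<subseteq> carrier R" using hc by auto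
      show "(\<lambda>f. f x) ` H \<noteq> {}" using F.submodule_zero[OF H] by blast
      fix a assume "a \<in> (\<lambda>f. f x) ` H"
      then obtain f where f: "f \<in> H" "a = f x" by auto
      have "(\<ominus>\<^bsub>R\<^esub> \<one>\<^bsub>R\<^esub>) \<odot>\<^bsub>?F\<^esub> f \<in> H" by (rule F.submodule_smult[OF H]) (use f in auto)
      then have "(\<ominus>\<^bsub>R\<^esub> \<one>\<^bsub>R\<^esub>) \<otimes>\<^bsub>R\<^esub> f x \<in> (\<lambda>f. f x) ` H" by force
      then show "\<ominus>\<^bsub>R\<^esub> a \<in> (\<lambda>f. f x) ` H"
        using f hc by (simp add: R.l_minus)
      fix b assume "b \<in> (\<lambda>f. f x) ` H"
      then obtain g where g: "g \<in> H" "b = g x" by auto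
      have "f \<oplus>\<^bsub>?F\<^esub> g \<in> H" by (rule F.submodule_add[OF H f(1) g(1)])
      then show "a \<oplus>\<^bsub>R\<^esub> b \<in> (\<lambda>f. f x) ` H" unfolding f g by force
    qed
    fix a r assume "a \<in> (\<lambda>f. f x) ` H" and r: "r \<in> carrier R"
    then obtain f where f: "f \<in> H" "a = f x" by auto
    have "r \<odot>\<^bsub>?F\<^esub> f \<in> H" by (rule F.submodule_smult[OF H r f(1)])
    then show "r \<otimes>\<^bsub>R\<^esub> a \<in> (\<lambda>f. f x) ` H" unfolding f by force
    then show "a \<otimes>\<^bsub>R\<^esub> r \<in> (\<lambda>f. f x) ` H" using r f hc by (simp add: R.m_comm)
  qed
  obtain A where A: "A \<subseteq> carrier R" "finite A" "(\<lambda>f. f x) ` K = genideal R A"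
    using N.finetely_gen[OF coord_ideal[OF K]] by auto
  have "A \<subseteq> (\<lambda>f. f x) ` K" unfolding A(3) by (rule R.genideal_self[OF A(1)])
  then obtain T where T: "T \<subseteq> K" "finite T" "A = (\<lambda>f. f x) ` T"
    using finite_subset_image[OF A(2)] by metis
  have K0: "submodule (K \<inter> carrier (free_module R X)) R (free_module R X)"
    by (rule R.submodule_free_subset[OF _ K]) auto
  from insert.IH[OF this] obtain U where U: "U \<subseteq> K \<inter> carrier (free_module R X)" "finite U"
    "K \<inter> carrier (free_module R X) \<subseteq> module_span R (free_module R X) U" by auto
  have "K \<subseteq> module_span R ?F (T \<union> U)"
  proof
    fix f assume f: "f \<in> K"
    let ?H = "module_span R ?F (T \<union> U) \<inter> K"
    have TU: "T \<union> U \<subseteq> carrier ?F" using T U F.submodule_carr[OF K] by auto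
    note sp = F.module_span_submodule[OF TU]
    have H: "submodule ?H R ?F"
      by (rule F.submoduleI')
         (use F.submodule_carr[OF K] F.submodule_zero[OF K] F.submodule_zero[OF sp] F.submodule_add[OF K]
           F.submodule_add[OF sp] F.submodule_smult[OF K] F.submodule_smult[OF sp] in auto)
    have TH: "T \<subseteq> ?H" using T module_span_self[of "T \<union> U"] by blast
    have "genideal R A \<subseteq> (\<lambda>f. f x) ` ?H"
      by (rule R.genideal_minimal[OF coord_ideal[OF H]]) (use TH T(3) in blast)
    moreover have "f x \<in> genideal R A" using f A(3) by blast
    ultimately have "f x \<in> (\<lambda>f. f x) ` ?H" by (rule subsetD)
    then obtain h where h: "h \<in> ?H" "h x = f x" by (elim imageE) simp
    have c: "f \<in> carrier ?F" "h \<in> carrier ?F" using F.submodule_carr[OF K] f h by auto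
    let ?g = "f \<ominus>\<^bsub>?F\<^esub> h"
    have gK: "?g \<in> K" by (rule F.submodule_minus[OF K f]) (use h in auto)
    have "?g x = \<zero>\<^bsub>R\<^esub>" unfolding R.free_minus[OF c] using h R.free_coord[OF c(1)] by (simp add: R.r_neg a_minus_def)
    moreover have "?g \<in> carrier ?F" by (rule F.submodule_carr[OF K gK])
    ultimately have "?g \<in> carrier (free_module R X)" by (auto simp: free_module_def)
    then have "?g \<in> module_span R (free_module R X) U" using gK U(3) by auto
    also have "\<dots> \<subseteq> module_span R ?F (T \<union> U) \<inter> carrier (free_module R X)"
      by (rule module_span_least[OF R.submodule_free_subset[OF _ sp]])
         (use U module_span_self[of "T \<union> U" R ?F] in auto)
    finally have "?g \<in> module_span R ?F (T \<union> U)" by simp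
    then have "?g \<oplus>\<^bsub>?F\<^esub> h \<in> module_span R ?F (T \<union> U)" using F.submodule_add[OF sp] h by blast
    also have "?g \<oplus>\<^bsub>?F\<^esub> h = f"
      unfolding a_minus_def using c by (simp add: F.M.a_assoc F.M.l_neg del: free_module_simps)
    finally show "f \<in> module_span R ?F (T \<union> U)" .
  qed
  then show ?case using T U by (intro exI[of _ "T \<union> U"]) auto
qed

lemma ideal_smult_free:
  assumes "cring R" "ideal I R" "f \<in> carrier (free_module R X)"
  shows "f \<in> ideal_smult (free_module R X) I (carrier (free_module R X)) \<longleftrightarrow> (\<forall>x. f x \<in> I)"
proof
  interpret R: cring R by fact
  interpret I: ideal I R by fact
  assume "f \<in> ideal_smult (free_module R X) I (carrier (free_module R X))"
  then show "\<forall>x. f x \<in> I"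
    by induction (auto intro: I.I_r_closed R.free_coord)
next
  interpret R: cring R by fact
  interpret I: ideal I R by fact
  let ?F = "free_module R X"
  assume f: "\<forall>x. f x \<in> I"
  have "finite A \<Longrightarrow> A \<subseteq> X \<Longrightarrow> f \<in> carrier ?F \<Longrightarrow> \<forall>x. f x \<in> I \<Longrightarrow> {x. f x \<noteq> \<zero>\<^bsub>R\<^esub>} \<subseteq> A \<Longrightarrow>
    f \<in> ideal_smult ?F I (carrier ?F)" for A f
  proof (induction A arbitrary: f rule: finite_induct)
    case empty
    then have "f = \<zero>\<^bsub>?F\<^esub>" by auto
    then show ?case by (metis ideal_smult.zero)
  next
    case (insert x A)
    let ?g = "f(x := \<zero>\<^bsub>R\<^esub>)"
    have "finite {y. ?g y \<noteq> \<zero>\<^bsub>R\<^esub>}"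
      by (rule finite_subset[OF _ insert.hyps(1)]) (use insert.prems in auto)
    then have "?g \<in> ideal_smult ?F I (carrier ?F)"
      by (intro insert.IH) (use insert.prems in \<open>auto simp: free_module_def\<close>)
    moreover have "f x \<odot>\<^bsub>?F\<^esub> free_basis R x \<in> ideal_smult ?F I (carrier ?F)"
      by (rule ideal_smult.smult) (use insert.prems free_basis_carrier[OF assms(1)] in auto)
    ultimately have "?g \<oplus>\<^bsub>?F\<^esub> f x \<odot>\<^bsub>?F\<^esub> free_basis R x \<in> ideal_smult ?F I (carrier ?F)"
      by (rule ideal_smult.add)
    also have "?g \<oplus>\<^bsub>?F\<^esub> f x \<odot>\<^bsub>?F\<^esub> free_basis R x = f"
      using R.free_coord[OF insert.prems(2)] by (auto simp: free_basis_def)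
    finally show ?case .
  qed
  from this[OF free_carrier(3)[OF assms(3)] _ assms(3) f] free_carrier(2)[OF assms(3)]
  show "f \<in> ideal_smult ?F I (carrier ?F)" by blast
qed

section \<open>Pure submodules over an integrally closed ideal\<close>

text \<open>
  The heart of the proof. Purity turns \<open>s K \<subseteq> I F\<close> into \<open>s K \<subseteq> I K\<close>, to which the
  determinant trick applies; this is used twice.

  Suppose that some coordinate \<open>c\<close> of an element of \<open>K\<close> is not in \<open>I\<close>. A multiple \<open>s\<close> of
  \<open>c\<close> lies in \<open>(I : \<mm>)\<close> but not in \<open>I\<close>. Since \<open>K \<subseteq> \<mm> F\<close>, we get
  \<open>s K \<subseteq> I F\<close>, so a monic value \<open>z\<close> at \<open>s\<close> kills \<open>K\<close>. In particular \<open>z c = 0\<close>,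
  hence \<open>z s = 0\<close>. But \<open>z s\<close> is a monic value at \<open>s\<close> again, so \<open>s\<close> is integral over
  \<open>I\<close> and therefore in \<open>I\<close>, a contradiction. That \<open>s\<close> comes from a coordinate of \<open>K\<close> is
  what makes the argument work when \<open>K\<close> has a large annihilator.

  Hence \<open>K \<subseteq> I F\<close> and \<open>K = I K\<close>. The trick for \<open>s = 1\<close> gives an element of
  \<open>1 + I\<close> that kills \<open>K\<close>, and it is a unit.
\<close>

lemma (in noetherian_local_ring) pure_submodule_zero:
  assumes prim: "primary_to R \<mm> I" and closed: "integrally_closed_ideal R I"
    and X: "finite X" and K: "submodule K R (free_module R X)"
    and Km: "\<And>f x. f \<in> K \<Longrightarrow> f x \<in> \<mm>"
    and pure: "pure_for (free_module R X) I K"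
  shows "K = {\<zero>\<^bsub>free_module R X\<^esub>}"
proof -
  let ?F = "free_module R X"
  have cr: "cring R" by (rule is_cring)
  interpret F: module R ?F by (rule module_free_module[OF cr])
  interpret I: ideal I R using prim by (auto simp: primary_to_def primary_ideal_def)
  have Im: "I \<subseteq> \<mm>"
  proof
    fix x assume x: "x \<in> I"
    then have "x [^] (1::nat) \<in> I" using I.Icarr by simp
    then show "x \<in> \<mm>" using prim x I.Icarr unfolding primary_to_def ideal_radical_def by blast
  qed
  obtain S where S: "S \<subseteq> K" "finite S" "K \<subseteq> module_span R ?F S"
    using free_submodule_fg[OF cr noetherian_ring_axioms X K] by blast
  have Sc: "S \<subseteq> carrier ?F" using S F.submodule_carr[OF K] by blast
  have Kspan: "K = module_span R ?F S" using S(3) module_span_least[OF K S(1)] by blast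
  have trick: "\<exists>m>0. \<exists>z\<in>monic_values R I s m. \<forall>f\<in>K. z \<odot>\<^bsub>?F\<^esub> f = \<zero>\<^bsub>?F\<^esub>"
    if s: "s \<in> carrier R" and sK: "\<And>f x. f \<in> K \<Longrightarrow> s \<otimes> f x \<in> I" for s
  proof -
    interpret ideal_element I R s by unfold_locales (rule s)
    have "s \<odot>\<^bsub>?F\<^esub> f \<in> combinations ?F I S" if f: "f \<in> S" for f
    proof -
      have "s \<odot>\<^bsub>?F\<^esub> f \<in> K" using F.submodule_smult[OF K s] f S(1) by blast
      moreover have "s \<odot>\<^bsub>?F\<^esub> f \<in> carrier ?F" using F.smult_closed[OF s] f Sc by blast
      then have "s \<odot>\<^bsub>?F\<^esub> f \<in> ideal_smult ?F I (carrier ?F)"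
        using sK f S(1) by (subst ideal_smult_free[OF cr I.is_ideal]) auto
      ultimately have "s \<odot>\<^bsub>?F\<^esub> f \<in> ideal_smult ?F I (module_span R ?F S)" using pure Kspan unfolding pure_for_def by blast
      then show ?thesis using F.ideal_smult_span[OF I.is_ideal S(2) Sc] by blast
    qed
    from determinant_trick[OF F.module_axioms S(2) Sc this] obtain m z where m: "0 < m"
      and z: "z \<in> monic_values R I s m" "\<forall>f\<in>S. z \<odot>\<^bsub>?F\<^esub> f = \<zero>\<^bsub>?F\<^esub>" by blast
    have "K \<subseteq> {f \<in> carrier ?F. z \<odot>\<^bsub>?F\<^esub> f = \<zero>\<^bsub>?F\<^esub>}"
      unfolding Kspan by (rule module_span_least[OF F.annihilated_submodule[OF D_carr[OF z(1)]]]) (use Sc z in blast)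
    then show ?thesis using m z by blast
  qed
  have KI: "f x \<in> I" if f: "f \<in> K" for f x
  proof (rule ccontr)
    assume nI: "f x \<notin> I"
    have fc: "f x \<in> carrier R" using free_coord[OF F.submodule_carr[OF K f]] .
    obtain r where r: "r \<in> carrier R" "r \<otimes> f x \<notin> I" "\<And>y. y \<in> \<mm> \<Longrightarrow> y \<otimes> (r \<otimes> f x) \<in> I"
      using primary_socle_multiple[OF prim fc nI] by blast
    let ?s = "r \<otimes> f x"
    have s: "?s \<in> carrier R" using r fc by simp
    interpret ideal_element I R ?s by unfold_locales (rule s)
    have "?s \<otimes> g y \<in> I" if g: "g \<in> K" for g y
      using r(3)[OF Km[OF g]] s free_coord[OF F.submodule_carr[OF K g]] by (simp add: m_comm)
    from trick[OF s] this obtain m z where m: "0 < m" and z: "z \<in> D m" "\<And>f. f \<in> K \<Longrightarrow> z \<odot>\<^bsub>?F\<^esub> f = \<zero>\<^bsub>?F\<^esub>"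
      by blast
    have zc: "z \<in> carrier R" by (rule D_carr[OF z(1)])
    have "z \<otimes> f x = \<zero>" using z(2)[OF f] by (simp add: fun_eq_iff)
    moreover have "z \<otimes> ?s = r \<otimes> (z \<otimes> f x)" using zc r fc by (simp add: m_ac)
    ultimately have "\<zero> \<in> D (m + 1)" using D_mult[OF z(1) s_D] r by simp
    then have "?s \<in> integral_closure_ideal R I" using integral_if_monic_zero[of "m + 1"] by simp
    then show False using closed r(2) unfolding integrally_closed_ideal_def by simp
  qed
  have "\<one> \<otimes> f x \<in> I" if "f \<in> K" for f x using KI[OF that] I.Icarr by simp
  from trick[OF one_closed] this obtain m z where z: "z \<in> monic_values R I \<one> m"
    and kill: "\<And>f. f \<in> K \<Longrightarrow> z \<odot>\<^bsub>?F\<^esub> f = \<zero>\<^bsub>?F\<^esub>" by blast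
  interpret ideal_element I R \<one> by unfold_locales simp
  obtain e where e: "e \<in> E m" "z = \<one> \<oplus> e" using z by (auto simp: monic_values_def)
  have eI: "e \<in> I" using e E_subset_I by blast
  have zc: "z \<in> carrier R" by (rule D_carr[OF z])
  have "z \<notin> \<mm>"
  proof
    assume "z \<in> \<mm>"
    then have "z \<oplus> \<ominus> e \<in> \<mm>" using eI Im by (meson a_closed a_inv_closed subsetD)
    also have "z \<oplus> \<ominus> e = \<one>" using e eI I.Icarr by (simp add: a_assoc r_neg)
    finally show False using one_notin_maximal by blast
  qed
  then have u: "z \<in> Units R" using unit_if_notin_maximal zc by blast
  have "f = \<zero>\<^bsub>?F\<^esub>" if f: "f \<in> K" for f
  proof -
    have fc: "f \<in> carrier ?F" using F.submodule_carr[OF K f] .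
    have "f = (inv z \<otimes> z) \<odot>\<^bsub>?F\<^esub> f" using u F.smult_one[OF fc] by (simp del: free_module_simps)
    also have "\<dots> = inv z \<odot>\<^bsub>?F\<^esub> (z \<odot>\<^bsub>?F\<^esub> f)" using u zc fc by (intro F.smult_assoc1) auto
    also have "\<dots> = \<zero>\<^bsub>?F\<^esub>" unfolding kill[OF f] using u by (intro F.smult_r_null) auto
    finally show ?thesis .
  qed
  then show ?thesis using F.submodule_zero[OF K] by blast
qed

section \<open>Minimal covers\<close>

text \<open>
  Map a basis onto a generating set of minimal size. A relation with a coordinate outside
  \<open>\<mm>\<close>, that is, with a unit coordinate, would express that generator by the others.
  The index type is left open, so that the modules of a resolution can all have the same type.
\<close>

lemma (in noetherian_local_ring) minimal_cover:
  fixes N :: "('a, 'n, 'k) module_scheme"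
  assumes N: "finitely_generated_module R N" and inf: "infinite (UNIV :: 'i set)"
  obtains X :: "'i set" and \<pi> where "finite X" "\<pi> \<in> mod_hom R (free_module R X) N"
    "\<pi> ` carrier (free_module R X) = carrier N"
    "\<And>f x. f \<in> a_kernel (free_module R X) N \<pi> \<Longrightarrow> f x \<in> \<mm>"
proof -
  have mod: "module R N" using N by (simp add: finitely_generated_module_def)
  interpret N: module R N by fact
  let ?P = "\<lambda>S. finite S \<and> S \<subseteq> carrier N \<and> carrier N \<subseteq> module_span R N S"
  have "\<exists>S. ?P S" using N unfolding finitely_generated_module_def by blast
  then obtain S0 where "?P S0" by (rule exE)
  from ex_has_least_nat[of ?P S0 card, OF this] obtain S
    where S: "?P S" and min: "\<And>T. ?P T \<Longrightarrow> card S \<le> card T" by auto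
  obtain X :: "'i set" where X: "finite X" "card X = card S"
    using infinite_arbitrarily_large[OF inf] by blast
  then obtain \<phi> where \<phi>: "bij_betw \<phi> X S" using finite_same_card_bij[of X S] S by auto
  let ?F = "free_module R X" and ?\<pi> = "lin_ext R N \<phi>"
  interpret F: module R ?F by (rule module_free_module[OF is_cring])
  have \<phi>X: "\<phi> \<in> X \<rightarrow> carrier N" using bij_betwE[OF \<phi>] S by auto
  have hom: "?\<pi> \<in> mod_hom R ?F N" by (rule lin_ext_hom[OF mod \<phi>X])
  have exp: "?\<pi> f = (\<Oplus>\<^bsub>N\<^esub>x\<in>X. f x \<odot>\<^bsub>N\<^esub> \<phi> x)" if "f \<in> carrier ?F" for f
    by (rule lin_ext_eq[OF mod that \<phi>X X(1)]) (use free_carrier(2)[OF that] in auto)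
  have im: "submodule (?\<pi> ` carrier ?F) R N"
  proof (rule N.submoduleI')
    show "?\<pi> ` carrier ?F \<subseteq> carrier N" using mod_homD(1)[OF hom] by auto
    show "\<zero>\<^bsub>N\<^esub> \<in> ?\<pi> ` carrier ?F"
      using mod_hom_zero[OF F.module_axioms mod hom] F.M.zero_closed by (metis imageI)
    fix a b assume "a \<in> ?\<pi> ` carrier ?F" "b \<in> ?\<pi> ` carrier ?F"
    then obtain f g where fg: "f \<in> carrier ?F" "a = ?\<pi> f" "g \<in> carrier ?F" "b = ?\<pi> g" by blast
    then have "a \<oplus>\<^bsub>N\<^esub> b = ?\<pi> (f \<oplus>\<^bsub>?F\<^esub> g)" using mod_homD(2)[OF hom] by metis
    then show "a \<oplus>\<^bsub>N\<^esub> b \<in> ?\<pi> ` carrier ?F" using F.M.add.m_closed[OF fg(1,3)] by (metis imageI)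
  next
    fix r b assume r: "r \<in> carrier R" and "b \<in> ?\<pi> ` carrier ?F"
    then obtain f where f: "f \<in> carrier ?F" "b = ?\<pi> f" by blast
    then have "r \<odot>\<^bsub>N\<^esub> b = ?\<pi> (r \<odot>\<^bsub>?F\<^esub> f)" using mod_homD(3)[OF hom r] by metis
    then show "r \<odot>\<^bsub>N\<^esub> b \<in> ?\<pi> ` carrier ?F" using F.smult_closed[OF r f(1)] by (metis imageI)
  qed
  have "S \<subseteq> ?\<pi> ` carrier ?F"
  proof
    fix y assume "y \<in> S"
    then obtain x where x: "x \<in> X" "y = \<phi> x" using bij_betw_imp_surj_on[OF \<phi>] by blast
    then show "y \<in> ?\<pi> ` carrier ?F"
      using lin_ext_basis[OF mod \<phi>X x(1)] free_basis_carrier[OF is_cring x(1)] by (metis imageI)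
  qed
  then have surj: "?\<pi> ` carrier ?F = carrier N"
    using module_span_least[OF im] S N.submodule_carr[OF im] by blast
  have ker: "f x \<in> \<mm>" if f: "f \<in> a_kernel ?F N ?\<pi>" for f x
  proof (rule ccontr)
    assume nm: "f x \<notin> \<mm>"
    have fc: "f \<in> carrier ?F" "?\<pi> f = \<zero>\<^bsub>N\<^esub>" using f by (auto simp: a_kernel_def')
    have "f x \<noteq> \<zero>" using nm zero_closed by metis
    then have x: "x \<in> X" using free_carrier(2)[OF fc(1)] by auto
    have u: "f x \<in> Units R" using unit_if_notin_maximal[OF free_coord[OF fc(1)] nm] .
    let ?T = "S - {\<phi> x}"
    have T: "?T \<subseteq> carrier N" using S by auto
    have sp: "submodule (module_span R N ?T) R N" by (rule N.module_span_submodule[OF T])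
    have Xx: "\<phi> y \<in> ?T" if "y \<in> X - {x}" for y
      using \<phi> that x by (auto simp: bij_betw_def inj_on_def)
    have mem: "f y \<odot>\<^bsub>N\<^esub> \<phi> y \<in> module_span R N ?T" if "y \<in> X - {x}" for y
      by (rule N.submodule_smult[OF sp free_coord[OF fc(1)] subsetD[OF module_span_self Xx[OF that]]])
    define w where "w = (\<Oplus>\<^bsub>N\<^esub>y\<in>X - {x}. f y \<odot>\<^bsub>N\<^esub> \<phi> y)"
    have w: "w \<in> module_span R N ?T"
      unfolding w_def by (rule N.submodule_finsum[OF sp]) (use X mem in auto)
    have wc: "w \<in> carrier N" by (rule N.submodule_carr[OF sp w])
    have px: "\<phi> x \<in> carrier N" using \<phi>X x by auto
    have "\<zero>\<^bsub>N\<^esub> = (\<Oplus>\<^bsub>N\<^esub>y\<in>insert x (X - {x}). f y \<odot>\<^bsub>N\<^esub> \<phi> y)"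
      using exp[OF fc(1)] fc(2) x by (simp add: insert_absorb)
    also have "\<dots> = f x \<odot>\<^bsub>N\<^esub> \<phi> x \<oplus>\<^bsub>N\<^esub> w"
      unfolding w_def by (rule N.M.finsum_insert) (use X \<phi>X x free_coord[OF fc(1)] in auto)
    finally have "f x \<odot>\<^bsub>N\<^esub> \<phi> x = \<ominus>\<^bsub>N\<^esub> w"
      using N.M.minus_equality[of "f x \<odot>\<^bsub>N\<^esub> \<phi> x" w] wc px free_coord[OF fc(1)] by simp
    then have "f x \<odot>\<^bsub>N\<^esub> \<phi> x \<in> module_span R N ?T" using N.submoduleE(3)[OF sp w] by simp
    then have "inv (f x) \<odot>\<^bsub>N\<^esub> (f x \<odot>\<^bsub>N\<^esub> \<phi> x) \<in> module_span R N ?T"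
      by (rule N.submodule_smult[OF sp Units_inv_closed[OF u]])
    also have "inv (f x) \<odot>\<^bsub>N\<^esub> (f x \<odot>\<^bsub>N\<^esub> \<phi> x) = \<phi> x"
      using u px free_coord[OF fc(1)] by (simp add: N.smult_assoc1[symmetric])
    finally have "S \<subseteq> module_span R N ?T" using module_span_self[of ?T R N] by auto
    then have "?P ?T" using S module_span_least[OF sp] T by blast
    then have "card S \<le> card ?T" by (rule min)
    moreover have "\<phi> x \<in> S" using \<phi> x by (auto simp: bij_betw_def)
    ultimately show False using S card_Diff1_less[of S "\<phi> x"] by simp
  qed
  show thesis by (rule that[OF X(1) hom surj]) (rule ker)
qed

section \<open>Homomorphisms and submodules\<close>

lemma mod_hom_id: "(\<lambda>x. x) \<in> mod_hom R M M"
  by (simp add: mod_hom_def)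

lemma mod_hom_minus:
  assumes "module R M" "module R N" "h \<in> mod_hom R M N" "x \<in> carrier M" "y \<in> carrier M"
  shows "h (x \<ominus>\<^bsub>M\<^esub> y) = h x \<ominus>\<^bsub>N\<^esub> h y"
proof -
  interpret M: module R M by fact
  interpret N: module R N by fact
  note h = mod_homD[OF assms(3)]
  have "h (\<ominus>\<^bsub>M\<^esub> y) = h ((\<ominus>\<^bsub>R\<^esub> \<one>\<^bsub>R\<^esub>) \<odot>\<^bsub>M\<^esub> y)" using assms by (simp add: M.smult_l_minus)
  also have "\<dots> = \<ominus>\<^bsub>N\<^esub> h y" using assms h by (simp add: N.smult_l_minus)
  finally show ?thesis using assms h by (simp add: a_minus_def)
qed

lemma submodule_image:
  assumes "module R M" "module R N" "h \<in> mod_hom R M N" "submodule H R M"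
  shows "submodule (h ` H) R N"
proof -
  interpret M: module R M by fact
  interpret N: module R N by fact
  note h = mod_homD[OF assms(3)] and Hc = M.submodule_carr[OF assms(4)]
  show ?thesis
  proof (rule N.submoduleI')
    show "h ` H \<subseteq> carrier N" using h(1) Hc by auto
    show "\<zero>\<^bsub>N\<^esub> \<in> h ` H"
      using mod_hom_zero[OF assms(1-3)] M.submodule_zero[OF assms(4)] by (metis imageI)
    fix a b assume "a \<in> h ` H" "b \<in> h ` H"
    then obtain f g where fg: "f \<in> H" "a = h f" "g \<in> H" "b = h g" by blast
    then have "a \<oplus>\<^bsub>N\<^esub> b = h (f \<oplus>\<^bsub>M\<^esub> g)" using h(2) Hc by simp
    then show "a \<oplus>\<^bsub>N\<^esub> b \<in> h ` H" using M.submodule_add[OF assms(4) fg(1,3)] by simp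
  next
    fix r b assume r: "r \<in> carrier R" and "b \<in> h ` H"
    then obtain f where f: "f \<in> H" "b = h f" by blast
    then have "r \<odot>\<^bsub>N\<^esub> b = h (r \<odot>\<^bsub>M\<^esub> f)" using h(3) Hc r by simp
    then show "r \<odot>\<^bsub>N\<^esub> b \<in> h ` H" using M.submodule_smult[OF assms(4) r f(1)] by simp
  qed
qed

lemma submodule_vimage:
  assumes "module R M" "module R N" "h \<in> mod_hom R M N" "submodule H R N"
  shows "submodule {x \<in> carrier M. h x \<in> H} R M"
proof -
  interpret M: module R M by fact
  interpret N: module R N by fact
  note h = mod_homD[OF assms(3)]
  show ?thesis
    by (rule M.submoduleI')
       (use h mod_hom_zero[OF assms(1-3)] N.submodule_zero[OF assms(4)] N.submodule_add[OF assms(4)]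
          N.submodule_smult[OF assms(4)] in auto)
qed

lemma ideal_smult_submodule:
  assumes "module R M" "ideal I R" "submodule K R M"
  shows "submodule (ideal_smult M I K) R M"
proof -
  interpret M: module R M by fact
  interpret I: ideal I R by fact
  have c: "u \<in> carrier M" if "u \<in> ideal_smult M I K" for u
    using that by induction (use M.submodule_carr[OF assms(3)] in auto)
  show ?thesis
  proof (rule M.submoduleI')
    fix r u assume r: "r \<in> carrier R" and u: "u \<in> ideal_smult M I K"
    from u show "r \<odot>\<^bsub>M\<^esub> u \<in> ideal_smult M I K"
    proof induction
      case zero show ?case using r by (simp add: ideal_smult.zero)
    next
      case (smult a x)
      then have "r \<odot>\<^bsub>M\<^esub> (a \<odot>\<^bsub>M\<^esub> x) = (r \<otimes>\<^bsub>R\<^esub> a) \<odot>\<^bsub>M\<^esub> x"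
        using r M.submodule_carr[OF assms(3)] by (simp add: M.smult_assoc1)
      then show ?case using smult r ideal_smult.smult[of "r \<otimes>\<^bsub>R\<^esub> a" I x K M] I.I_l_closed by simp
    next
      case (add u v)
      then show ?case using r c by (simp add: M.smult_r_distr ideal_smult.add)
    qed
  qed (use c in \<open>auto intro: ideal_smult.intros\<close>)
qed

lemma ideal_smult_image:
  assumes "module R M" "module R N" "h \<in> mod_hom R M N" "ideal I R" "submodule K R M"
  shows "h ` ideal_smult M I K = ideal_smult N I (h ` K)"
proof -
  interpret M: module R M by fact
  interpret N: module R N by fact
  interpret I: ideal I R by fact
  note h = mod_homD[OF assms(3)] and Kc = M.submodule_carr[OF assms(5)]
  note sm = M.submodule_carr[OF ideal_smult_submodule[OF assms(1,4,5)]]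
  have "h u \<in> ideal_smult N I (h ` K)" if "u \<in> ideal_smult M I K" for u
    using that
  proof induction
    case zero show ?case using mod_hom_zero[OF assms(1-3)] by (simp add: ideal_smult.zero)
  next
    case (smult a x) then show ?case using h(3) Kc by (simp add: ideal_smult.smult)
  next
    case (add u v) then show ?case using h(2) sm by (simp add: ideal_smult.add)
  qed
  moreover have "u \<in> h ` ideal_smult M I K" if "u \<in> ideal_smult N I (h ` K)" for u
    using that
  proof induction
    case zero show ?case using mod_hom_zero[OF assms(1-3)] ideal_smult.zero by (metis imageI)
  next
    case (smult a x)
    then obtain y where y: "y \<in> K" "x = h y" by blast
    then have "a \<odot>\<^bsub>N\<^esub> x = h (a \<odot>\<^bsub>M\<^esub> y)" using smult h(3) Kc by simp
    then show ?case using imageI[OF ideal_smult.smult[OF smult(1) y(1), of M], of h] by simp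
  next
    case (add u v)
    then obtain a b where ab: "a \<in> ideal_smult M I K" "u = h a" "b \<in> ideal_smult M I K" "v = h b" by blast
    then have "u \<oplus>\<^bsub>N\<^esub> v = h (a \<oplus>\<^bsub>M\<^esub> b)" using h(2) sm by simp
    then show ?case using imageI[OF ideal_smult.add[OF ab(1,3)], of h] by simp
  qed
  ultimately show ?thesis by blast
qed

section \<open>Quotient modules\<close>

locale quotient = module R M + submodule H R M for H and R (structure) and M (structure)
begin

abbreviation "Q \<equiv> quotient_module R M H"
abbreviation "coset x \<equiv> H +>\<^bsub>M\<^esub> x"

lemma sub: "submodule H R M" by (rule submodule_axioms)

lemma abelian_sub: "abelian_subgroup H M"
  by (rule abelian_subgroupI3[OF additive_subgroupI])
     (rule submodule.axioms(1)[OF sub], rule M.abelian_group_axioms)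

lemma coset_self: "x \<in> carrier M \<Longrightarrow> x \<in> coset x"
  by (rule abelian_subgroup.a_rcos_self[OF abelian_sub])

lemma mem_coset_iff:
  assumes "x \<in> carrier M" "y \<in> carrier M"
  shows "x \<in> coset y \<longleftrightarrow> x \<ominus>\<^bsub>M\<^esub> y \<in> H"
  using abelian_subgroup.a_rcos_module[OF abelian_sub assms(2,1)] by (simp add: a_minus_def)

lemma coset_eq_iff:
  assumes "x \<in> carrier M" "y \<in> carrier M"
  shows "coset x = coset y \<longleftrightarrow> x \<ominus>\<^bsub>M\<^esub> y \<in> H"
  using M.a_repr_independence[OF _ assms(2) submodule.axioms(1)[OF sub], of x] mem_coset_iff[OF assms]
    coset_self[OF assms(1)] by auto

lemma coset_eq_zero_iff: "x \<in> carrier M \<Longrightarrow> coset x = H \<longleftrightarrow> x \<in> H"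
  using M.a_coset_join1[OF _ _ submodule.axioms(1)[OF sub]]
    M.a_coset_join2[OF _ submodule.axioms(1)[OF sub]] by blast

lemma coset_zero: "coset \<zero>\<^bsub>M\<^esub> = H"
  using coset_eq_zero_iff submodule_zero[OF sub] by simp

lemma Q_carrier: "carrier Q = coset ` carrier M"
  by (auto simp: quotient_module_def A_RCOSETS_def')

lemma Q_zero: "\<zero>\<^bsub>Q\<^esub> = H"
  by (simp add: quotient_module_def)

lemma Q_add: "x \<in> carrier M \<Longrightarrow> y \<in> carrier M \<Longrightarrow> coset x \<oplus>\<^bsub>Q\<^esub> coset y = coset (x \<oplus>\<^bsub>M\<^esub> y)"
  using abelian_subgroup.a_rcos_sum[OF abelian_sub] by (simp add: quotient_module_def)

lemma coset_carr: "x \<in> carrier M \<Longrightarrow> u \<in> coset x \<Longrightarrow> u \<in> carrier M"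
  using M.a_r_coset_subset_G[OF submoduleE(1)[OF sub]] by blast

lemma Q_smult:
  assumes r: "r \<in> carrier R" and x: "x \<in> carrier M"
  shows "r \<odot>\<^bsub>Q\<^esub> coset x = coset (r \<odot>\<^bsub>M\<^esub> x)"
proof -
  have "coset (r \<odot>\<^bsub>M\<^esub> u) = coset (r \<odot>\<^bsub>M\<^esub> x)" if u: "u \<in> coset x" for u
  proof -
    have uc: "u \<in> carrier M" by (rule coset_carr[OF x u])
    have "r \<odot>\<^bsub>M\<^esub> (u \<ominus>\<^bsub>M\<^esub> x) \<in> H"
      by (rule submodule_smult[OF sub r]) (use mem_coset_iff[OF uc x] u in simp)
    also have "r \<odot>\<^bsub>M\<^esub> (u \<ominus>\<^bsub>M\<^esub> x) = r \<odot>\<^bsub>M\<^esub> u \<ominus>\<^bsub>M\<^esub> r \<odot>\<^bsub>M\<^esub> x"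
      using r uc x by (simp add: a_minus_def smult_r_distr smult_r_minus)
    finally show ?thesis using coset_eq_iff r uc x by simp
  qed
  then have "(\<Union>u\<in>coset x. coset (r \<odot>\<^bsub>M\<^esub> u)) = coset (r \<odot>\<^bsub>M\<^esub> x)"
    using coset_self[OF x] by blast
  then show ?thesis by (simp add: quotient_module_def)
qed

lemma Q_module: "module R Q"
proof -
  have mc: "x \<in> carrier M \<Longrightarrow> coset x \<in> carrier Q" for x unfolding Q_carrier by blast
  note simps = Q_add Q_smult Q_zero
  show ?thesis
  proof (rule moduleI[OF R.is_cring abelian_groupI])
    show "\<zero>\<^bsub>Q\<^esub> \<in> carrier Q" unfolding Q_carrier Q_zero using coset_zero by (metis M.zero_closed imageI)
    fix x assume x: "x \<in> carrier Q"
    then obtain x' where x': "x' \<in> carrier M" "x = coset x'" by (auto simp: Q_carrier)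
    show "\<zero>\<^bsub>Q\<^esub> \<oplus>\<^bsub>Q\<^esub> x = x" using x' Q_add[of "\<zero>\<^bsub>M\<^esub>" x'] by (simp add: coset_zero Q_zero)
    show "\<exists>y\<in>carrier Q. y \<oplus>\<^bsub>Q\<^esub> x = \<zero>\<^bsub>Q\<^esub>"
      using x' by (intro bexI[of _ "coset (\<ominus>\<^bsub>M\<^esub> x')"]) (auto simp: simps coset_zero M.l_neg intro: mc)
    show "\<one> \<odot>\<^bsub>Q\<^esub> x = x" using x' by (simp add: simps)
    fix y assume "y \<in> carrier Q"
    then obtain y' where y': "y' \<in> carrier M" "y = coset y'" by (auto simp: Q_carrier)
    show "x \<oplus>\<^bsub>Q\<^esub> y \<in> carrier Q" using x' y' by (simp add: simps mc)
    show "x \<oplus>\<^bsub>Q\<^esub> y = y \<oplus>\<^bsub>Q\<^esub> x" using x' y' by (simp add: simps M.a_comm)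
    fix z assume "z \<in> carrier Q"
    then obtain z' where z': "z' \<in> carrier M" "z = coset z'" by (auto simp: Q_carrier)
    show "x \<oplus>\<^bsub>Q\<^esub> y \<oplus>\<^bsub>Q\<^esub> z = x \<oplus>\<^bsub>Q\<^esub> (y \<oplus>\<^bsub>Q\<^esub> z)" using x' y' z' by (simp add: simps M.a_assoc)
  next
    fix a x assume a: "a \<in> carrier R" and x: "x \<in> carrier Q"
    then obtain x' where x': "x' \<in> carrier M" "x = coset x'" by (auto simp: Q_carrier)
    show "a \<odot>\<^bsub>Q\<^esub> x \<in> carrier Q" using a x' by (simp add: simps mc)
    fix b assume b: "b \<in> carrier R"
    show "(a \<oplus> b) \<odot>\<^bsub>Q\<^esub> x = a \<odot>\<^bsub>Q\<^esub> x \<oplus>\<^bsub>Q\<^esub> b \<odot>\<^bsub>Q\<^esub> x" using a b x' by (simp add: simps smult_l_distr)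
    show "a \<otimes> b \<odot>\<^bsub>Q\<^esub> x = a \<odot>\<^bsub>Q\<^esub> (b \<odot>\<^bsub>Q\<^esub> x)" using a b x' by (simp add: simps smult_assoc1)
  next
    fix a x y assume a: "a \<in> carrier R" and "x \<in> carrier Q" "y \<in> carrier Q"
    then obtain x' y' where xy: "x' \<in> carrier M" "x = coset x'" "y' \<in> carrier M" "y = coset y'"
      by (auto simp: Q_carrier)
    then show "a \<odot>\<^bsub>Q\<^esub> (x \<oplus>\<^bsub>Q\<^esub> y) = a \<odot>\<^bsub>Q\<^esub> x \<oplus>\<^bsub>Q\<^esub> a \<odot>\<^bsub>Q\<^esub> y"
      using a by (simp add: simps smult_r_distr)
  qed
qed

lemma coset_hom: "coset \<in> mod_hom R M Q"
  using Q_carrier by (auto simp: mod_hom_def Q_add Q_smult)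

end

lemma quotientI: "module R M \<Longrightarrow> submodule H R M \<Longrightarrow> quotient H R M"
  by (simp add: quotient_def)

section \<open>Tensor products\<close>

text \<open>
  Induction principle for free modules: each element is the linear extension of the basis at
  itself, hence a combination of basis elements.
\<close>

lemma submodule_free_basis:
  assumes cr: "cring R" and W: "submodule W R (free_module R X)"
    and b: "\<And>x. x \<in> X \<Longrightarrow> free_basis R x \<in> W" and f: "f \<in> carrier (free_module R X)"
  shows "f \<in> W"
proof -
  interpret F: module R "free_module R X" by (rule module_free_module[OF cr])
  have bX: "free_basis R \<in> X \<rightarrow> carrier (free_module R X)" using free_basis_carrier[OF cr] by auto
  have "lin_ext R (free_module R X) (free_basis R) f = f"
    by (rule free_hom_eqI[OF F.module_axioms lin_ext_hom[OF F.module_axioms bX] mod_hom_id _ f])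
       (rule lin_ext_basis[OF F.module_axioms bX])
  moreover have "lin_ext R (free_module R X) (free_basis R) f \<in> W"
    unfolding lin_ext_def
  proof (rule F.submodule_finsum[OF W free_carrier(3)[OF f]], rule Pi_I)
    fix x assume "x \<in> {x. f x \<noteq> \<zero>\<^bsub>R\<^esub>}"
    then have "x \<in> X" using free_carrier(2)[OF f] by auto
    then show "f x \<odot>\<^bsub>free_module R X\<^esub> free_basis R x \<in> W"
      by (intro F.submodule_smult[OF W] b) (rule free_carrier(1)[OF f])
  qed
  ultimately show ?thesis by simp
qed

definition bilinear_on where
  "bilinear_on R N P L \<phi> \<longleftrightarrow>
     (\<forall>x\<in>carrier N. \<forall>y\<in>carrier P. \<phi> (x, y) \<in> carrier L) \<and>
     (\<forall>x\<in>carrier N. \<forall>x'\<in>carrier N. \<forall>y\<in>carrier P. \<phi> (x \<oplus>\<^bsub>N\<^esub> x', y) = \<phi> (x, y) \<oplus>\<^bsub>L\<^esub> \<phi> (x', y)) \<and>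
     (\<forall>x\<in>carrier N. \<forall>y\<in>carrier P. \<forall>y'\<in>carrier P. \<phi> (x, y \<oplus>\<^bsub>P\<^esub> y') = \<phi> (x, y) \<oplus>\<^bsub>L\<^esub> \<phi> (x, y')) \<and>
     (\<forall>r\<in>carrier R. \<forall>x\<in>carrier N. \<forall>y\<in>carrier P. \<phi> (r \<odot>\<^bsub>N\<^esub> x, y) = r \<odot>\<^bsub>L\<^esub> \<phi> (x, y)) \<and>
     (\<forall>r\<in>carrier R. \<forall>x\<in>carrier N. \<forall>y\<in>carrier P. \<phi> (x, r \<odot>\<^bsub>P\<^esub> y) = r \<odot>\<^bsub>L\<^esub> \<phi> (x, y))"

lemma bilinear_onD:
  assumes "bilinear_on R N P L \<phi>"
  shows "x \<in> carrier N \<Longrightarrow> y \<in> carrier P \<Longrightarrow> \<phi> (x, y) \<in> carrier L"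
    "x \<in> carrier N \<Longrightarrow> x' \<in> carrier N \<Longrightarrow> y \<in> carrier P \<Longrightarrow> \<phi> (x \<oplus>\<^bsub>N\<^esub> x', y) = \<phi> (x, y) \<oplus>\<^bsub>L\<^esub> \<phi> (x', y)"
    "x \<in> carrier N \<Longrightarrow> y \<in> carrier P \<Longrightarrow> y' \<in> carrier P \<Longrightarrow> \<phi> (x, y \<oplus>\<^bsub>P\<^esub> y') = \<phi> (x, y) \<oplus>\<^bsub>L\<^esub> \<phi> (x, y')"
    "r \<in> carrier R \<Longrightarrow> x \<in> carrier N \<Longrightarrow> y \<in> carrier P \<Longrightarrow> \<phi> (r \<odot>\<^bsub>N\<^esub> x, y) = r \<odot>\<^bsub>L\<^esub> \<phi> (x, y)"
    "r \<in> carrier R \<Longrightarrow> x \<in> carrier N \<Longrightarrow> y \<in> carrier P \<Longrightarrow> \<phi> (x, r \<odot>\<^bsub>P\<^esub> y) = r \<odot>\<^bsub>L\<^esub> \<phi> (x, y)"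
  using assms unfolding bilinear_on_def by blast+

locale tensor = N?: module R N + P?: module R P for R (structure) and N (structure) and P (structure)
begin

abbreviation "F \<equiv> free_module R (carrier N \<times> carrier P)"
abbreviation "T \<equiv> tensor_module R N P"
abbreviation "H \<equiv> tensor_null R N P"
abbreviation "e \<equiv> free_basis R"

lemma F_module: "module R F" by (rule module_free_module[OF R.is_cring])

lemma e_carr: "x \<in> carrier N \<Longrightarrow> y \<in> carrier P \<Longrightarrow> e (x, y) \<in> carrier F"
  by (rule free_basis_carrier[OF R.is_cring]) simp

lemma relations_carr: "tensor_relations R N P \<subseteq> carrier F"
proof -
  interpret F: module R F by (rule F_module)
  show ?thesis unfolding tensor_relations_def Let_def
    using e_carr by (auto intro!: F.M.minus_closed F.smult_closed F.M.add.m_closed simp del: free_module_simps)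
qed

lemma null_sub: "submodule H R F"
  unfolding tensor_null_def by (rule module.module_span_submodule[OF F_module relations_carr])

lemma quotient: "quotient H R F" by (rule quotientI[OF F_module null_sub])

lemma T_eq: "T = quotient_module R F H" by (simp add: tensor_module_def)

lemma T_module: "module R T" unfolding T_eq by (rule quotient.Q_module[OF quotient])

lemma pure_eq: "pure_tensor R N P x y = H +>\<^bsub>F\<^esub> e (x, y)" by (simp add: pure_tensor_def)

lemma relation_null: "u \<in> tensor_relations R N P \<Longrightarrow> u \<in> H"
  unfolding tensor_null_def by (rule subsetD[OF module_span_self])

lemma pure_bilinear: "bilinear_on R N P T (\<lambda>(x, y). pure_tensor R N P x y)"
proof -
  interpret F: module R F by (rule F_module)
  interpret Q: quotient H R F by (rule quotient)
  note c = F.M.add.m_closed F.smult_closed e_carr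
  show ?thesis unfolding bilinear_on_def prod.case T_eq pure_eq
  proof (intro conjI ballI)
    fix x y assume xy: "x \<in> carrier N" "y \<in> carrier P"
    show "H +>\<^bsub>F\<^esub> e (x, y) \<in> carrier (quotient_module R F H)"
      unfolding Q.Q_carrier using e_carr xy by blast
  next
    fix x x' y assume xy: "x \<in> carrier N" "x' \<in> carrier N" "y \<in> carrier P"
    have "e (x \<oplus>\<^bsub>N\<^esub> x', y) \<ominus>\<^bsub>F\<^esub> (e (x, y) \<oplus>\<^bsub>F\<^esub> e (x', y)) \<in> H"
      by (rule relation_null) (use xy in \<open>unfold tensor_relations_def Let_def, blast\<close>)
    then have "H +>\<^bsub>F\<^esub> e (x \<oplus>\<^bsub>N\<^esub> x', y) = H +>\<^bsub>F\<^esub> (e (x, y) \<oplus>\<^bsub>F\<^esub> e (x', y))"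
      by (subst Q.coset_eq_iff) (use xy c in \<open>simp_all del: free_module_simps\<close>)
    then show "H +>\<^bsub>F\<^esub> e (x \<oplus>\<^bsub>N\<^esub> x', y) = (H +>\<^bsub>F\<^esub> e (x, y)) \<oplus>\<^bsub>quotient_module R F H\<^esub> (H +>\<^bsub>F\<^esub> e (x', y))"
      using xy e_carr by (simp add: Q.Q_add del: free_module_simps)
  next
    fix x y y' assume xy: "x \<in> carrier N" "y \<in> carrier P" "y' \<in> carrier P"
    have "e (x, y \<oplus>\<^bsub>P\<^esub> y') \<ominus>\<^bsub>F\<^esub> (e (x, y) \<oplus>\<^bsub>F\<^esub> e (x, y')) \<in> H"
      by (rule relation_null) (use xy in \<open>unfold tensor_relations_def Let_def, blast\<close>)
    then have "H +>\<^bsub>F\<^esub> e (x, y \<oplus>\<^bsub>P\<^esub> y') = H +>\<^bsub>F\<^esub> (e (x, y) \<oplus>\<^bsub>F\<^esub> e (x, y'))"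
      by (subst Q.coset_eq_iff) (use xy c in \<open>simp_all del: free_module_simps\<close>)
    then show "H +>\<^bsub>F\<^esub> e (x, y \<oplus>\<^bsub>P\<^esub> y') = (H +>\<^bsub>F\<^esub> e (x, y)) \<oplus>\<^bsub>quotient_module R F H\<^esub> (H +>\<^bsub>F\<^esub> e (x, y'))"
      using xy e_carr by (simp add: Q.Q_add del: free_module_simps)
  next
    fix r x y assume xy: "r \<in> carrier R" "x \<in> carrier N" "y \<in> carrier P"
    have "e (r \<odot>\<^bsub>N\<^esub> x, y) \<ominus>\<^bsub>F\<^esub> r \<odot>\<^bsub>F\<^esub> e (x, y) \<in> H"
      by (rule relation_null) (use xy in \<open>unfold tensor_relations_def Let_def, blast\<close>)
    then have "H +>\<^bsub>F\<^esub> e (r \<odot>\<^bsub>N\<^esub> x, y) = H +>\<^bsub>F\<^esub> (r \<odot>\<^bsub>F\<^esub> e (x, y))"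
      by (subst Q.coset_eq_iff) (use xy c in \<open>simp_all del: free_module_simps\<close>)
    then show "H +>\<^bsub>F\<^esub> e (r \<odot>\<^bsub>N\<^esub> x, y) = r \<odot>\<^bsub>quotient_module R F H\<^esub> (H +>\<^bsub>F\<^esub> e (x, y))"
      using xy e_carr by (simp add: Q.Q_smult del: free_module_simps)
  next
    fix r x y assume xy: "r \<in> carrier R" "x \<in> carrier N" "y \<in> carrier P"
    have "e (x, r \<odot>\<^bsub>P\<^esub> y) \<ominus>\<^bsub>F\<^esub> r \<odot>\<^bsub>F\<^esub> e (x, y) \<in> H"
      by (rule relation_null) (use xy in \<open>unfold tensor_relations_def Let_def, blast\<close>)
    then have "H +>\<^bsub>F\<^esub> e (x, r \<odot>\<^bsub>P\<^esub> y) = H +>\<^bsub>F\<^esub> (r \<odot>\<^bsub>F\<^esub> e (x, y))"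
      by (subst Q.coset_eq_iff) (use xy c in \<open>simp_all del: free_module_simps\<close>)
    then show "H +>\<^bsub>F\<^esub> e (x, r \<odot>\<^bsub>P\<^esub> y) = r \<odot>\<^bsub>quotient_module R F H\<^esub> (H +>\<^bsub>F\<^esub> e (x, y))"
      using xy e_carr by (simp add: Q.Q_smult del: free_module_simps)
  qed
qed

lemmas pure_simps = bilinear_onD[OF pure_bilinear, unfolded prod.case]

text \<open>
  The universal property: the generators of the null submodule are the differences that a
  bilinear map has to send to zero.
\<close>

lemma bilinear_kills_null:
  assumes L: "module R L" and \<phi>: "bilinear_on R N P L \<phi>" and u: "u \<in> H"
  shows "lin_ext R L \<phi> u = \<zero>\<^bsub>L\<^esub>"
proof -
  interpret L: module R L by fact
  interpret F: module R F by (rule F_module)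
  note b = bilinear_onD[OF \<phi>]
  have \<phi>X: "\<phi> \<in> carrier N \<times> carrier P \<rightarrow> carrier L" using b(1) by auto
  have hom: "lin_ext R L \<phi> \<in> mod_hom R F L" by (rule lin_ext_hom[OF L \<phi>X])
  have be: "lin_ext R L \<phi> (e (x, y)) = \<phi> (x, y)" if "x \<in> carrier N" "y \<in> carrier P" for x y
    by (rule lin_ext_basis[OF L \<phi>X]) (use that in simp)
  note hs = mod_homD[OF hom] and hm = mod_hom_minus[OF F_module L hom]
  note c = F.M.add.m_closed F.smult_closed e_carr
  have "tensor_relations R N P \<subseteq> a_kernel F L (lin_ext R L \<phi>)"
  proof
    fix v assume v: "v \<in> tensor_relations R N P"
    then have "lin_ext R L \<phi> v = \<zero>\<^bsub>L\<^esub>"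
      unfolding tensor_relations_def Let_def
      by (auto simp: hm hs be b c L.M.r_neg a_minus_def[of L] simp del: free_module_simps)
    then show "v \<in> a_kernel F L (lin_ext R L \<phi>)" using v relations_carr by (auto simp: a_kernel_def')
  qed
  then have "H \<subseteq> a_kernel F L (lin_ext R L \<phi>)"
    unfolding tensor_null_def by (rule module_span_least[OF submodule_kernel[OF F_module L hom]])
  then show ?thesis using u by (auto simp: a_kernel_def')
qed

text \<open>
  The map \<^const>\<open>tensor_map\<close> is defined as the only value of a linear extension on a coset; the
  value is unique because the extension vanishes on the null submodule.
\<close>

lemma tensor_map_coset:
  assumes T': "tensor R N' P'" and \<phi>: "\<phi> \<in> mod_hom R N N'" and \<psi>: "\<psi> \<in> mod_hom R P P'"
    and x: "x \<in> carrier N" and y: "y \<in> carrier P"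
  shows "tensor_map R N' P' \<phi> \<psi> (pure_tensor R N P x y) = pure_tensor R N' P' (\<phi> x) (\<psi> y)"
proof -
  interpret T': tensor R N' P' by fact
  interpret F: module R F by (rule F_module)
  interpret Q: quotient H R F by (rule quotient)
  let ?\<beta> = "\<lambda>(x, y). pure_tensor R N' P' (\<phi> x) (\<psi> y)"
  note p = mod_homD[OF \<phi>] and q = mod_homD[OF \<psi>]
  have bil: "bilinear_on R N P T'.T ?\<beta>"
    unfolding bilinear_on_def by (simp add: p q T'.pure_simps)
  have \<beta>X: "?\<beta> \<in> carrier N \<times> carrier P \<rightarrow> carrier T'.T" using bilinear_onD(1)[OF bil] by auto
  note hom = lin_ext_hom[OF T'.T_module \<beta>X]
  have exy: "e (x, y) \<in> carrier F" by (rule e_carr[OF x y])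
  have be: "lin_ext R T'.T ?\<beta> (e (x, y)) = pure_tensor R N' P' (\<phi> x) (\<psi> y)"
    using lin_ext_basis[OF T'.T_module \<beta>X, of "(x, y)"] x y by simp
  have "lin_ext R T'.T ?\<beta> u = pure_tensor R N' P' (\<phi> x) (\<psi> y)"
    if u: "u \<in> H +>\<^bsub>F\<^esub> e (x, y)" for u
  proof -
    obtain h where h: "h \<in> H" "u = h \<oplus>\<^bsub>F\<^esub> e (x, y)" using u by (auto simp: a_r_coset_def')
    have hc: "h \<in> carrier F" by (rule F.submodule_carr[OF null_sub h(1)])
    interpret T: module R T'.T by (rule T'.T_module)
    have "pure_tensor R N' P' (\<phi> x) (\<psi> y) \<in> carrier T'.T"
      by (rule T'.pure_simps(1)[OF p(1)[OF x] q(1)[OF y]])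
    then show ?thesis unfolding h(2)
      using mod_homD(2)[OF hom hc exy] bilinear_kills_null[OF T'.T_module bil h(1)] be by simp
  qed
  moreover have "e (x, y) \<in> H +>\<^bsub>F\<^esub> e (x, y)" by (rule Q.coset_self[OF exy])
  ultimately have "lin_ext R T'.T ?\<beta> ` (H +>\<^bsub>F\<^esub> e (x, y)) = {pure_tensor R N' P' (\<phi> x) (\<psi> y)}" by blast
  then show ?thesis unfolding tensor_map_def pure_eq by simp
qed

end

section \<open>Tensoring with a residue ring\<close>

lemma (in abelian_group) minus_eq_zero_iff:
  assumes "x \<in> carrier G" "y \<in> carrier G"
  shows "x \<ominus> y = \<zero> \<longleftrightarrow> x = y"
  using minus_equality[of x "\<ominus> y"] assms by (auto simp: a_minus_def r_neg)

lemma regular_module_module: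
  assumes "cring R" shows "module R (regular_module R)"
proof -
  interpret cring R by fact
  have inv: "\<exists>y\<in>carrier R. y \<oplus>\<^bsub>R\<^esub> x = \<zero>\<^bsub>R\<^esub>" if "x \<in> carrier R" for x
    using l_neg[OF that] a_inv_closed[OF that] by blast
  show ?thesis
    by (rule moduleI[OF assms abelian_groupI])
       (auto simp: regular_module_def a_ac m_assoc l_distr r_distr intro: inv)
qed

lemma ideal_submodule_regular:
  assumes "cring R" "ideal I R" shows "submodule I R (regular_module R)"
proof -
  interpret ideal I R by fact
  interpret M: module R "regular_module R" by (rule regular_module_module[OF assms(1)])
  show ?thesis
    by (rule M.submoduleI') (auto simp: regular_module_def Icarr I_l_closed)
qed

abbreviation residue_module :: "('a, 'r) ring_scheme \<Rightarrow> 'a set \<Rightarrow> ('a, 'a set) module" where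
  "residue_module R I \<equiv> quotient_module R (regular_module R) I"

text \<open>
  The map \<open>p \<mapsto> 1 \<otimes> p\<close> from \<open>P\<close> to \<open>R/I \<otimes> P\<close>. It is surjective with
  kernel \<open>I P\<close>, so that it replaces the isomorphism \<open>P/IP \<cong> R/I \<otimes> P\<close> in all
  computations below.
\<close>

definition residue_tensor ::
  "('a, 'r) ring_scheme \<Rightarrow> 'a set \<Rightarrow> ('a, 'c, 'n) module_scheme \<Rightarrow> 'c \<Rightarrow> ('a set \<times> 'c \<Rightarrow> 'a) set" where
  "residue_tensor R I P p =
     pure_tensor R (residue_module R I) P (I +>\<^bsub>regular_module R\<^esub> \<one>\<^bsub>R\<^esub>) p"

locale residue = ideal I R + P?: module R P for I and R (structure) and P (structure)
begin

abbreviation "L \<equiv> regular_module R"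
abbreviation "N \<equiv> residue_module R I"
abbreviation "\<tau> \<equiv> residue_tensor R I P"
abbreviation "IP \<equiv> ideal_smult P I (carrier P)"

lemma L_simps: "carrier L = carrier R" "\<zero>\<^bsub>L\<^esub> = \<zero>" "x \<oplus>\<^bsub>L\<^esub> y = x \<oplus> y" "r \<odot>\<^bsub>L\<^esub> x = r \<otimes> x"
  by (simp_all add: regular_module_def)

lemma q: "quotient I R L"
  by (rule quotientI[OF regular_module_module[OF R.is_cring] ideal_submodule_regular[OF R.is_cring is_ideal]])

lemma N_module: "module R N" by (rule quotient.Q_module[OF q])

lemma tensor: "tensor R N P" by (rule tensor.intro[OF N_module P.module_axioms])

abbreviation "T \<equiv> tensor_module R N P"

lemma T_module: "module R T" by (rule tensor.T_module[OF tensor])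

lemma IP_sub: "submodule IP R P"
  by (rule ideal_smult_submodule[OF P.module_axioms is_ideal P.carrier_is_submodule])

lemma coset_N: "r \<in> carrier R \<Longrightarrow> I +>\<^bsub>L\<^esub> r \<in> carrier N"
  unfolding quotient.Q_carrier[OF q] L_simps by (rule imageI)

lemma coset_smult: "r \<in> carrier R \<Longrightarrow> I +>\<^bsub>L\<^esub> r = r \<odot>\<^bsub>N\<^esub> (I +>\<^bsub>L\<^esub> \<one>)"
  using quotient.Q_smult[OF q, of r \<one>] by (simp add: L_simps)

lemma tau_hom: "\<tau> \<in> mod_hom R P T"
  unfolding mod_hom_def residue_tensor_def
  by (simp add: tensor.pure_simps[OF tensor] coset_N)

lemma tau_smult:
  assumes "r \<in> carrier R" "p \<in> carrier P"
  shows "pure_tensor R N P (I +>\<^bsub>L\<^esub> r) p = \<tau> (r \<odot>\<^bsub>P\<^esub> p)"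
  using assms unfolding residue_tensor_def
  by (simp add: coset_smult[OF assms(1)] tensor.pure_simps[OF tensor] coset_N)

text \<open>
  It suffices to reach the pure tensors, and \<open>r \<otimes> p = 1 \<otimes> r p\<close>.
\<close>

lemma tau_surj: "\<tau> ` carrier P = carrier T"
proof -
  interpret X: tensor R N P by (rule tensor)
  interpret Q: quotient X.H R X.F by (rule X.quotient)
  interpret TM: module R T by (rule T_module)
  have im: "submodule (\<tau> ` carrier P) R T"
    by (rule submodule_image[OF P.module_axioms T_module tau_hom P.carrier_is_submodule])
  have ch: "Q.coset \<in> mod_hom R X.F T" unfolding X.T_eq by (rule Q.coset_hom)
  let ?W = "{f \<in> carrier X.F. Q.coset f \<in> \<tau> ` carrier P}"
  have W: "submodule ?W R X.F" by (rule submodule_vimage[OF X.F_module T_module ch im])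
  have "f \<in> ?W" if f: "f \<in> carrier X.F" for f
  proof (rule submodule_free_basis[OF R.is_cring W _ f])
    fix z assume "z \<in> carrier N \<times> carrier P"
    then obtain r p where rp: "r \<in> carrier R" "p \<in> carrier P" "z = (I +>\<^bsub>L\<^esub> r, p)"
      unfolding quotient.Q_carrier[OF q] L_simps by blast
    have "Q.coset (X.e z) = \<tau> (r \<odot>\<^bsub>P\<^esub> p)"
      using tau_smult[OF rp(1,2)] unfolding rp(3) X.pure_eq .
    moreover have "X.e z \<in> carrier X.F" unfolding rp(3) by (rule X.e_carr[OF coset_N[OF rp(1)] rp(2)])
    ultimately show "X.e z \<in> ?W" using rp(1,2) by simp
  qed
  then have "carrier T \<subseteq> \<tau> ` carrier P" unfolding X.T_eq Q.Q_carrier by blast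
  then show ?thesis using TM.submodule_carr[OF im] by blast
qed

text \<open>
  To see that \<open>1 \<otimes> p = 0\<close> forces \<open>p \<in> I P\<close>, use the bilinear map
  \<open>(r + I, y) \<mapsto> r y + I P\<close>, which by the universal property kills the null submodule. It
  sends \<open>(1, p)\<close> to \<open>p + I P\<close>.
\<close>

lemma tau_zero_iff:
  assumes p: "p \<in> carrier P"
  shows "\<tau> p = \<zero>\<^bsub>T\<^esub> \<longleftrightarrow> p \<in> IP"
proof
  interpret X: tensor R N P by (rule tensor)
  interpret TM: module R T by (rule T_module)
  assume "p \<in> IP"
  then show "\<tau> p = \<zero>\<^bsub>T\<^esub>"
  proof induction
    case zero show ?case by (rule mod_hom_zero[OF P.module_axioms T_module tau_hom])
  next
    case (smult a x)
    have a: "a \<in> carrier R" using smult Icarr by blast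
    have z: "I +>\<^bsub>L\<^esub> a = \<zero> \<odot>\<^bsub>N\<^esub> (I +>\<^bsub>L\<^esub> \<one>)"
      using quotient.coset_eq_zero_iff[OF q, of a] quotient.coset_zero[OF q] a smult(1) coset_smult[of \<zero>]
      by (simp add: L_simps)
    have "\<tau> (a \<odot>\<^bsub>P\<^esub> x) = pure_tensor R N P (I +>\<^bsub>L\<^esub> a) x" using tau_smult[OF a smult(2)] by simp
    also have "\<dots> = \<zero> \<odot>\<^bsub>T\<^esub> pure_tensor R N P (I +>\<^bsub>L\<^esub> \<one>) x"
      unfolding z using X.pure_simps(4)[of \<zero>] coset_N smult(2) by simp
    also have "\<dots> = \<zero>\<^bsub>T\<^esub>" using X.pure_simps(1) coset_N smult(2) by simp
    finally show ?case .
  next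
    case (add u v)
    have "u \<in> carrier P" "v \<in> carrier P" using add P.submodule_carr[OF IP_sub] by auto
    then show ?case using mod_homD(2)[OF tau_hom] add by simp
  qed
next
  interpret X: tensor R N P by (rule tensor)
  interpret Q: quotient IP R P by (rule quotientI[OF P.module_axioms IP_sub])
  interpret B: quotient X.H R X.F by (rule X.quotient)
  assume t: "\<tau> p = \<zero>\<^bsub>T\<^esub>"
  define \<rho> :: "'a set \<Rightarrow> 'a" where "\<rho> Y = (SOME r. r \<in> Y)" for Y
  have Ncar: "\<exists>r\<in>carrier R. Y = I +>\<^bsub>L\<^esub> r" if "Y \<in> carrier N" for Y
    using that unfolding quotient.Q_carrier[OF q] L_simps by blast
  have \<rho>: "\<rho> Y \<in> carrier R" "Y = I +>\<^bsub>L\<^esub> \<rho> Y" if Y: "Y \<in> carrier N" for Y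
  proof -
    obtain r where r: "r \<in> carrier R" "Y = I +>\<^bsub>L\<^esub> r" using Ncar[OF Y] by blast
    have "r \<in> Y" unfolding r(2) by (rule quotient.coset_self[OF q]) (use r in \<open>simp add: L_simps\<close>)
    then have s: "\<rho> Y \<in> Y" unfolding \<rho>_def by (rule someI)
    then show c: "\<rho> Y \<in> carrier R"
      using quotient.coset_carr[OF q, of r] r by (simp add: L_simps)
    show "Y = I +>\<^bsub>L\<^esub> \<rho> Y"
      using s r c quotient.mem_coset_iff[OF q, of "\<rho> Y" r] quotient.coset_eq_iff[OF q, of "\<rho> Y" r]
      by (simp add: L_simps)
  qed
  \<comment> \<open>the class of \<open>r y\<close> modulo \<open>I P\<close> depends on \<open>r + I\<close> only, so \<open>\<rho>\<close> may choose any representative\<close>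
  have indep: "Q.coset (r \<odot>\<^bsub>P\<^esub> y) = Q.coset (\<rho> Y \<odot>\<^bsub>P\<^esub> y)"
    if r: "r \<in> carrier R" and Y: "Y = I +>\<^bsub>L\<^esub> r" and y: "y \<in> carrier P" for r Y y
  proof -
    have YN: "Y \<in> carrier N" unfolding Y by (rule coset_N[OF r])
    have "r \<ominus>\<^bsub>L\<^esub> \<rho> Y \<in> I"
      using quotient.coset_eq_iff[OF q, of r "\<rho> Y"] r \<rho>[OF YN] Y by (simp add: L_simps)
    moreover have "r \<ominus>\<^bsub>L\<^esub> \<rho> Y = r \<ominus> \<rho> Y"
      by (simp add: a_minus_def a_inv_def regular_module_def m_inv_def)
    ultimately have "(r \<ominus> \<rho> Y) \<odot>\<^bsub>P\<^esub> y \<in> IP" by (simp add: ideal_smult.smult y)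
    moreover have "(r \<ominus> \<rho> Y) \<odot>\<^bsub>P\<^esub> y = r \<odot>\<^bsub>P\<^esub> y \<ominus>\<^bsub>P\<^esub> \<rho> Y \<odot>\<^bsub>P\<^esub> y"
      using r y \<rho>(1)[OF YN] by (simp add: a_minus_def P.smult_l_distr P.smult_l_minus)
    ultimately show ?thesis using Q.coset_eq_iff r y \<rho>(1)[OF YN] by simp
  qed
  define \<phi> where "\<phi> = (\<lambda>(Y, y). Q.coset (\<rho> Y \<odot>\<^bsub>P\<^esub> y))"
  have \<phi>: "\<phi> (I +>\<^bsub>L\<^esub> r, y) = Q.coset (r \<odot>\<^bsub>P\<^esub> y)" if "r \<in> carrier R" "y \<in> carrier P" for r y
    unfolding \<phi>_def using indep[OF that(1) refl that(2)] by simp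
  have cc: "Q.coset y \<in> carrier Q.Q" if "y \<in> carrier P" for y
    using mod_homD(1)[OF Q.coset_hom that] .
  note addN = quotient.Q_add[OF q] and smN = quotient.Q_smult[OF q]
  have bil: "bilinear_on R N P Q.Q \<phi>"
    unfolding bilinear_on_def
  proof (intro conjI ballI)
    fix Y y assume Y: "Y \<in> carrier N" and y: "y \<in> carrier P"
    obtain r where r: "r \<in> carrier R" "Y = I +>\<^bsub>L\<^esub> r" using Ncar[OF Y] by blast
    show "\<phi> (Y, y) \<in> carrier Q.Q" using r y by (simp add: \<phi> cc)
    fix y' assume y': "y' \<in> carrier P"
    show "\<phi> (Y, y \<oplus>\<^bsub>P\<^esub> y') = \<phi> (Y, y) \<oplus>\<^bsub>Q.Q\<^esub> \<phi> (Y, y')"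
      using r y y' by (simp add: \<phi> Q.Q_add P.smult_r_distr)
  next
    fix Y Y' y assume Y: "Y \<in> carrier N" "Y' \<in> carrier N" and y: "y \<in> carrier P"
    obtain r where r: "r \<in> carrier R" "Y = I +>\<^bsub>L\<^esub> r" using Ncar[OF Y(1)] by blast
    obtain r' where r': "r' \<in> carrier R" "Y' = I +>\<^bsub>L\<^esub> r'" using Ncar[OF Y(2)] by blast
    show "\<phi> (Y \<oplus>\<^bsub>N\<^esub> Y', y) = \<phi> (Y, y) \<oplus>\<^bsub>Q.Q\<^esub> \<phi> (Y', y)"
      using r r' y addN[of r r'] by (simp add: \<phi> Q.Q_add P.smult_l_distr L_simps)
  next
    fix a Y y assume a: "a \<in> carrier R" and Y: "Y \<in> carrier N" and y: "y \<in> carrier P"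
    obtain r where r: "r \<in> carrier R" "Y = I +>\<^bsub>L\<^esub> r" using Ncar[OF Y] by blast
    show "\<phi> (a \<odot>\<^bsub>N\<^esub> Y, y) = a \<odot>\<^bsub>Q.Q\<^esub> \<phi> (Y, y)"
      using r a y smN[of a r] by (simp add: \<phi> Q.Q_smult P.smult_assoc1 L_simps)
    have "r \<odot>\<^bsub>P\<^esub> (a \<odot>\<^bsub>P\<^esub> y) = a \<odot>\<^bsub>P\<^esub> (r \<odot>\<^bsub>P\<^esub> y)"
      using r a y by (simp add: P.smult_assoc1[symmetric] R.m_comm)
    then show "\<phi> (Y, a \<odot>\<^bsub>P\<^esub> y) = a \<odot>\<^bsub>Q.Q\<^esub> \<phi> (Y, y)"
      using r a y by (simp add: \<phi> Q.Q_smult)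
  qed
  let ?e = "X.e (I +>\<^bsub>L\<^esub> \<one>, p)"
  have ec: "?e \<in> carrier X.F" by (rule X.e_carr[OF coset_N[OF one_closed] p])
  have "B.coset ?e = X.H" using t unfolding residue_tensor_def X.pure_eq X.T_eq B.Q_zero .
  then have "?e \<in> X.H" using B.coset_eq_zero_iff[OF ec] by simp
  then have "lin_ext R Q.Q \<phi> ?e = \<zero>\<^bsub>Q.Q\<^esub>" by (rule X.bilinear_kills_null[OF Q.Q_module bil])
  moreover have "lin_ext R Q.Q \<phi> ?e = \<phi> (I +>\<^bsub>L\<^esub> \<one>, p)"
    by (rule lin_ext_basis[OF Q.Q_module, of _ "carrier N \<times> carrier P"])
       (use bilinear_onD(1)[OF bil] coset_N[OF one_closed] p in auto)
  ultimately have "Q.coset p = IP" using \<phi>[OF one_closed p] p by (simp add: Q.Q_zero)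
  then show "p \<in> IP" using Q.coset_eq_zero_iff[OF p] by simp
qed

end

lemma residue_tensor_map:
  assumes "residue I R P" "residue I R P'" and d: "d \<in> mod_hom R P P'" and p: "p \<in> carrier P"
  shows "tensor_map R (residue_module R I) P' (\<lambda>x. x) d (residue_tensor R I P p) = residue_tensor R I P' (d p)"
proof -
  interpret A: residue I R P by fact
  interpret B: residue I R P' by fact
  show ?thesis unfolding residue_tensor_def
    by (rule tensor.tensor_map_coset[OF A.tensor B.tensor mod_hom_id d A.coset_N[OF A.one_closed] p])
qed

section \<open>Vanishing of Tor as purity of a syzygy\<close>

text \<open>
  Lift cycles and boundaries of \<open>R/I \<otimes> P\<close> along \<open>p \<mapsto> 1 \<otimes> p\<close>. The class \<open>1 \<otimes> p\<close> is a cycle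
  if \<open>d p \<in> I P\<close>, and a boundary if \<open>p\<close> agrees modulo \<open>I P\<close> with an element of the image of \<open>d\<close>.
\<close>

lemma homology_zero_iff:
  assumes I: "ideal I R" and P: "\<And>n. module R (P n)" and d: "\<And>n. d n \<in> mod_hom R (P (Suc n)) (P n)"
  shows "zero_module (homology_module R (\<lambda>i. tensor_module R (residue_module R I) (P i))
            (\<lambda>i. tensor_map R (residue_module R I) (P i) (\<lambda>x. x) (d i)) (Suc n)) \<longleftrightarrow>
    (\<forall>p\<in>carrier (P (Suc n)). d n p \<in> ideal_smult (P n) I (carrier (P n)) \<longrightarrow>
       (\<exists>q\<in>carrier (P (Suc (Suc n))).
          p \<ominus>\<^bsub>P (Suc n)\<^esub> d (Suc n) q \<in> ideal_smult (P (Suc n)) I (carrier (P (Suc n)))))"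
    (is "zero_module (homology_module R ?T ?\<delta> _) \<longleftrightarrow> ?rhs")
proof -
  have res: "residue I R (P i)" for i using I P by (simp add: residue_def)
  let ?\<tau> = "\<lambda>i. residue_tensor R I (P i)"
  interpret P1: module R "P (Suc n)" by (rule P)
  interpret T1: module R "?T (Suc n)" by (rule residue.T_module[OF res])
  note hom = residue.tau_hom[OF res] and surj = residue.tau_surj[OF res] and dh = mod_homD[OF d]
  have map: "?\<delta> i (?\<tau> (Suc i) p) = ?\<tau> i (d i p)" if "p \<in> carrier (P (Suc i))" for i p
    by (rule residue_tensor_map[OF res res d that])
  let ?Z = "cycles ?T ?\<delta> (Suc n)" and ?B = "?\<delta> (Suc n) ` carrier (?T (Suc (Suc n)))"
  have Beq: "?B = ?\<tau> (Suc n) ` d (Suc n) ` carrier (P (Suc (Suc n)))"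
    unfolding surj[symmetric] image_image by (rule image_cong[OF refl map])
  have Bsub: "submodule ?B R (?T (Suc n))"
    unfolding Beq
    by (rule submodule_image[OF P residue.T_module[OF res] hom submodule_image[OF P P d module.carrier_is_submodule[OF P]]])
  have tZ: "?\<tau> (Suc n) p \<in> ?Z \<longleftrightarrow> d n p \<in> ideal_smult (P n) I (carrier (P n))"
    if p: "p \<in> carrier (P (Suc n))" for p
    using mod_homD(1)[OF hom p] residue.tau_zero_iff[OF res dh(1)[OF p]] map[OF p]
    by (simp add: a_kernel_def')
  have tB: "?\<tau> (Suc n) p \<in> ?B \<longleftrightarrow> (\<exists>q\<in>carrier (P (Suc (Suc n))).
          p \<ominus>\<^bsub>P (Suc n)\<^esub> d (Suc n) q \<in> ideal_smult (P (Suc n)) I (carrier (P (Suc n))))"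
    if p: "p \<in> carrier (P (Suc n))" for p
  proof -
    have "?\<tau> (Suc n) p = ?\<tau> (Suc n) w \<longleftrightarrow> p \<ominus>\<^bsub>P (Suc n)\<^esub> w \<in> ideal_smult (P (Suc n)) I (carrier (P (Suc n)))"
      if w: "w \<in> carrier (P (Suc n))" for w
    proof -
      have "p \<ominus>\<^bsub>P (Suc n)\<^esub> w \<in> carrier (P (Suc n))" using p w by simp
      from residue.tau_zero_iff[OF res this] show ?thesis
        using mod_hom_minus[OF P residue.T_module[OF res] hom p w] mod_homD(1)[OF hom p] mod_homD(1)[OF hom w]
        by (simp add: T1.M.minus_eq_zero_iff)
    qed
    then show ?thesis unfolding Beq using dh(1) by blast
  qed
  let ?C = "(?T (Suc n))\<lparr>carrier := ?Z\<rparr>"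
  have car: "carrier (homology_module R ?T ?\<delta> (Suc n)) = (\<lambda>u. ?B +>\<^bsub>?T (Suc n)\<^esub> u) ` ?Z"
    by (auto simp: homology_module_def quotient_module_def A_RCOSETS_def' a_r_coset_def' )
  have z: "\<zero>\<^bsub>homology_module R ?T ?\<delta> (Suc n)\<^esub> = ?B"
    by (simp add: homology_module_def quotient_module_def)
  have Zc: "?Z \<subseteq> carrier (?T (Suc n))" by (auto simp: a_kernel_def')
  interpret Q: quotient ?B R "?T (Suc n)" by (rule quotientI[OF T1.module_axioms Bsub])
  have "\<zero>\<^bsub>?T (Suc n)\<^esub> \<in> ?Z"
    using tZ[OF P1.M.zero_closed] mod_hom_zero[OF P residue.T_module[OF res] hom] mod_hom_zero[OF P P d]
      ideal_smult.zero by metis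
  then have "zero_module (homology_module R ?T ?\<delta> (Suc n)) \<longleftrightarrow> (\<forall>u\<in>?Z. ?B +>\<^bsub>?T (Suc n)\<^esub> u = ?B)"
    unfolding zero_module_def car z by blast
  also have "\<dots> \<longleftrightarrow> (\<forall>u\<in>?Z. u \<in> ?B)"
    by (rule ball_cong[OF refl]) (rule Q.coset_eq_zero_iff[OF subsetD[OF Zc]])
  also have "\<dots> \<longleftrightarrow> (\<forall>p\<in>carrier (P (Suc n)). ?\<tau> (Suc n) p \<in> ?Z \<longrightarrow> ?\<tau> (Suc n) p \<in> ?B)"
  proof -
    have "(\<forall>u\<in>A. u \<in> B) \<longleftrightarrow> (\<forall>p\<in>C. f p \<in> A \<longrightarrow> f p \<in> B)" if "A \<subseteq> f ` C" for A B :: "'z set" and C f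
      using that by blast
    moreover have "?Z \<subseteq> ?\<tau> (Suc n) ` carrier (P (Suc n))" using Zc by (simp only: surj)
    ultimately show ?thesis .
  qed
  also have "\<dots> \<longleftrightarrow> ?rhs" by (rule ball_cong[OF refl]) (simp only: tZ tB)
  finally show ?thesis .
qed

text \<open>
  The kernel inside \<open>P n\<close>, which in the usual count is the syzygy of index \<open>n + 1\<close>: the
  differential out of \<open>P 0\<close> is the augmentation.
\<close>

definition syzygy where
  "syzygy M P d \<epsilon> n = (case n of 0 \<Rightarrow> a_kernel (P 0) M \<epsilon> | Suc k \<Rightarrow> a_kernel (P (Suc k)) (P k) (d k))"

lemma projective_resolutionD:
  assumes "projective_resolution R M P d \<epsilon>"
  shows "projective_module R (P n)" "module R (P n)" "d n \<in> mod_hom R (P (Suc n)) (P n)"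
    "\<epsilon> \<in> mod_hom R (P 0) M" "\<epsilon> ` carrier (P 0) = carrier M"
    "d n ` carrier (P (Suc n)) = syzygy M P d \<epsilon> n"
proof -
  have a: "\<forall>n. projective_module R (P n)" "\<forall>n. d n \<in> mod_hom R (P (Suc n)) (P n)" "\<epsilon> \<in> mod_hom R (P 0) M"
    "\<epsilon> ` carrier (P 0) = carrier M" "d 0 ` carrier (P 1) = a_kernel (P 0) M \<epsilon>"
    "\<forall>n. d (Suc n) ` carrier (P (Suc (Suc n))) = a_kernel (P (Suc n)) (P n) (d n)"
    using assms unfolding projective_resolution_def by simp_all
  show "projective_module R (P n)" by (rule a(1)[rule_format])
  then show "module R (P n)" by (simp add: projective_module_def)
  show "d n \<in> mod_hom R (P (Suc n)) (P n)" by (rule a(2)[rule_format])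
  show "\<epsilon> \<in> mod_hom R (P 0) M" "\<epsilon> ` carrier (P 0) = carrier M" by (rule a)+
  show "d n ` carrier (P (Suc n)) = syzygy M P d \<epsilon> n"
  proof (cases n)
    case 0 then show ?thesis using a by (simp add: syzygy_def)
  next
    case (Suc k) then show ?thesis using a by (simp add: syzygy_def)
  qed
qed

lemma syzygy_submodule:
  assumes "module R M" "projective_resolution R M P d \<epsilon>"
  shows "submodule (syzygy M P d \<epsilon> n) R (P n)"
proof (cases n)
  case 0
  then show ?thesis
    using submodule_kernel[OF projective_resolutionD(2)[OF assms(2)] assms(1) projective_resolutionD(4)[OF assms(2)]]
    by (simp add: syzygy_def)
next
  case (Suc k)
  note r = projective_resolutionD[OF assms(2)]
  show ?thesis using submodule_kernel[OF r(2) r(2) r(3)] Suc by (simp add: syzygy_def)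
qed

text \<open>
  By exactness \<open>d n\<close> maps \<open>P (n + 1)\<close> onto the syzygy \<open>K\<close> in \<open>P n\<close>, and \<open>I P (n + 1)\<close>
  onto \<open>I K\<close>, and the kernel of \<open>d n\<close> consists of the boundaries. So \<open>p\<close> agrees modulo \<open>I P (n + 1)\<close> with a
  boundary if and only if \<open>d p \<in> I K\<close>.
\<close>

lemma Tor_zero_iff_pure:
  fixes M :: "('a, 'b, 'm) module_scheme"
  assumes M: "module R M" and I: "ideal I R"
    and res: "projective_resolution R M P d \<epsilon>" and ch: "chosen_resolution R M = (P, d)"
  shows "zero_module (Tor (Suc n) R (residue_module R I) M) \<longleftrightarrow> pure_for (P n) I (syzygy M P d \<epsilon> n)"
proof -
  note r = projective_resolutionD[OF res]
  interpret P0: module R "P n" by (rule r)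
  interpret P1: module R "P (Suc n)" by (rule r)
  note dh = mod_homD[OF r(3)]
  let ?IP = "\<lambda>n. ideal_smult (P n) I (carrier (P n))"
  have IK: "ideal_smult (P n) I (syzygy M P d \<epsilon> n) = d n ` ?IP (Suc n)"
    unfolding r(6)[symmetric] by (rule ideal_smult_image[OF r(2) r(2) r(3) I P1.carrier_is_submodule, symmetric])
  have IPc: "u \<in> carrier (P (Suc n))" if "u \<in> ?IP (Suc n)" for u
    using P1.submodule_carr[OF ideal_smult_submodule[OF r(2) I P1.carrier_is_submodule] that] .
  have ker: "x \<in> d (Suc n) ` carrier (P (Suc (Suc n))) \<longleftrightarrow> x \<in> carrier (P (Suc n)) \<and> d n x = \<zero>\<^bsub>P n\<^esub>" for x
    unfolding r(6) by (simp add: syzygy_def a_kernel_def')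
  have "(\<exists>q\<in>carrier (P (Suc (Suc n))). p \<ominus>\<^bsub>P (Suc n)\<^esub> d (Suc n) q \<in> ?IP (Suc n)) \<longleftrightarrow> d n p \<in> d n ` ?IP (Suc n)"
    if p: "p \<in> carrier (P (Suc n))" for p
  proof
    assume "\<exists>q\<in>carrier (P (Suc (Suc n))). p \<ominus>\<^bsub>P (Suc n)\<^esub> d (Suc n) q \<in> ?IP (Suc n)"
    then obtain q where q: "q \<in> carrier (P (Suc (Suc n)))" "p \<ominus>\<^bsub>P (Suc n)\<^esub> d (Suc n) q \<in> ?IP (Suc n)" by blast
    have "d (Suc n) q \<in> carrier (P (Suc n))" "d n (d (Suc n) q) = \<zero>\<^bsub>P n\<^esub>" using ker q(1) by blast+
    then have "d n (p \<ominus>\<^bsub>P (Suc n)\<^esub> d (Suc n) q) = d n p"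
      using mod_hom_minus[OF r(2) r(2) r(3) p] dh(1)[OF p] by (simp add: a_minus_def)
    then show "d n p \<in> d n ` ?IP (Suc n)" using q(2) by (metis imageI)
  next
    assume "d n p \<in> d n ` ?IP (Suc n)"
    then obtain w where w: "w \<in> ?IP (Suc n)" "d n p = d n w" by blast
    note wc = IPc[OF w(1)]
    have "d n (p \<ominus>\<^bsub>P (Suc n)\<^esub> w) = \<zero>\<^bsub>P n\<^esub>"
      using mod_hom_minus[OF r(2) r(2) r(3) p wc] w(2) dh(1)[OF wc] by (simp add: a_minus_def P0.M.r_neg)
    then obtain q where q: "q \<in> carrier (P (Suc (Suc n)))" "p \<ominus>\<^bsub>P (Suc n)\<^esub> w = d (Suc n) q"
      using ker[of "p \<ominus>\<^bsub>P (Suc n)\<^esub> w"] p wc by auto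
    have "p \<ominus>\<^bsub>P (Suc n)\<^esub> (p \<ominus>\<^bsub>P (Suc n)\<^esub> w) = w"
      using p wc by (simp add: a_minus_def P1.M.minus_add P1.M.a_assoc[symmetric] P1.M.r_neg)
    then show "\<exists>q\<in>carrier (P (Suc (Suc n))). p \<ominus>\<^bsub>P (Suc n)\<^esub> d (Suc n) q \<in> ?IP (Suc n)"
      using q w(1) by metis
  qed
  then show ?thesis
    unfolding Tor_def ch prod.case homology_zero_iff[of I R P d, OF I r(2) r(3)] pure_for_def IK
    unfolding r(6)[symmetric] by blast
qed

section \<open>Comparison of projective resolutions\<close>

text \<open>
  The lifting property in \<^const>\<open>projective_module\<close> is restricted to two types. It suffices to
  write \<open>P\<close> as a direct summand of the free module on its carrier, and free modules lift along
  maps of any types. The condition on images, in place of surjectivity of \<open>g\<close>, allows lifting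
  into a syzygy without turning it into a module of its own.
\<close>

lemma projective_lift:
  fixes P :: "('a, 'p) module" and A :: "('a, 'x, 'k) module_scheme" and B :: "('a, 'y, 'l) module_scheme"
  assumes P: "projective_module R P" and A: "module R A" and B: "module R B"
    and g: "g \<in> mod_hom R A B" and f: "f \<in> mod_hom R P B"
    and im: "f ` carrier P \<subseteq> g ` carrier A"
  shows "\<exists>h\<in>mod_hom R P A. \<forall>x\<in>carrier P. g (h x) = f x"
proof -
  have Pm: "module R P" using P by (simp add: projective_module_def)
  interpret P: module R P by fact
  let ?F = "free_module R (carrier P)"
  have F: "module R ?F" by (rule module_free_module[OF P.R.is_cring])
  have id: "(\<lambda>x. x) \<in> carrier P \<rightarrow> carrier P" by simp
  let ?s = "lin_ext R P (\<lambda>x. x)"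
  have s: "?s \<in> mod_hom R ?F P" by (rule lin_ext_hom[OF Pm id])
  have "?s ` carrier ?F = carrier P" by (rule lin_ext_surj[OF Pm]) simp
  then obtain j where j: "j \<in> mod_hom R P ?F" "\<And>x. x \<in> carrier P \<Longrightarrow> ?s (j x) = x"
    using P s F Pm mod_hom_id unfolding projective_module_def by blast
  define \<phi> where "\<phi> x = (SOME a. a \<in> carrier A \<and> g a = f x)" for x
  have \<phi>: "\<phi> x \<in> carrier A \<and> g (\<phi> x) = f x" if "x \<in> carrier P" for x
  proof -
    have "f x \<in> g ` carrier A" using im that by blast
    then have "\<exists>a. a \<in> carrier A \<and> g a = f x" by auto
    then show ?thesis unfolding \<phi>_def by (rule someI_ex)
  qed
  then have \<phi>X: "\<phi> \<in> carrier P \<rightarrow> carrier A" by auto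
  let ?L = "lin_ext R A \<phi>"
  have L: "?L \<in> mod_hom R ?F A" by (rule lin_ext_hom[OF A \<phi>X])
  have eq: "g (?L u) = f (?s u)" if u: "u \<in> carrier ?F" for u
  proof (rule free_hom_eqI[OF B mod_hom_comp[OF L g] mod_hom_comp[OF s f] _ u])
    fix x assume x: "x \<in> carrier P"
    show "g (?L (free_basis R x)) = f (?s (free_basis R x))"
      unfolding lin_ext_basis[OF A \<phi>X x] lin_ext_basis[OF Pm id x] using \<phi>[OF x] by simp
  qed
  show ?thesis
  proof (rule bexI[OF _ mod_hom_comp[OF j(1) L]], rule ballI)
    fix x assume x: "x \<in> carrier P"
    show "g (?L (j x)) = f x" using eq[OF mod_homD(1)[OF j(1) x]] j(2)[OF x] by simp
  qed
qed

lemma mod_hom_diff: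
  assumes "module R M" "module R N" and f: "f \<in> mod_hom R M N" and g: "g \<in> mod_hom R M N"
  shows "(\<lambda>x. f x \<ominus>\<^bsub>N\<^esub> g x) \<in> mod_hom R M N"
proof -
  interpret M: module R M by fact
  interpret N: module R N by fact
  note h = mod_homD[OF f] mod_homD[OF g]
  show ?thesis unfolding mod_hom_def
    by (auto simp: h a_minus_def N.smult_r_distr N.smult_r_minus N.M.minus_add N.M.a_ac)
qed

lemma mod_hom_sum:
  assumes "module R M" "module R N" and f: "f \<in> mod_hom R M N" and g: "g \<in> mod_hom R M N"
  shows "(\<lambda>x. f x \<oplus>\<^bsub>N\<^esub> g x) \<in> mod_hom R M N"
proof -
  interpret M: module R M by fact
  interpret N: module R N by fact
  note h = mod_homD[OF f] mod_homD[OF g]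
  show ?thesis unfolding mod_hom_def
    by (auto simp: h N.smult_r_distr N.M.a_ac)
qed

text \<open>
  Maps \<open>U\<close> and \<open>V\<close> between \<open>P\<close> and \<open>P'\<close> that respect the submodules \<open>S\<close> and
  \<open>S'\<close>, such that \<open>V U\<close> differs from the identity of \<open>S\<close> by a map \<open>h\<close> that is defined on all
  of \<open>P\<close>. For syzygies this is the trace, in one degree, of a homotopy equivalence: \<open>h\<close> is the
  differential after the homotopy.
\<close>

definition comparison_maps where
  "comparison_maps R P S P' S' U V h \<longleftrightarrow>
     U \<in> mod_hom R P P' \<and> V \<in> mod_hom R P' P \<and> h \<in> mod_hom R P P \<and>
     U ` S \<subseteq> S' \<and> V ` S' \<subseteq> S \<and> h ` carrier P \<subseteq> S \<and> (\<forall>x\<in>S. V (U x) = x \<oplus>\<^bsub>P\<^esub> h x)"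

lemma comparison_mapsD:
  assumes "comparison_maps R P S P' S' U V h"
  shows "U \<in> mod_hom R P P'" "V \<in> mod_hom R P' P" "h \<in> mod_hom R P P"
    "U ` S \<subseteq> S'" "V ` S' \<subseteq> S" "h ` carrier P \<subseteq> S" "x \<in> S \<Longrightarrow> V (U x) = x \<oplus>\<^bsub>P\<^esub> h x"
  using assms by (simp_all add: comparison_maps_def)

text \<open>
  One step up along two resolutions. \<open>U\<close> and \<open>V\<close> are lifts of \<open>u\<close> and \<open>v\<close>. The error
  \<open>h = V U - id - k \<pi>1\<close> is defined on \<open>P1\<close> and is killed by \<open>\<pi>1\<close>; on the kernel of
  \<open>\<pi>1\<close> the last term vanishes.
\<close>

lemma comparison_step:
  assumes N: "module R N1" "module R N2" and P: "projective_module R P1" "projective_module R P2"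
    and \<pi>: "\<pi>1 \<in> mod_hom R P1 N1" "\<pi>2 \<in> mod_hom R P2 N2"
    and u: "u \<in> mod_hom R N1 N2" and v: "v \<in> mod_hom R N2 N1" and k: "k \<in> mod_hom R N1 P1"
    and im: "u ` \<pi>1 ` carrier P1 \<subseteq> \<pi>2 ` carrier P2" "v ` \<pi>2 ` carrier P2 \<subseteq> \<pi>1 ` carrier P1"
    and vu: "\<And>x. x \<in> \<pi>1 ` carrier P1 \<Longrightarrow> v (u x) = x \<oplus>\<^bsub>N1\<^esub> \<pi>1 (k x)"
  shows "\<exists>U V h. comparison_maps R P1 (a_kernel P1 N1 \<pi>1) P2 (a_kernel P2 N2 \<pi>2) U V h"
proof -
  have Pm: "module R P1" "module R P2" using P by (auto simp: projective_module_def)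
  interpret P1: module R P1 by fact
  interpret P2: module R P2 by fact
  interpret N1: module R N1 by fact
  interpret N2: module R N2 by fact
  obtain U where U: "U \<in> mod_hom R P1 P2" "\<And>x. x \<in> carrier P1 \<Longrightarrow> \<pi>2 (U x) = u (\<pi>1 x)"
    using projective_lift[OF P(1) Pm(2) N(2) \<pi>(2) mod_hom_comp[OF \<pi>(1) u]] im(1) by blast
  obtain V where V: "V \<in> mod_hom R P2 P1" "\<And>x. x \<in> carrier P2 \<Longrightarrow> \<pi>1 (V x) = v (\<pi>2 x)"
    using projective_lift[OF P(2) Pm(1) N(1) \<pi>(1) mod_hom_comp[OF \<pi>(2) v]] im(2) by blast
  let ?k = "\<lambda>x. k (\<pi>1 x)"
  define h where "h = (\<lambda>x. V (U x) \<ominus>\<^bsub>P1\<^esub> (x \<oplus>\<^bsub>P1\<^esub> ?k x))"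
  have kh: "?k \<in> mod_hom R P1 P1" by (rule mod_hom_comp[OF \<pi>(1) k])
  have sh: "(\<lambda>x. x \<oplus>\<^bsub>P1\<^esub> ?k x) \<in> mod_hom R P1 P1" by (rule mod_hom_sum[OF Pm(1) Pm(1) mod_hom_id kh])
  have hh: "h \<in> mod_hom R P1 P1"
    unfolding h_def by (rule mod_hom_diff[OF Pm(1) Pm(1) mod_hom_comp[OF U(1) V(1)] sh])
  note Uc = mod_homD(1)[OF U(1)] and Vc = mod_homD(1)[OF V(1)] and kc = mod_homD(1)[OF kh]
    and pc = mod_homD(1)[OF \<pi>(1)]
  note zeros = mod_hom_zero[OF N(1) N(2) u] mod_hom_zero[OF N(2) N(1) v] mod_hom_zero[OF N(1) Pm(1) k]
  have "\<pi>1 (h x) = \<zero>\<^bsub>N1\<^esub>" if x: "x \<in> carrier P1" for x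
  proof -
    have "\<pi>1 (h x) = \<pi>1 (V (U x)) \<ominus>\<^bsub>N1\<^esub> (\<pi>1 x \<oplus>\<^bsub>N1\<^esub> \<pi>1 (?k x))"
      unfolding h_def using x Uc Vc kc
      by (simp add: mod_hom_minus[OF Pm(1) N(1) \<pi>(1)] mod_homD(2)[OF \<pi>(1)])
    also have "\<pi>1 (V (U x)) = \<pi>1 x \<oplus>\<^bsub>N1\<^esub> \<pi>1 (?k x)"
      using V(2)[OF Uc[OF x]] U(2)[OF x] vu[OF imageI[OF x]] by simp
    finally show ?thesis using x pc kc by (simp add: a_minus_def N1.M.r_neg)
  qed
  then have hK: "h ` carrier P1 \<subseteq> a_kernel P1 N1 \<pi>1"
    using mod_homD(1)[OF hh] by (auto simp: a_kernel_def')
  have VU: "V (U x) = x \<oplus>\<^bsub>P1\<^esub> h x" if "x \<in> a_kernel P1 N1 \<pi>1" for x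
  proof -
    have x: "x \<in> carrier P1" "?k x = \<zero>\<^bsub>P1\<^esub>" using that zeros by (auto simp: a_kernel_def')
    have "x \<oplus>\<^bsub>P1\<^esub> h x = V (U x)"
      unfolding h_def using x Uc Vc by (simp add: a_minus_def P1.M.a_lcomm[of x "V (U x)"] P1.M.r_neg)
    then show ?thesis by simp
  qed
  have "U ` a_kernel P1 N1 \<pi>1 \<subseteq> a_kernel P2 N2 \<pi>2" "V ` a_kernel P2 N2 \<pi>2 \<subseteq> a_kernel P1 N1 \<pi>1"
    using Uc Vc U(2) V(2) zeros by (auto simp: a_kernel_def')
  then have "comparison_maps R P1 (a_kernel P1 N1 \<pi>1) P2 (a_kernel P2 N2 \<pi>2) U V h"
    unfolding comparison_maps_def using U(1) V(1) hh hK VU by simp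
  then show ?thesis by (intro exI)
qed

text \<open>
  Induction along the resolutions, starting from the identity of \<open>M\<close>. The error map \<open>h\<close> of one
  step takes values in the image of the next differential and hence lifts to the map \<open>k\<close> that the
  next step needs.
\<close>

lemma comparison:
  fixes P :: "nat \<Rightarrow> ('a, 'p) module" and P' :: "nat \<Rightarrow> ('a, 'q) module"
  assumes M: "module R M" and r: "projective_resolution R M P d \<epsilon>" and r': "projective_resolution R M P' d' \<epsilon>'"
  shows "\<exists>U V h. comparison_maps R (P n) (syzygy M P d \<epsilon> n) (P' n) (syzygy M P' d' \<epsilon>' n) U V h"
proof (induction n)
  note D = projective_resolutionD[OF r] and D' = projective_resolutionD[OF r']
  case 0
  interpret M: module R M by fact
  interpret P0: module R "P 0" by (rule D)
  have k: "(\<lambda>_. \<zero>\<^bsub>P 0\<^esub>) \<in> mod_hom R M (P 0)" by (auto simp: mod_hom_def)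
  have "\<epsilon> \<zero>\<^bsub>P 0\<^esub> = \<zero>\<^bsub>M\<^esub>" by (rule mod_hom_zero[OF D(2) M D(4)])
  then have id: "x = x \<oplus>\<^bsub>M\<^esub> \<epsilon> \<zero>\<^bsub>P 0\<^esub>" if "x \<in> \<epsilon> ` carrier (P 0)" for x using that D(5) by simp
  have im: "(\<lambda>x. x) ` \<epsilon> ` carrier (P 0) \<subseteq> \<epsilon>' ` carrier (P' 0)" "(\<lambda>x. x) ` \<epsilon>' ` carrier (P' 0) \<subseteq> \<epsilon> ` carrier (P 0)"
    using D(5) D'(5) by simp_all
  show ?case
    using comparison_step[OF M M D(1) D'(1) D(4) D'(4) mod_hom_id mod_hom_id k im id] by (simp add: syzygy_def)
next
  note D = projective_resolutionD[OF r] and D' = projective_resolutionD[OF r']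
  case (Suc n)
  then obtain U V h where "comparison_maps R (P n) (syzygy M P d \<epsilon> n) (P' n) (syzygy M P' d' \<epsilon>' n) U V h"
    by (elim exE)
  note * = comparison_mapsD[OF this]
  obtain k where k: "k \<in> mod_hom R (P n) (P (Suc n))" "\<And>x. x \<in> carrier (P n) \<Longrightarrow> d n (k x) = h x"
    using projective_lift[OF D(1) D(2) D(2) D(3) *(3) *(6)[folded D(6)]] by blast
  have vu: "V (U x) = x \<oplus>\<^bsub>P n\<^esub> d n (k x)" if "x \<in> d n ` carrier (P (Suc n))" for x
    using that *(7) k(2) module.submodule_carr[OF D(2) syzygy_submodule[OF M r]] unfolding D(6) by simp
  show ?case
    using comparison_step[OF D(2) D'(2) D(1) D'(1) D(3) D'(3) *(1,2) k(1) _ _ vu] *(4,5) D(6) D'(6)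
    by (simp add: syzygy_def)
qed

lemma ideal_smult_mono: "K \<subseteq> L \<Longrightarrow> u \<in> ideal_smult M I K \<Longrightarrow> u \<in> ideal_smult M I L"
  by (erule ideal_smult.induct) (auto intro: ideal_smult.intros)

text \<open>
  This expresses that the vanishing of Tor does not depend on the resolution. If \<open>x\<close> is in the
  syzygy and in \<open>I P\<close>, then \<open>U x\<close> is in \<open>I S'\<close> by purity, so \<open>V U x \<in> I S\<close>. Also
  \<open>h x \<in> I S\<close>, because \<open>h\<close> maps all of \<open>P\<close> into \<open>S\<close>. The difference of the two is \<open>x\<close>.
\<close>

lemma pure_for_transfer:
  fixes P :: "nat \<Rightarrow> ('a, 'p) module" and P' :: "nat \<Rightarrow> ('a, 'q) module"
  assumes M: "module R M" and I: "ideal I R" and r: "projective_resolution R M P d \<epsilon>"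
    and r': "projective_resolution R M P' d' \<epsilon>'"
    and pure: "pure_for (P' n) I (syzygy M P' d' \<epsilon>' n)"
  shows "pure_for (P n) I (syzygy M P d \<epsilon> n)"
proof -
  note D = projective_resolutionD[OF r] and D' = projective_resolutionD[OF r']
  interpret P: module R "P n" by (rule D)
  interpret P': module R "P' n" by (rule D')
  let ?S = "syzygy M P d \<epsilon> n" and ?S' = "syzygy M P' d' \<epsilon>' n"
  note S = syzygy_submodule[OF M r, of n] and S' = syzygy_submodule[OF M r', of n]
  obtain U V h where "comparison_maps R (P n) ?S (P' n) ?S' U V h"
    using comparison[OF M r r', of n] by (elim exE)
  note * = comparison_mapsD[OF this]
  show ?thesis unfolding pure_for_def
  proof
    fix x assume "x \<in> ?S \<inter> ideal_smult (P n) I (carrier (P n))"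
    then have x: "x \<in> ?S" "x \<in> ideal_smult (P n) I (carrier (P n))" by auto
    have xc: "x \<in> carrier (P n)" by (rule P.submodule_carr[OF S x(1)])
    have "U x \<in> ideal_smult (P' n) I (U ` carrier (P n))"
      using imageI[OF x(2), of U] unfolding ideal_smult_image[OF D(2) D'(2) *(1) I P.carrier_is_submodule] .
    then have "U x \<in> ideal_smult (P' n) I (carrier (P' n))"
      by (rule ideal_smult_mono[rotated]) (use mod_homD(1)[OF *(1)] in blast)
    then have "U x \<in> ideal_smult (P' n) I ?S'" using pure *(4) x(1) unfolding pure_for_def by blast
    from imageI[OF this, of V] have "V (U x) \<in> ideal_smult (P n) I (V ` ?S')"
      unfolding ideal_smult_image[OF D'(2) D(2) *(2) I S'] .
    then have VU: "V (U x) \<in> ideal_smult (P n) I ?S" by (rule ideal_smult_mono[OF *(5)])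
    from imageI[OF x(2), of h] have "h x \<in> ideal_smult (P n) I (h ` carrier (P n))"
      unfolding ideal_smult_image[OF D(2) D(2) *(3) I P.carrier_is_submodule] .
    then have h: "h x \<in> ideal_smult (P n) I ?S" by (rule ideal_smult_mono[OF *(6)])
    have "V (U x) \<ominus>\<^bsub>P n\<^esub> h x \<in> ideal_smult (P n) I ?S"
      by (rule P.submodule_minus[OF ideal_smult_submodule[OF D(2) I S] VU h])
    also have "V (U x) \<ominus>\<^bsub>P n\<^esub> h x = x"
      unfolding *(7)[OF x(1)] using xc mod_homD(1)[OF *(3) xc] by (simp add: a_minus_def P.M.a_assoc P.M.r_neg)
    finally show "x \<in> ideal_smult (P n) I ?S" .
  qed
qed

section \<open>Minimal free resolutions and truncation\<close>

text \<open>
  Submodules of \<open>K\<close> as a module of its own are submodules of \<open>M\<close>, so generation inside \<open>M\<close>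
  and inside \<open>K\<close> is the same.
\<close>

lemma submodule_fg_module:
  assumes M: "module R M" and K: "submodule K R M" and S: "S \<subseteq> K" "finite S" "K \<subseteq> module_span R M S"
  shows "finitely_generated_module R (M\<lparr>carrier := K\<rparr>)"
proof -
  interpret M: module R M by fact
  let ?N = "M\<lparr>carrier := K\<rparr>"
  have N: "module R ?N" by (rule submodule.submodule_is_module[OF K M])
  interpret N: module R ?N by (rule N)
  have "module_span R ?N S \<subseteq> K"
    using module_span_least[OF N.carrier_is_submodule] S(1) by simp
  moreover have "K \<subseteq> H" if H: "submodule H R ?N" "S \<subseteq> H" for H
  proof -
    have "submodule H R M"
      by (rule M.submoduleI')
         (use N.submodule_carr[OF H(1)] M.submodule_carr[OF K] N.submodule_zero[OF H(1)]
            N.submodule_add[OF H(1)] N.submodule_smult[OF H(1)] in auto)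
    then show ?thesis using module_span_least[OF _ H(2)] S(3) by blast
  qed
  ultimately have "module_span R ?N S = K" unfolding module_span_def by blast
  then show ?thesis unfolding finitely_generated_module_def using N S by auto
qed

text \<open>
  Iterate minimal covers; each syzygy is finitely generated as a submodule of a finite free
  module.
\<close>

lemma (in noetherian_local_ring) minimal_free_resolution:
  fixes M :: "('a, 'n, 'k) module_scheme"
  assumes M: "finitely_generated_module R M" and inf: "infinite (UNIV :: 'i set)"
  obtains X :: "nat \<Rightarrow> 'i set" and d \<epsilon> where "\<And>n. finite (X n)"
    "projective_resolution R M (\<lambda>n. free_module R (X n)) d \<epsilon>"
    "\<And>n f x. f \<in> syzygy M (\<lambda>n. free_module R (X n)) d \<epsilon> n \<Longrightarrow> f x \<in> \<mm>"
proof -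
  let ?F = "free_module R :: 'i set \<Rightarrow> _"
  have Mm: "module R M" using M by (simp add: finitely_generated_module_def)
  have Fm: "module R (?F X)" for X by (rule module_free_module[OF is_cring])
  obtain X0 :: "'i set" and \<epsilon> where X0: "finite X0" "\<epsilon> \<in> mod_hom R (?F X0) M"
    "\<epsilon> ` carrier (?F X0) = carrier M" "\<And>f x. f \<in> a_kernel (?F X0) M \<epsilon> \<Longrightarrow> f x \<in> \<mm>"
    using minimal_cover[OF M inf] by blast
  \<comment> \<open>a stage is a finite basis set together with the syzygy in the free module on it\<close>
  define good where "good = (\<lambda>(X, K). finite X \<and> submodule K R (?F X) \<and> (\<forall>f\<in>K. \<forall>x. f x \<in> \<mm>))"
  define next_stage where "next_stage = (\<lambda>(X, K) (Y, L). \<exists>\<delta>. \<delta> \<in> mod_hom R (?F Y) (?F X) \<and>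
      \<delta> ` carrier (?F Y) = K \<and> L = a_kernel (?F Y) (?F X) \<delta>)"
  let ?s0 = "(X0, a_kernel (?F X0) M \<epsilon>)"
  have s0: "good ?s0" using X0 submodule_kernel[OF Fm Mm X0(2)] by (auto simp: good_def)
  have step: "\<exists>t. good t \<and> next_stage s t" if s: "good s" for s
  proof -
    obtain X K where XK: "s = (X, K)" by (cases s)
    have X: "finite X" and K: "submodule K R (?F X)" using s by (auto simp: good_def XK)
    let ?N = "(?F X)\<lparr>carrier := K\<rparr>"
    obtain S where "S \<subseteq> K" "finite S" "K \<subseteq> module_span R (?F X) S"
      using free_submodule_fg[OF is_cring noetherian_ring_axioms X K] by blast
    then have N: "finitely_generated_module R ?N" by (rule submodule_fg_module[OF Fm K])
    obtain Y :: "'i set" and \<delta> where Y: "finite Y" "\<delta> \<in> mod_hom R (?F Y) ?N"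
      "\<delta> ` carrier (?F Y) = carrier ?N" "\<And>f x. f \<in> a_kernel (?F Y) ?N \<delta> \<Longrightarrow> f x \<in> \<mm>"
      using minimal_cover[OF N inf] by blast
    have ker: "a_kernel (?F Y) ?N \<delta> = a_kernel (?F Y) (?F X) \<delta>" by (simp add: a_kernel_def')
    have \<delta>: "\<delta> \<in> mod_hom R (?F Y) (?F X)"
      using Y(2) module.submodule_carr[OF Fm K] by (auto simp: mod_hom_def simp del: free_module_simps)
    have "good (Y, a_kernel (?F Y) (?F X) \<delta>)"
      using Y(1,4) submodule_kernel[OF Fm Fm \<delta>] unfolding ker by (auto simp: good_def)
    moreover have "next_stage s (Y, a_kernel (?F Y) (?F X) \<delta>)"
      using \<delta> Y(3) by (auto simp: next_stage_def XK)
    ultimately show ?thesis by blast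
  qed
  have "\<exists>s. \<forall>n. (good (s n) \<and> (n = 0 \<longrightarrow> s n = ?s0)) \<and> next_stage (s n) (s (Suc n))"
    by (rule dependent_nat_choice) (use s0 step in auto)
  then obtain s where s: "\<And>n. good (s n)" "s 0 = ?s0" "\<And>n. next_stage (s n) (s (Suc n))" by blast
  let ?X = "\<lambda>n. fst (s n)" and ?K = "\<lambda>n. snd (s n)"
  have "\<exists>\<delta>. \<delta> \<in> mod_hom R (?F (?X (Suc n))) (?F (?X n)) \<and> \<delta> ` carrier (?F (?X (Suc n))) = ?K n \<and>
      ?K (Suc n) = a_kernel (?F (?X (Suc n))) (?F (?X n)) \<delta>" for n
    using s(3)[of n] by (simp add: next_stage_def split_beta)
  then obtain d where d: "\<And>n. d n \<in> mod_hom R (?F (?X (Suc n))) (?F (?X n))"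
    "\<And>n. d n ` carrier (?F (?X (Suc n))) = ?K n"
    "\<And>n. ?K (Suc n) = a_kernel (?F (?X (Suc n))) (?F (?X n)) (d n)" by metis
  have res: "projective_resolution R M (\<lambda>n. ?F (?X n)) d \<epsilon>"
    unfolding projective_resolution_def
    using d X0 s(2) by (simp add: projective_free_module[OF is_cring])
  have syz: "syzygy M (\<lambda>n. ?F (?X n)) d \<epsilon> n = ?K n" for n
    using projective_resolutionD(6)[OF res, of n] d(2)[of n] by simp
  show thesis
  proof (rule that[OF _ res])
    show "finite (?X n)" for n using s(1)[of n] by (simp add: good_def split_beta)
    show "f x \<in> \<mm>" if "f \<in> syzygy M (\<lambda>n. ?F (?X n)) d \<epsilon> n" for n f x
      using that s(1)[of n] unfolding syz by (simp add: good_def split_beta)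
  qed
qed

text \<open>
  If the syzygy in degree \<open>n\<close> vanishes, all terms above degree \<open>n\<close> can be replaced by the free
  module on the empty set.
\<close>

lemma truncated_resolution:
  fixes X :: "nat \<Rightarrow> 'i set"
  assumes cr: "cring R" and res: "projective_resolution R M (\<lambda>n. free_module R (X n)) d \<epsilon>"
    and zero: "syzygy M (\<lambda>n. free_module R (X n)) d \<epsilon> n = {\<zero>\<^bsub>free_module R (X n)\<^esub>}"
  shows "\<exists>(P :: nat \<Rightarrow> ('a, 'i \<Rightarrow> 'a) module) d'. projective_resolution R M P d' \<epsilon> \<and> (\<forall>i>n. zero_module (P i))"
proof -
  interpret R: cring R by fact
  note D = projective_resolutionD[OF res]
  let ?z = "\<lambda>_. \<zero>\<^bsub>R\<^esub>"
  define Y where "Y = (\<lambda>i. if i \<le> n then X i else {})"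
  define d' where "d' = (\<lambda>i. if i < n then d i else (\<lambda>_. ?z))"
  let ?P = "\<lambda>i. free_module R (Y i)"
  have triv: "carrier (?P i) = {?z}" if "n < i" for i
    using that by (auto simp: Y_def free_module_def)
  have Pm: "module R (?P i)" for i by (rule module_free_module[OF cr])
  have zc: "?z \<in> carrier (?P i)" for i by (auto simp: free_module_def)
  have d'_hom: "d' i \<in> mod_hom R (?P (Suc i)) (?P i)" for i
    using D(3)[of i] zc[of i] by (auto simp: d'_def Y_def mod_hom_def)
  have im: "d' i ` carrier (?P (Suc i)) = syzygy M ?P d' \<epsilon> i" for i
  proof -
    consider "i < n" | "i = n" | "n < i" by linarith
    then show ?thesis
    proof cases
      case 1
      then have "syzygy M ?P d' \<epsilon> i = syzygy M (\<lambda>n. free_module R (X n)) d \<epsilon> i"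
        by (cases i) (auto simp: syzygy_def d'_def Y_def)
      then show ?thesis using D(6)[of i] 1 by (simp add: d'_def Y_def)
    next
      case 2
      then have "syzygy M ?P d' \<epsilon> i = syzygy M (\<lambda>n. free_module R (X n)) d \<epsilon> i"
        by (cases i) (auto simp: syzygy_def d'_def Y_def)
      then show ?thesis using zero 2 triv[of "Suc i"] by (simp add: d'_def)
    next
      case 3
      then show ?thesis using triv[of i] triv[of "Suc i"]
        by (cases i) (auto simp: syzygy_def d'_def a_kernel_def')
    qed
  qed
  have "projective_resolution R M ?P d' \<epsilon>"
    unfolding projective_resolution_def
  proof (intro conjI allI)
    show "projective_module R (?P i)" for i by (rule projective_free_module[OF cr])
    show "d' i \<in> mod_hom R (?P (Suc i)) (?P i)" for i by (rule d'_hom)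
    have "Y 0 = X 0" by (simp add: Y_def)
    then show "\<epsilon> \<in> mod_hom R (?P 0) M" "\<epsilon> ` carrier (?P 0) = carrier M" using D(4,5) by simp_all
    show "d' 0 ` carrier (?P 1) = a_kernel (?P 0) M \<epsilon>" using im[of 0] by (simp add: syzygy_def)
    show "d' (Suc i) ` carrier (?P (Suc (Suc i))) = a_kernel (?P (Suc i)) (?P i) (d' i)" for i
      using im[of "Suc i"] by (simp add: syzygy_def)
  qed
  moreover have "zero_module (?P i)" if "n < i" for i using triv[OF that] by (simp add: zero_module_def)
  ultimately show ?thesis by blast
qed

section \<open>Projective dimension and the vanishing of Tor\<close>

text \<open>
  With \<open>t = n + 1\<close>, the vanishing of Tor says that the syzygy in degree \<open>n\<close> of the chosen resolution
  is pure. If the projective dimension is less than \<open>t\<close>, a short resolution has zero syzygy in degree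
  \<open>n\<close>, and purity passes from it to the chosen one. Conversely, purity passes from the chosen
  resolution to a minimal one, whose syzygy is then zero, so that it can be truncated.
\<close>

theorem corollary3p3:
  fixes R :: "('a, 'r) ring_scheme" and \<mm> I :: "'a set"
    and M :: "('a, 'b, 'm) module_scheme" and t :: nat
  assumes "local_ring R \<mm>" and "noetherian_ring R"
    and "ideal I R" and "primary_to R \<mm> I" and "integrally_closed_ideal R I"
    and "finitely_generated_module R M"
    and "t \<ge> 1"
  shows "projective_dimension R M < enat t \<longleftrightarrow>
         zero_module (Tor t R (quotient_module R (regular_module R) I) M)"
proof -
  interpret noetherian_local_ring R \<mm> by (rule noetherian_local_ring.intro) fact+
  have M: "module R M" using assms(6) by (simp add: finitely_generated_module_def)
  obtain n where t: "t = Suc n" using assms(7) by (cases t) auto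
  obtain P d where ch: "chosen_resolution R M = (P, d)" by (cases "chosen_resolution R M")
  obtain \<epsilon> where res: "projective_resolution R M P d \<epsilon>" using chosen_resolution[OF M ch] by blast
  have Tor: "zero_module (Tor t R (residue_module R I) M) \<longleftrightarrow> pure_for (P n) I (syzygy M P d \<epsilon> n)"
    unfolding t by (rule Tor_zero_iff_pure[OF M assms(3) res ch])
  show ?thesis unfolding Tor
  proof
    assume "projective_dimension R M < enat t"
    then obtain k Q e \<eta> where k: "k < t"
      and Q: "projective_resolution R M (Q :: nat \<Rightarrow> ('a, ('a + 'b) list \<Rightarrow> 'a) module) e \<eta>"
      and Qz: "\<forall>i>k. zero_module (Q i)"
      unfolding projective_dimension_def Inf_less_iff by auto
    note D = projective_resolutionD[OF Q]
    have "syzygy M Q e \<eta> n = {\<zero>\<^bsub>Q n\<^esub>}"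
      unfolding D(6)[symmetric] using Qz k t mod_hom_zero[OF D(2) D(2) D(3)] by (simp add: zero_module_def)
    then have "pure_for (Q n) I (syzygy M Q e \<eta> n)"
      by (auto simp: pure_for_def ideal_smult.zero)
    then show "pure_for (P n) I (syzygy M P d \<epsilon> n)" by (rule pure_for_transfer[OF M assms(3) res Q])
  next
    assume pure: "pure_for (P n) I (syzygy M P d \<epsilon> n)"
    obtain X :: "nat \<Rightarrow> ('a + 'b) list set" and e \<eta> where X: "\<And>n. finite (X n)"
      and F: "projective_resolution R M (\<lambda>n. free_module R (X n)) e \<eta>"
      and min: "\<And>n f x. f \<in> syzygy M (\<lambda>n. free_module R (X n)) e \<eta> n \<Longrightarrow> f x \<in> \<mm>"
      using minimal_free_resolution[OF assms(6) infinite_UNIV_listI] by blast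
    have pF: "pure_for (free_module R (X n)) I (syzygy M (\<lambda>n. free_module R (X n)) e \<eta> n)"
      by (rule pure_for_transfer[OF M assms(3) F res pure])
    have "syzygy M (\<lambda>n. free_module R (X n)) e \<eta> n = {\<zero>\<^bsub>free_module R (X n)\<^esub>}"
      by (rule pure_submodule_zero[OF assms(4,5) X syzygy_submodule[OF M F] _ pF]) (rule min)
    from truncated_resolution[OF is_cring F this]
    have "projective_dimension R M \<le> enat n"
      unfolding projective_dimension_def by (intro Inf_lower) blast
    then show "projective_dimension R M < enat t" unfolding t by (simp add: order.strict_trans1)
  qed
qed

end
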